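(* Let $\varepsilon>0$ and consider an instance of 2GGK-C. Let $OPT$ be an optimal packing and let $OPT_{L\&C}$ be a most profitable solution that is packed by a guillotine separable $L\&C$ packing. Then $p(OPT_{L\&C})\ge (\frac34-O(\varepsilon))\,p(OPT)$.
   Context: 2GGK-C: items are axis-aligned rectangles with integral width $w(i)$ and height $h(i)$, all of profit $1$; a feasible solution places a subset of items by translation (no rotation) as pairwise disjoint open rectangles in $[0,N]^2$ such that the packing is guillotine separable (a packing in a rectangle $R$ is guillotine separable if it has at most one item or some horizontal/vertical segment spanning $R$ meets no item interior and splits $R$ into two rectangles whose packings are guillotine separable); $p(S)=|S|$. An item is long if $w(i)>N/2$ or $h(i)>N/2$. Containers are pairwise non-overlapping axis-aligned rectangles labeled large, horizontal, vertical or area: a large container contains a single item; in a horizontal container items are stacked on top of each other; in a vertical container items are placed side by side; an area container of size $a\times b$ only contains items with $w(i)\le\varepsilon a$ and $h(i)\le\varepsilon b$. An $L\&C$ packing consists of a boundary-$\boldsymbol{\mathsf{L}}$ region $([0,N]\times[0,N_1])\cup([0,N_2]\times[0,N])$ containing only long items, together with a number of containers bounded by a function of $\varepsilon$ only (through constants $\varepsilon_{large},\varepsilon_{small}$ determined by $\varepsilon$), placed in the part of the knapsack not occupied by the boundary-$\boldsymbol{\mathsf{L}}$, with all items packed in containers; the containers and the items in them must be guillotine separable. $O(\varepsilon)\le c\varepsilon$ for an absolute constant $c$. *)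

theory Defs
  imports "HOL-Analysis.Analysis"
begin

text \<open>A rectangle is given by its lower left and its upper right corner.\<close>

type_synonym rect = "(real \<times> real) \<times> (real \<times> real)"

definition rect_open :: "rect \<Rightarrow> (real \<times> real) set" where
  "rect_open r = box (fst r) (snd r)"

definition rect_closed :: "rect \<Rightarrow> (real \<times> real) set" where
  "rect_closed r = cbox (fst r) (snd r)"

definition rect_width :: "rect \<Rightarrow> real" where
  "rect_width r = fst (snd r) - fst (fst r)"

definition rect_height :: "rect \<Rightarrow> real" where
  "rect_height r = snd (snd r) - snd (fst r)"

text \<open>
  \<open>guillotine_separable R F\<close> is meant for a finite set \<open>F\<close> of pairwise disjoint rectangles contained
  in \<open>R\<close>. A cut that meets the interior of no member of \<open>F\<close> then leaves each of them on exactly one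
  of its two sides.
\<close>

inductive guillotine_separable :: "rect \<Rightarrow> rect set \<Rightarrow> bool" where
  at_most_one: "F \<subseteq> {r} \<Longrightarrow> guillotine_separable R F"
| vertical_cut:
    "x1 < c \<Longrightarrow> c < x2 \<Longrightarrow>
     (\<And>r. r \<in> F \<Longrightarrow> rect_open r \<inter> ({c} \<times> {y1..y2}) = {}) \<Longrightarrow>
     guillotine_separable ((x1, y1), (c, y2))
       {r \<in> F. rect_closed r \<subseteq> rect_closed ((x1, y1), (c, y2))} \<Longrightarrow>
     guillotine_separable ((c, y1), (x2, y2))
       {r \<in> F. rect_closed r \<subseteq> rect_closed ((c, y1), (x2, y2))} \<Longrightarrow>
     guillotine_separable ((x1, y1), (x2, y2)) F"
| horizontal_cut:
    "y1 < c \<Longrightarrow> c < y2 \<Longrightarrow>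
     (\<And>r. r \<in> F \<Longrightarrow> rect_open r \<inter> ({x1..x2} \<times> {c}) = {}) \<Longrightarrow>
     guillotine_separable ((x1, y1), (x2, c))
       {r \<in> F. rect_closed r \<subseteq> rect_closed ((x1, y1), (x2, c))} \<Longrightarrow>
     guillotine_separable ((x1, c), (x2, y2))
       {r \<in> F. rect_closed r \<subseteq> rect_closed ((x1, c), (x2, y2))} \<Longrightarrow>
     guillotine_separable ((x1, y1), (x2, y2)) F"

definition knapsack :: "nat \<Rightarrow> rect" where
  "knapsack N = ((0, 0), (real N, real N))"

definition ggk_instance :: "nat \<Rightarrow> nat set \<Rightarrow> (nat \<Rightarrow> nat) \<Rightarrow> (nat \<Rightarrow> nat) \<Rightarrow> bool" where
  "ggk_instance N I w h \<longleftrightarrow> N > 0 \<and> finite I \<and> (\<forall>i\<in>I. w i > 0 \<and> h i > 0)"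

text \<open>A packing is a set of items together with the positions of their lower left corners.\<close>

definition item_rect ::
    "(nat \<Rightarrow> nat) \<Rightarrow> (nat \<Rightarrow> nat) \<Rightarrow> (nat \<Rightarrow> real \<times> real) \<Rightarrow> nat \<Rightarrow> rect" where
  "item_rect w h pos i = (pos i, pos i + (real (w i), real (h i)))"

definition feasible_packing ::
    "nat \<Rightarrow> nat set \<Rightarrow> (nat \<Rightarrow> nat) \<Rightarrow> (nat \<Rightarrow> nat) \<Rightarrow> nat set \<Rightarrow> (nat \<Rightarrow> real \<times> real) \<Rightarrow> bool" where
  "feasible_packing N I w h S pos \<longleftrightarrow>
     S \<subseteq> I \<and>
     (\<forall>i\<in>S. rect_open (item_rect w h pos i) \<subseteq> rect_closed (knapsack N)) \<and>
     disjoint_family_on (\<lambda>i. rect_open (item_rect w h pos i)) S \<and>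
     guillotine_separable (knapsack N) (item_rect w h pos ` S)"

definition optimal_packing ::
    "nat \<Rightarrow> nat set \<Rightarrow> (nat \<Rightarrow> nat) \<Rightarrow> (nat \<Rightarrow> nat) \<Rightarrow> nat set \<Rightarrow> (nat \<Rightarrow> real \<times> real) \<Rightarrow> bool" where
  "optimal_packing N I w h S pos \<longleftrightarrow>
     feasible_packing N I w h S pos \<and>
     (\<forall>S' pos'. feasible_packing N I w h S' pos' \<longrightarrow> card S' \<le> card S)"

definition long_item :: "nat \<Rightarrow> (nat \<Rightarrow> nat) \<Rightarrow> (nat \<Rightarrow> nat) \<Rightarrow> nat \<Rightarrow> bool" where
  "long_item N w h i \<longleftrightarrow> real (w i) > real N / 2 \<or> real (h i) > real N / 2"

definition boundary_L :: "nat \<Rightarrow> real \<Rightarrow> real \<Rightarrow> (real \<times> real) set" where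
  "boundary_L N N1 N2 = {0..real N} \<times> {0..N1} \<union> {0..N2} \<times> {0..real N}"

datatype container_label = Large | Horizontal | Vertical | Area

type_synonym container = "container_label \<times> rect"

definition items_in ::
    "(nat \<Rightarrow> nat) \<Rightarrow> (nat \<Rightarrow> nat) \<Rightarrow> nat set \<Rightarrow> (nat \<Rightarrow> real \<times> real) \<Rightarrow> (real \<times> real) set \<Rightarrow> nat set" where
  "items_in w h S pos A = {i \<in> S. rect_open (item_rect w h pos i) \<subseteq> A}"

fun respects_label ::
    "real \<Rightarrow> (nat \<Rightarrow> nat) \<Rightarrow> (nat \<Rightarrow> nat) \<Rightarrow> (nat \<Rightarrow> real \<times> real) \<Rightarrow> container \<Rightarrow> nat set \<Rightarrow> bool" where
  "respects_label \<epsilon> w h pos (Large, r) T \<longleftrightarrow> card T = 1"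
| "respects_label \<epsilon> w h pos (Horizontal, r) T \<longleftrightarrow>
     disjoint_family_on (\<lambda>i. {snd (pos i)<..<snd (pos i) + real (h i)}) T"
| "respects_label \<epsilon> w h pos (Vertical, r) T \<longleftrightarrow>
     disjoint_family_on (\<lambda>i. {fst (pos i)<..<fst (pos i) + real (w i)}) T"
| "respects_label \<epsilon> w h pos (Area, r) T \<longleftrightarrow>
     (\<forall>i\<in>T. real (w i) \<le> \<epsilon> * rect_width r \<and> real (h i) \<le> \<epsilon> * rect_height r)"

text \<open>
  Guillotine separability of an L\&C packing is required on two levels: the knapsack is separated into
  the items of the boundary L and the containers (each container being an uncut rectangle), and
  every container is separated into the items packed in it.
\<close>

definition LC_packing ::
    "real \<Rightarrow> nat \<Rightarrow> nat \<Rightarrow> nat set \<Rightarrow> (nat \<Rightarrow> nat) \<Rightarrow> (nat \<Rightarrow> nat) \<Rightarrow>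
     nat set \<Rightarrow> (nat \<Rightarrow> real \<times> real) \<Rightarrow> bool" where
  "LC_packing \<epsilon> k N I w h S pos \<longleftrightarrow>
     feasible_packing N I w h S pos \<and>
     (\<exists>N1 N2 (Cs :: container set).
        0 \<le> N1 \<and> N1 \<le> real N \<and> 0 \<le> N2 \<and> N2 \<le> real N \<and>
        finite Cs \<and> card Cs \<le> k \<and>
        (\<forall>C\<in>Cs. rect_width (snd C) > 0 \<and> rect_height (snd C) > 0 \<and>
           rect_open (snd C) \<subseteq> rect_closed (knapsack N) - boundary_L N N1 N2) \<and>
        disjoint_family_on (\<lambda>C. rect_open (snd C)) Cs \<and>
        S = items_in w h S pos (boundary_L N N1 N2)
              \<union> (\<Union>C\<in>Cs. items_in w h S pos (rect_closed (snd C))) \<and>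
        (\<forall>i \<in> items_in w h S pos (boundary_L N N1 N2). long_item N w h i) \<and>
        (\<forall>C\<in>Cs. respects_label \<epsilon> w h pos C (items_in w h S pos (rect_closed (snd C)))) \<and>
        guillotine_separable (knapsack N)
          (item_rect w h pos ` items_in w h S pos (boundary_L N N1 N2) \<union> snd ` Cs) \<and>
        (\<forall>C\<in>Cs. guillotine_separable (snd C)
           (item_rect w h pos ` items_in w h S pos (rect_closed (snd C)))))"

definition optimal_LC_packing ::
    "real \<Rightarrow> nat \<Rightarrow> nat \<Rightarrow> nat set \<Rightarrow> (nat \<Rightarrow> nat) \<Rightarrow> (nat \<Rightarrow> nat) \<Rightarrow>
     nat set \<Rightarrow> (nat \<Rightarrow> real \<times> real) \<Rightarrow> bool" where
  "optimal_LC_packing \<epsilon> k N I w h S pos \<longleftrightarrow>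
     LC_packing \<epsilon> k N I w h S pos \<and>
     (\<forall>S' pos'. LC_packing \<epsilon> k N I w h S' pos' \<longrightarrow> card S' \<le> card S)"

end

theory Submission
  imports Defs
begin

text \<open>
  Call an item tall if its height, and wide if its width, is more than a constant fraction of \<open>N\<close>. There are
  only boundedly many items that are both, and items of medium size can be neglected. By symmetry at
  most half of the items are tall, so that it suffices to lose half of the tall ones. If a horizontal cut
  of a box separates tall items from tall items, remove those on the side with fewer of them; that
  side then contains only wide items and can be moved to the top of the box. Applying this to every
  box that still reaches almost from the bottom to the top of the knapsack, removing at most half of
  the tall items leaves a packing with two kinds of columns: those with a wide-only part of constant
  height at the top, and tall items whose height is close to \<open>N\<close>. After dropping the wide items in a suitable
  range of depths, the former columns have a free horizontal strip that is much higher than the total height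
  of the wide items above it. The items of height close to \<open>N\<close> and the long ones among these wide items form
  the boundary L (if the former have total width above \<open>N / 2\<close>, half of them are dropped; they have not
  been halved before), the remaining wide ones are at most half as wide as the knapsack and go into the strip.

  With a free strip everything else can be put into boundedly many containers: stretch the packing
  vertically and align the tall items to a grid of rows. Sub-boxes with the same first cut are
  merged, which leaves boundedly many boxes, each with tall items side by side or with wide items only. In the
  latter, stacked boxes are sorted by the position of their vertical cuts, and shifting their left parts against
  their right parts gives common cuts. The small items are finally filled into the free area.
\<close>

section \<open>Guillotine packings without coordinates\<close>

text \<open>Whether a box can be packed does not depend on which side of a cut lies left or right,
  above or below. Without coordinates, moving a part to the top, sorting slabs and collecting boxes
  with equal cuts are therefore free. A strip of full width is blocked by items of almost full
  height, which is why these become the vertical arm of the L. If a horizontal cut has tall items on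
  both sides, all of them are lower than \<open>1 - \<delta>\<close>; so the two halvings concern
  different items and together cost at most a quarter of all items. The range of depths comes from a
  pigeonhole argument on geometrically growing levels: wide items above depth \<open>s\<close> have
  area at most \<open>s\<close> and width above \<open>\<delta>\<close>, hence total height at most
  \<open>s / \<delta>\<close>, far less than the next level. Small items must be small compared with
  the number of containers, which depends on the sizes of the other items; this causes the gap of
  medium sizes. The constant \<open>4\<close> collects four losses of a fraction
  \<open>\<epsilon>\<close> of the items: medium ones, those in the range of depths, the largest of
  the small ones, and a constant number absorbed since the optimum is large.\<close>

inductive packable :: "(nat \<Rightarrow> real) \<Rightarrow> (nat \<Rightarrow> real) \<Rightarrow> real \<Rightarrow> real \<Rightarrow> nat set \<Rightarrow> bool"
  for w h :: "nat \<Rightarrow> real" where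
  empty: "0 \<le> W \<Longrightarrow> 0 \<le> H \<Longrightarrow> packable w h W H {}"
| item: "0 < w i \<Longrightarrow> w i \<le> W \<Longrightarrow> 0 < h i \<Longrightarrow> h i \<le> H \<Longrightarrow> packable w h W H {i}"
| vcut: "packable w h W1 H A \<Longrightarrow> packable w h W2 H B \<Longrightarrow> A \<inter> B = {} \<Longrightarrow> packable w h (W1 + W2) H (A \<union> B)"
| hcut: "packable w h W H1 A \<Longrightarrow> packable w h W H2 B \<Longrightarrow> A \<inter> B = {} \<Longrightarrow> packable w h W (H1 + H2) (A \<union> B)"

definition area :: "(nat \<Rightarrow> real) \<Rightarrow> (nat \<Rightarrow> real) \<Rightarrow> nat set \<Rightarrow> real" where
  "area w h A = (\<Sum>i\<in>A. w i * h i)"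

lemma area_Un: "finite A \<Longrightarrow> finite B \<Longrightarrow> A \<inter> B = {} \<Longrightarrow> area w h (A \<union> B) = area w h A + area w h B"
  by (simp add: area_def sum.union_disjoint)

lemma packable_nonneg: "packable w h W H A \<Longrightarrow> 0 \<le> W \<and> 0 \<le> H"
  by (induction rule: packable.induct) auto

lemma packable_finite: "packable w h W H A \<Longrightarrow> finite A"
  by (induction rule: packable.induct) auto

lemma packable_dims: "packable w h W H A \<Longrightarrow> i \<in> A \<Longrightarrow> 0 < w i \<and> w i \<le> W \<and> 0 < h i \<and> h i \<le> H"
proof (induction rule: packable.induct)
  case (vcut W1 H A W2 B)
  then show ?case using packable_nonneg[OF vcut.hyps(1)] packable_nonneg[OF vcut.hyps(2)] by fastforce
next
  case (hcut W H1 A H2 B)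
  then show ?case using packable_nonneg[OF hcut.hyps(1)] packable_nonneg[OF hcut.hyps(2)] by fastforce
qed auto

lemma packable_swap: "packable w h W H A \<Longrightarrow> packable h w H W A"
  by (induction rule: packable.induct) (auto intro: packable.intros)

lemma packable_mono:
  assumes "packable w h W H A" "W \<le> W'" "H \<le> H'"
  shows "packable w h W' H' A"
proof -
  note nn = packable_nonneg[OF assms(1)]
  have "packable w h (W + (W' - W)) H (A \<union> {})"
    using assms nn by (intro packable.vcut packable.empty) auto
  then have "packable w h W' (H + (H' - H)) (A \<union> {})"
    using assms nn by (intro packable.hcut packable.empty) auto
  then show ?thesis by simp
qed

lemma packable_vcutI:
  assumes "packable w h W1 H A" "packable w h W2 H B" "A \<inter> B = {}" "W1 + W2 \<le> W"
  shows "packable w h W H (A \<union> B)"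
  using packable_mono[OF packable.vcut[OF assms(1-3)] assms(4)] by simp

lemma packable_hcutI:
  assumes "packable w h W H1 A" "packable w h W H2 B" "A \<inter> B = {}" "H1 + H2 \<le> H"
  shows "packable w h W H (A \<union> B)"
  using packable_mono[OF packable.hcut[OF assms(1-3)] order_refl assms(4)] .

lemma packable_subset: "packable w h W H A \<Longrightarrow> B \<subseteq> A \<Longrightarrow> packable w h W H B"
proof (induction arbitrary: B rule: packable.induct)
  case (item i W H)
  then show ?case by (cases "B = {}") (auto intro: packable.intros dest: subset_singletonD)
next
  case (vcut W1 H A W2 A')
  have "packable w h (W1 + W2) H ((B \<inter> A) \<union> (B \<inter> A'))"
    using vcut by (intro packable.vcut) auto
  moreover have "(B \<inter> A) \<union> (B \<inter> A') = B" using vcut.prems by auto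
  ultimately show ?case by simp
next
  case (hcut W H1 A H2 A')
  have "packable w h W (H1 + H2) ((B \<inter> A) \<union> (B \<inter> A'))"
    using hcut by (intro packable.hcut) auto
  moreover have "(B \<inter> A) \<union> (B \<inter> A') = B" using hcut.prems by auto
  ultimately show ?case by simp
qed (auto intro: packable.intros)

lemma packable_area: "packable w h W H A \<Longrightarrow> area w h A \<le> W * H"
proof (induction rule: packable.induct)
  case (item i W H)
  then show ?case by (auto simp: area_def intro!: mult_mono)
next
  case (vcut W1 H A W2 B)
  then show ?case by (simp add: area_Un packable_finite algebra_simps)
next
  case (hcut W H1 A H2 B)
  then show ?case by (simp add: area_Un packable_finite algebra_simps)
qed (auto simp: area_def)

lemma packable_scale:
  assumes "packable w h W H A" "0 < c"
  shows "packable (\<lambda>i. c * w i) (\<lambda>i. c * h i) (c * W) (c * H) A"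
  using assms(1)
proof (induction rule: packable.induct)
  case (vcut W1 H A W2 B)
  then show ?case by (auto simp: distrib_left intro: packable.vcut)
next
  case (hcut W H1 A H2 B)
  then show ?case by (auto simp: distrib_left intro: packable.hcut)
qed (use assms(2) in \<open>auto intro!: packable.intros\<close>)

lemma packable_row:
  assumes "finite A" "\<And>i. i \<in> A \<Longrightarrow> 0 < w i \<and> 0 < h i \<and> h i \<le> H" "0 \<le> H"
  shows "packable w h (sum w A) H A"
  using assms
proof (induction rule: finite_induct)
  case (insert i A)
  have "packable w h (w i + sum w A) H ({i} \<union> A)"
    using insert by (intro packable.vcut packable.item) auto
  then show ?case using insert by simp
qed (auto intro: packable.intros)

text \<open>The leaves reached by a horizontal line lie side by side, and each one with an item is
  wider than \<open>d\<close>, so at most \<open>W / d\<close> items are lost. \<open>D\<close>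
  takes the item of every such leaf, whether or not the item itself is cut by the line.\<close>

lemma packable_split_wide:
  assumes "packable w h W q A" "\<And>i. i \<in> A \<Longrightarrow> d < w i" "0 \<le> t" "t \<le> q"
  shows "\<exists>A1 A2 D. A = A1 \<union> A2 \<union> D \<and> A1 \<inter> A2 = {} \<and> A1 \<inter> D = {} \<and> A2 \<inter> D = {} \<and>
    packable w h W t A1 \<and> packable w h W (q - t) A2 \<and> d * card D \<le> W"
  using assms
proof (induction arbitrary: t rule: packable.induct)
  case (empty W H)
  then show ?case by (intro exI[of _ "{}"]) (auto intro: packable.empty)
next
  case (item i W H)
  then show ?case
    by (intro exI[of _ "{}"] exI[of _ "{i}"]) (auto intro: packable.empty)
next
  case (vcut W1 H A W2 B)
  obtain A1 A2 D where 1: "A = A1 \<union> A2 \<union> D" "A1 \<inter> A2 = {}" "A1 \<inter> D = {}" "A2 \<inter> D = {}"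
    "packable w h W1 t A1" "packable w h W1 (H - t) A2" "d * card D \<le> W1"
    using vcut.IH(1)[of t] vcut.prems by auto
  obtain B1 B2 E where 2: "B = B1 \<union> B2 \<union> E" "B1 \<inter> B2 = {}" "B1 \<inter> E = {}" "B2 \<inter> E = {}"
    "packable w h W2 t B1" "packable w h W2 (H - t) B2" "d * card E \<le> W2"
    using vcut.IH(2)[of t] vcut.prems by auto
  have fin: "finite D" "finite E"
    using 1(1) 2(1) packable_finite[OF vcut.hyps(1)] packable_finite[OF vcut.hyps(2)] by auto
  have "card (D \<union> E) = card D + card E"
    using fin 1 2 vcut.hyps by (intro card_Un_disjoint) auto
  then have "d * card (D \<union> E) \<le> W1 + W2" using 1 2 by (simp add: distrib_left)
  moreover have "packable w h (W1 + W2) t (A1 \<union> B1)" "packable w h (W1 + W2) (H - t) (A2 \<union> B2)"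
    using 1 2 vcut.hyps by (auto intro!: packable.vcut)
  moreover have "A \<union> B = (A1 \<union> B1) \<union> (A2 \<union> B2) \<union> (D \<union> E)" using 1(1) 2(1) by auto
  moreover have "(A1 \<union> B1) \<inter> (A2 \<union> B2) = {}" "(A1 \<union> B1) \<inter> (D \<union> E) = {}" "(A2 \<union> B2) \<inter> (D \<union> E) = {}"
    using 1(1-4) 2(1-4) vcut.hyps(3) by blast+
  ultimately show ?case by blast
next
  case (hcut W H1 A H2 B)
  show ?case
  proof (cases "t \<le> H1")
    case True
    obtain A1 A2 D where 1: "A = A1 \<union> A2 \<union> D" "A1 \<inter> A2 = {}" "A1 \<inter> D = {}" "A2 \<inter> D = {}"
      "packable w h W t A1" "packable w h W (H1 - t) A2" "d * card D \<le> W"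
      using hcut.IH(1)[of t] hcut.prems True by auto
    have "packable w h W ((H1 - t) + H2) (A2 \<union> B)"
      using 1 hcut.hyps by (auto intro!: packable.hcut)
    then have "packable w h W (H1 + H2 - t) (A2 \<union> B)" by (simp add: algebra_simps)
    moreover have "A \<union> B = A1 \<union> (A2 \<union> B) \<union> D" using 1(1) by auto
    moreover have "A1 \<inter> (A2 \<union> B) = {}" "(A2 \<union> B) \<inter> D = {}"
      using 1(1-4) hcut.hyps(3) by blast+
    ultimately show ?thesis using 1(3,5,7) by blast
  next
    case False
    obtain B1 B2 E where 2: "B = B1 \<union> B2 \<union> E" "B1 \<inter> B2 = {}" "B1 \<inter> E = {}" "B2 \<inter> E = {}"
      "packable w h W (t - H1) B1" "packable w h W (H2 - (t - H1)) B2" "d * card E \<le> W"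
      using hcut.IH(2)[of "t - H1"] hcut.prems False by auto
    have "packable w h W (H1 + (t - H1)) (A \<union> B1)"
      using 2 hcut.hyps by (intro packable.hcut) auto
    then have "packable w h W t (A \<union> B1)" by simp
    moreover have "packable w h W (H1 + H2 - t) B2" using 2(6) by (simp add: algebra_simps)
    moreover have "A \<union> B = (A \<union> B1) \<union> B2 \<union> E" using 2(1) by auto
    moreover have "(A \<union> B1) \<inter> B2 = {}" "(A \<union> B1) \<inter> E = {}"
      using 2(1-4) hcut.hyps(3) by blast+
    ultimately show ?thesis using 2(4,7) by blast
  qed
qed

section \<open>Packings with a bounded number of pieces\<close>

text \<open>The factor \<open>\<kappa>\<close> bounds the area wasted inside containers, so that the rest of the free area is in empty leaves.\<close>

inductive tight_packable :: "(nat \<Rightarrow> real) \<Rightarrow> (nat \<Rightarrow> real) \<Rightarrow> real \<Rightarrow> nat \<Rightarrow> real \<Rightarrow> real \<Rightarrow> nat set \<Rightarrow> bool"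
  for w h :: "nat \<Rightarrow> real" and \<kappa> :: real where
  empty: "1 \<le> k \<Longrightarrow> 0 \<le> W \<Longrightarrow> 0 \<le> H \<Longrightarrow> tight_packable w h \<kappa> k W H {}"
| hcont: "1 \<le> k \<Longrightarrow> finite A \<Longrightarrow> 0 \<le> W \<Longrightarrow>
    (\<And>i. i \<in> A \<Longrightarrow> 0 < w i \<and> 0 < h i \<and> w i \<le> W \<and> \<kappa> * W \<le> w i) \<Longrightarrow>
    tight_packable w h \<kappa> k W (sum h A) A"
| vcont: "1 \<le> k \<Longrightarrow> finite A \<Longrightarrow> 0 \<le> H \<Longrightarrow>
    (\<And>i. i \<in> A \<Longrightarrow> 0 < w i \<and> 0 < h i \<and> h i \<le> H \<and> \<kappa> * H \<le> h i) \<Longrightarrow>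
    tight_packable w h \<kappa> k (sum w A) H A"
| vcut: "tight_packable w h \<kappa> k1 W1 H A \<Longrightarrow> tight_packable w h \<kappa> k2 W2 H B \<Longrightarrow> A \<inter> B = {} \<Longrightarrow>
    tight_packable w h \<kappa> (k1 + k2) (W1 + W2) H (A \<union> B)"
| hcut: "tight_packable w h \<kappa> k1 W H1 A \<Longrightarrow> tight_packable w h \<kappa> k2 W H2 B \<Longrightarrow> A \<inter> B = {} \<Longrightarrow>
    tight_packable w h \<kappa> (k1 + k2) W (H1 + H2) (A \<union> B)"

text \<open>The shape of the final packing inside the inner box of the L. In contrast to
  \<open>tight_packable\<close>, containers may have slack and there are area containers. An empty
  leaf is allowed for every \<open>k\<close>, so \<open>k\<close> bounds the number of containers
  and not the number of leaves.\<close>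

inductive container_packable :: "real \<Rightarrow> (nat \<Rightarrow> real) \<Rightarrow> (nat \<Rightarrow> real) \<Rightarrow> nat \<Rightarrow> real \<Rightarrow> real \<Rightarrow> nat set \<Rightarrow> bool"
  for \<epsilon> :: real and w h :: "nat \<Rightarrow> real" where
  empty: "0 \<le> W \<Longrightarrow> 0 \<le> H \<Longrightarrow> container_packable \<epsilon> w h k W H {}"
| hcont: "1 \<le> k \<Longrightarrow> finite A \<Longrightarrow> 0 \<le> W \<Longrightarrow>
    (\<And>i. i \<in> A \<Longrightarrow> 0 < w i \<and> 0 < h i \<and> w i \<le> W) \<Longrightarrow> sum h A \<le> H \<Longrightarrow> container_packable \<epsilon> w h k W H A"
| vcont: "1 \<le> k \<Longrightarrow> finite A \<Longrightarrow> 0 \<le> H \<Longrightarrow>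
    (\<And>i. i \<in> A \<Longrightarrow> 0 < w i \<and> 0 < h i \<and> h i \<le> H) \<Longrightarrow> sum w A \<le> W \<Longrightarrow> container_packable \<epsilon> w h k W H A"
| acont: "1 \<le> k \<Longrightarrow> packable w h W H A \<Longrightarrow>
    (\<And>i. i \<in> A \<Longrightarrow> w i \<le> \<epsilon> * W \<and> h i \<le> \<epsilon> * H) \<Longrightarrow> container_packable \<epsilon> w h k W H A"
| vcut: "container_packable \<epsilon> w h k1 W1 H A \<Longrightarrow> container_packable \<epsilon> w h k2 W2 H B \<Longrightarrow> A \<inter> B = {} \<Longrightarrow>
    container_packable \<epsilon> w h (k1 + k2) (W1 + W2) H (A \<union> B)"
| hcut: "container_packable \<epsilon> w h k1 W H1 A \<Longrightarrow> container_packable \<epsilon> w h k2 W H2 B \<Longrightarrow> A \<inter> B = {} \<Longrightarrow>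
    container_packable \<epsilon> w h (k1 + k2) W (H1 + H2) (A \<union> B)"

section \<open>Monotonicity, transposition and scaling of packings with boundedly many
  pieces\<close>

lemma tight_packable_mono_k: "tight_packable w h \<kappa> k W H A \<Longrightarrow> k \<le> k' \<Longrightarrow> tight_packable w h \<kappa> k' W H A"
proof (induction arbitrary: k' rule: tight_packable.induct)
  case (vcut k1 W1 H A k2 W2 B)
  have "tight_packable w h \<kappa> (k1 + (k' - k1)) (W1 + W2) H (A \<union> B)"
    using vcut by (intro tight_packable.vcut) auto
  then show ?case using vcut.prems by simp
next
  case (hcut k1 W H1 A k2 H2 B)
  have "tight_packable w h \<kappa> (k1 + (k' - k1)) W (H1 + H2) (A \<union> B)"
    using hcut by (intro tight_packable.hcut) auto
  then show ?case using hcut.prems by simp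
qed (auto intro: tight_packable.empty tight_packable.hcont tight_packable.vcont)

lemma tight_packable_swap: "tight_packable w h \<kappa> k W H A \<Longrightarrow> tight_packable h w \<kappa> k H W A"
  by (induction rule: tight_packable.induct) (auto intro: tight_packable.intros)

lemma tight_packable_facts: "tight_packable w h \<kappa> k W H A \<Longrightarrow> 0 \<le> W \<and> 0 \<le> H \<and> 1 \<le> k \<and> finite A"
proof (induction rule: tight_packable.induct)
  case (hcont k A W)
  then have "0 \<le> sum h A" by (intro sum_nonneg) force
  then show ?case using hcont by auto
next
  case (vcont k A H)
  then have "0 \<le> sum w A" by (intro sum_nonneg) force
  then show ?case using vcont by auto
qed auto

lemma tight_packable_pad:
  assumes "tight_packable w h \<kappa> k W H A" "W \<le> W'" "H \<le> H'"
  shows "tight_packable w h \<kappa> (k + 2) W' H' A"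
proof -
  note nn = tight_packable_facts[OF assms(1)]
  have "tight_packable w h \<kappa> (k + 1) (W + (W' - W)) H (A \<union> {})"
    using assms nn by (intro tight_packable.vcut tight_packable.empty) auto
  then have "tight_packable w h \<kappa> ((k + 1) + 1) W' (H + (H' - H)) (A \<union> {})"
    using assms nn by (intro tight_packable.hcut tight_packable.empty) auto
  then show ?thesis by simp
qed

lemma container_packable_mono_k: "container_packable \<epsilon> w h k W H A \<Longrightarrow> k \<le> k' \<Longrightarrow> container_packable \<epsilon> w h k' W H A"
proof (induction arbitrary: k' rule: container_packable.induct)
  case (vcut k1 W1 H A k2 W2 B)
  have "container_packable \<epsilon> w h (k1 + (k' - k1)) (W1 + W2) H (A \<union> B)"
    using vcut by (intro container_packable.vcut) auto
  then show ?case using vcut.prems by simp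
next
  case (hcut k1 W H1 A k2 H2 B)
  have "container_packable \<epsilon> w h (k1 + (k' - k1)) W (H1 + H2) (A \<union> B)"
    using hcut by (intro container_packable.hcut) auto
  then show ?case using hcut.prems by simp
qed (auto intro: container_packable.intros)

lemma container_packable_swap: "container_packable \<epsilon> w h k W H A \<Longrightarrow> container_packable \<epsilon> h w k H W A"
  by (induction rule: container_packable.induct) (auto intro: container_packable.intros packable_swap)

lemma container_packable_scale:
  assumes "container_packable \<epsilon> w h k W H A" "0 < c"
  shows "container_packable \<epsilon> (\<lambda>i. c * w i) (\<lambda>i. c * h i) k (c * W) (c * H) A"
  using assms(1)
proof (induction rule: container_packable.induct)
  case (hcont k A W H)
  have "sum (\<lambda>i. c * h i) A \<le> c * H"
    using hcont assms(2) by (simp add: sum_distrib_left[symmetric])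
  then show ?case using hcont assms(2) by (intro container_packable.hcont) auto
next
  case (vcont k A H W)
  have "sum (\<lambda>i. c * w i) A \<le> c * W"
    using vcont assms(2) by (simp add: sum_distrib_left[symmetric])
  then show ?case using vcont assms(2) by (intro container_packable.vcont) auto
next
  case (acont k W H A)
  have "c * w i \<le> \<epsilon> * (c * W) \<and> c * h i \<le> \<epsilon> * (c * H)" if "i \<in> A" for i
    using acont.hyps(3)[OF that] assms(2) mult_left_mono[of "w i" "\<epsilon> * W" c]
      mult_left_mono[of "h i" "\<epsilon> * H" c] by (simp add: mult.left_commute)
  then show ?case using acont assms(2) by (intro container_packable.acont packable_scale) auto
next
  case (vcut k1 W1 H A k2 W2 B)
  then show ?case by (auto simp: distrib_left intro: container_packable.vcut)
next
  case (hcut k1 W H1 A k2 H2 B)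
  then show ?case by (auto simp: distrib_left intro: container_packable.hcut)
qed (use assms(2) in \<open>auto intro: container_packable.empty\<close>)

text \<open>For optimal packings with boundedly many items: each item gets a container of its own,
  and no further structure is needed.\<close>

lemma container_packable_singletons: "packable w h W H A \<Longrightarrow> container_packable \<epsilon> w h (card A) W H A"
proof (induction rule: packable.induct)
  case (item i W H)
  then show ?case by (intro container_packable.hcont) auto
next
  case (vcut W1 H A W2 B)
  then have "card (A \<union> B) = card A + card B" by (intro card_Un_disjoint) (auto intro: packable_finite)
  then show ?case using vcut by (auto intro: container_packable.vcut)
next
  case (hcut W H1 A H2 B)
  then have "card (A \<union> B) = card A + card B" by (intro card_Un_disjoint) (auto intro: packable_finite)
  then show ?case using hcut by (auto intro: container_packable.hcut)
qed (auto intro: container_packable.empty)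

text \<open>The items are grouped by height into intervals of length
  \<open>\<theta> = (1 - \<kappa>) * \<delta>\<close>. As all heights exceed
  \<open>\<delta>\<close>, a difference of \<open>\<theta>\<close> is a relative difference of at
  most \<open>1 - \<kappa>\<close>, so every group is a tight vertical container. Each group
  contributes a container and the empty leaf above it, whence \<open>2 * J + 1\<close> pieces. The
  bound \<open>2\<close> on \<open>q\<close> leaves room for stretched boxes, which may be higher
  than the unit square.\<close>

lemma tight_packable_tight_row:
  fixes \<delta> \<kappa> :: real
  assumes "0 < \<delta>" "0 < \<kappa>" "\<kappa> < 1"
  shows "\<exists>k. \<forall>w h W q X. finite X \<longrightarrow> sum w X \<le> W \<longrightarrow>
    (\<forall>i\<in>X. 0 < w i \<and> \<delta> < h i \<and> h i \<le> q) \<longrightarrow> 0 \<le> q \<longrightarrow> q \<le> 2 \<longrightarrow> tight_packable w h \<kappa> k W q X"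
proof -
  define \<theta> where "\<theta> = (1 - \<kappa>) * \<delta>"
  have \<theta>: "0 < \<theta>" using assms by (simp add: \<theta>_def)
  have step: "tight_packable w h \<kappa> (2 * j + 1) W q X"
    if "finite X" "sum w X \<le> W" "\<And>i. i \<in> X \<Longrightarrow> 0 < w i \<and> \<delta> < h i \<and> h i \<le> q \<and> h i \<le> j * \<theta>" "0 \<le> q"
    for w h :: "nat \<Rightarrow> real" and W q X and j :: nat
    using that
  proof (induction j arbitrary: X W)
    case 0
    then have "X = {}" using assms(1) by force
    then show ?case using 0 by (auto intro: tight_packable.empty)
  next
    case (Suc j)
    define G where "G = {i \<in> X. j * \<theta> < h i}"
    \<comment> \<open>The upper end of the interval may exceed the box, so the height of the
      container is capped by \<open>q\<close>; this only makes it tighter.\<close>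
    define c where "c = min q ((Suc j) * \<theta>)"
    have "\<kappa> * c \<le> h i" if "i \<in> G" for i
    proof -
      have i: "i \<in> X" "j * \<theta> < h i" using that by (auto simp: G_def)
      have "\<delta> < h i" "h i \<le> (Suc j) * \<theta>" using Suc.prems(3) i by auto
      then have "(1 - \<kappa>) * \<delta> \<le> (1 - \<kappa>) * ((Suc j) * \<theta>)"
        using assms by (intro mult_left_mono) auto
      then have "\<kappa> * ((Suc j) * \<theta>) \<le> (Suc j) * \<theta> - \<theta>" by (simp add: \<theta>_def algebra_simps)
      also have "\<dots> < h i" using i by (simp add: algebra_simps)
      finally have "\<kappa> * ((Suc j) * \<theta>) \<le> h i" by simp
      moreover have "\<kappa> * c \<le> \<kappa> * ((Suc j) * \<theta>)"
        using assms unfolding c_def by (intro mult_left_mono) auto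
      ultimately show ?thesis by simp
    qed
    moreover have "h i \<le> c" if "i \<in> G" for i
      using Suc.prems(3)[of i] that by (auto simp: G_def c_def)
    moreover have c0: "0 \<le> c" "c \<le> q" using Suc.prems(4) \<theta> by (auto simp: c_def)
    ultimately have "tight_packable w h \<kappa> 1 (sum w G) c G"
      using Suc.prems(1,3) assms(1) by (intro tight_packable.vcont) (fastforce simp: G_def)+
    moreover have "tight_packable w h \<kappa> 1 (sum w G) (q - c) {}"
      using c0 Suc.prems(3) by (intro tight_packable.empty sum_nonneg) (auto simp: G_def intro: less_imp_le)
    ultimately have 1: "tight_packable w h \<kappa> (1 + 1) (sum w G) (c + (q - c)) (G \<union> {})"
      by (intro tight_packable.hcut) auto
    have GX: "G \<subseteq> X" by (auto simp: G_def)
    have 2: "tight_packable w h \<kappa> (2 * j + 1) (W - sum w G) q (X - G)"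
    proof (rule Suc.IH)
      show "sum w (X - G) \<le> W - sum w G"
        using Suc.prems(1,2) GX by (simp add: sum_diff)
      show "0 < w i \<and> \<delta> < h i \<and> h i \<le> q \<and> h i \<le> j * \<theta>" if "i \<in> X - G" for i
        using Suc.prems(3)[of i] that by (auto simp: G_def)
    qed (use Suc.prems in auto)
    have "tight_packable w h \<kappa> (1 + 1 + (2 * j + 1)) (sum w G + (W - sum w G)) (c + (q - c)) ((G \<union> {}) \<union> (X - G))"
      using 1 2 by (intro tight_packable.vcut) auto
    then show ?case using GX by (simp add: Un_absorb1)
  qed
  define J where "J = nat \<lceil>2 / \<theta>\<rceil>"
  have "2 / \<theta> \<le> real J" unfolding J_def by linarith
  then have J: "2 \<le> J * \<theta>" using \<theta> by (simp add: field_simps)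
  show ?thesis
  proof (rule exI[of _ "2 * J + 1"], intro allI impI)
    fix w h :: "nat \<Rightarrow> real" and W q :: real and X :: "nat set"
    assume *: "finite X" "sum w X \<le> W" "\<forall>i\<in>X. 0 < w i \<and> \<delta> < h i \<and> h i \<le> q" "0 \<le> q" "q \<le> 2"
    then show "tight_packable w h \<kappa> (2 * J + 1) W q X" using J by (intro step) force+
  qed
qed

lemma tight_packable_tight_stack:
  fixes \<delta> \<kappa> :: real
  assumes "0 < \<delta>" "0 < \<kappa>" "\<kappa> < 1"
  shows "\<exists>k. \<forall>w h W q X. finite X \<longrightarrow> sum h X \<le> q \<longrightarrow>
    (\<forall>i\<in>X. 0 < h i \<and> \<delta> < w i \<and> w i \<le> W) \<longrightarrow> 0 \<le> W \<longrightarrow> W \<le> 1 \<longrightarrow> tight_packable w h \<kappa> k W q X"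
proof -
  obtain k where k: "\<And>w h W q X. finite X \<Longrightarrow> sum w X \<le> W \<Longrightarrow>
    (\<forall>i\<in>X. 0 < w i \<and> \<delta> < h i \<and> h i \<le> q) \<Longrightarrow> 0 \<le> q \<Longrightarrow> q \<le> 2 \<Longrightarrow> tight_packable w h \<kappa> k W q X"
    using tight_packable_tight_row[OF assms] by auto
  show ?thesis by (rule exI[of _ k]) (auto intro!: tight_packable_swap[OF k])
qed

lemma tight_packable_vcut_family:
  fixes r :: nat
  assumes "\<And>i. i < r \<Longrightarrow> tight_packable w h \<kappa> k (Wf i) H (G i)" "disjoint_family_on G {..<r}" "0 \<le> H"
  shows "tight_packable w h \<kappa> (r * k + 1) (sum Wf {..<r}) H (\<Union>i<r. G i)"
  using assms
proof (induction r)
  case (Suc r)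
  have "tight_packable w h \<kappa> ((r * k + 1) + k) (sum Wf {..<r} + Wf r) H ((\<Union>i<r. G i) \<union> G r)"
  proof (rule tight_packable.vcut)
    show "tight_packable w h \<kappa> (r * k + 1) (sum Wf {..<r}) H (\<Union>i<r. G i)"
      using Suc.prems by (intro Suc.IH) (auto simp: disjoint_family_on_def)
    show "(\<Union>i<r. G i) \<inter> G r = {}"
    proof -
      have "G i \<inter> G r = {}" if "i < r" for i
        using disjoint_family_onD[OF Suc.prems(2), of i r] that by auto
      then show ?thesis by blast
    qed
  qed (use Suc.prems in auto)
  moreover have "(\<Union>i<Suc r. G i) = (\<Union>i<r. G i) \<union> G r" by (auto simp: less_Suc_eq)
  ultimately show ?case by (simp add: algebra_simps)
qed (auto intro: tight_packable.empty)

text \<open>\<open>T\<close> is a largest initial segment in the order of decreasing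
  \<open>h\<close> that fits into width \<open>X\<close>. If something is left, the highest
  remaining item could be added unless less than \<open>\<mu>\<close> is free. Serves both for
  shelves and, with unit widths, for removing the largest elements of a set.\<close>

lemma greedy_shelf:
  fixes w h :: "nat \<Rightarrow> real"
  assumes "finite S" "\<And>i. i \<in> S \<Longrightarrow> w i \<le> \<mu>" "0 \<le> X"
  shows "\<exists>T\<subseteq>S. sum w T \<le> X \<and> (\<forall>i\<in>T. \<forall>j\<in>S - T. h j \<le> h i) \<and> (T = S \<or> X - \<mu> < sum w T)"
proof -
  define P where "P T \<longleftrightarrow> T \<subseteq> S \<and> sum w T \<le> X \<and> (\<forall>i\<in>T. \<forall>j\<in>S - T. h j \<le> h i)" for T
  have "P {}" using assms by (simp add: P_def)
  moreover have "\<forall>T. P T \<longrightarrow> card T < Suc (card S)"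
    using assms(1) by (auto simp: P_def less_Suc_eq_le card_mono)
  ultimately obtain T where T: "P T" "\<And>T'. P T' \<Longrightarrow> card T' \<le> card T"
    using ex_has_greatest_nat[of P "{}" card "Suc (card S)"] by auto
  have "T = S \<or> X - \<mu> < sum w T"
  proof (rule ccontr)
    assume "\<not> ?thesis"
    then have n: "T \<noteq> S" "sum w T \<le> X - \<mu>" by auto
    have fin: "finite (S - T)" "S - T \<noteq> {}" using n T assms(1) by (auto simp: P_def)
    have "Max (h ` (S - T)) \<in> h ` (S - T)" using fin by (intro Max_in) auto
    then obtain j where j: "j \<in> S - T" "h j = Max (h ` (S - T))" by auto
    have jm: "h i \<le> h j" if "i \<in> S - T" for i using that fin j by auto
    have fT: "finite T" using T(1) assms(1) finite_subset by (auto simp: P_def)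
    have "sum w (insert j T) \<le> X" using j n assms(2)[of j] fT by auto
    then have "P (insert j T)" using T(1) j jm by (auto simp: P_def)
    then have "card (insert j T) \<le> card T" by (rule T(2))
    then show False using j fT by simp
  qed
  then show ?thesis using T(1) by (auto simp: P_def)
qed

text \<open>Shelves with decreasing heights: no item of a shelf is lower than the highest item
  \<open>b2\<close> of the next one, and the shelf is filled up to \<open>\<mu>\<close>, so its area
  is at least \<open>(X - \<mu>) * b2\<close> and pays for the next shelf. In the sum only the first
  shelf, of height at most \<open>b\<close>, is not paid for; the shelf that no longer fits covers
  the height left at the top.\<close>

lemma shelf_fill_bound:
  fixes w h :: "nat \<Rightarrow> real"
  assumes "finite S" "\<And>i. i \<in> S \<Longrightarrow> 0 < w i \<and> w i \<le> \<mu> \<and> 0 < h i \<and> h i \<le> b" "\<mu> \<le> X" "0 \<le> \<mu>" "0 \<le> Y"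
  shows "\<exists>S'\<subseteq>S. packable w h X Y S' \<and> (S' = S \<or> (X - \<mu>) * (Y - b) \<le> area w h S')"
  using assms(1,2,5)
proof (induction "card S" arbitrary: S Y b rule: less_induct)
  case less
  show ?case
  proof (cases "S = {}")
    case True
    then show ?thesis using assms less.prems by (auto intro: packable.empty)
  next
    case False
    define b1 where "b1 = Max (h ` S)"
    have b1: "\<And>i. i \<in> S \<Longrightarrow> h i \<le> b1" using less.prems(1) by (auto simp: b1_def)
    have b1': "b1 \<in> h ` S" unfolding b1_def using less.prems(1) False by (intro Max_in) auto
    then have b1b: "b1 \<le> b" "0 < b1" using less.prems(2) by auto
    show ?thesis
    proof (cases "b1 \<le> Y")
      case False
      \<comment> \<open>Here \<open>Y < b1 \<le> b\<close>, so the required area is not positive and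
        the empty set will do.\<close>
      then have "(X - \<mu>) * (Y - b) \<le> 0"
        using assms b1b by (intro mult_nonneg_nonpos) auto
      then show ?thesis using assms less.prems
        by (intro exI[of _ "{}"]) (auto intro: packable.empty simp: area_def)
    next
      case bY: True
      obtain T where T: "T \<subseteq> S" "sum w T \<le> X" "\<And>i j. i \<in> T \<Longrightarrow> j \<in> S - T \<Longrightarrow> h j \<le> h i"
        "T = S \<or> X - \<mu> < sum w T"
        using greedy_shelf[of S w \<mu> X h] less.prems assms by auto
      have fT: "finite T" using T(1) less.prems(1) finite_subset by auto
      have gT: "packable w h X b1 T"
        using packable_mono[OF packable_row[OF fT, of w h b1] T(2), of b1] T(1) less.prems(2) b1 b1b by force
      show ?thesis
      proof (cases "T = S")
        case True
        then show ?thesis using packable_mono[OF gT, of X Y] bY by auto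
      next
        case TS: False
        have "T \<noteq> {}" using T(4) TS assms by auto
        then have card: "card (S - T) < card S"
          using T(1) less.prems(1) by (intro psubset_card_mono) auto
        define b2 where "b2 = Max (h ` (S - T))"
        have fin: "finite (S - T)" "S - T \<noteq> {}" using less.prems(1) TS T(1) by auto
        have b2: "\<And>i. i \<in> S - T \<Longrightarrow> h i \<le> b2" using fin by (auto simp: b2_def)
        have b2': "b2 \<in> h ` (S - T)" unfolding b2_def using fin by (intro Max_in) auto
        obtain S' where S': "S' \<subseteq> S - T" "packable w h X (Y - b1) S'"
          "S' = S - T \<or> (X - \<mu>) * ((Y - b1) - b2) \<le> area w h S'"
          using less.hyps[OF card fin(1), of b2 "Y - b1"] less.prems(2) b2 bY by auto
        have g: "packable w h X (b1 + (Y - b1)) (T \<union> S')"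
          using gT S' by (intro packable.hcut) auto
        have "T \<union> S' = S \<or> (X - \<mu>) * (Y - b) \<le> area w h (T \<union> S')"
        proof (cases "S' = S - T")
          case True
          then show ?thesis using T(1) by auto
        next
          case False
          then have a1: "(X - \<mu>) * ((Y - b1) - b2) \<le> area w h S'" using S'(3) by simp
          have "b2 * sum w T \<le> area w h T"
            unfolding area_def sum_distrib_left
          proof (rule sum_mono)
            fix i assume "i \<in> T"
            then have "b2 \<le> h i" "0 < w i" using b2' T(1,3) less.prems(2) by auto
            then show "b2 * w i \<le> w i * h i" by (simp add: mult.commute)
          qed
          moreover have "0 \<le> b2" using b2' less.prems(2) by (auto intro: less_imp_le)
          then have "b2 * (X - \<mu>) \<le> b2 * sum w T" using T(4) TS by (intro mult_left_mono) auto
          moreover have "area w h (T \<union> S') = area w h T + area w h S'"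
            using S'(1) fT fin(1) finite_subset by (intro area_Un) auto
          moreover have "(X - \<mu>) * (Y - b) \<le> (X - \<mu>) * (Y - b1)"
            using b1b assms by (intro mult_left_mono) auto
          ultimately show ?thesis using a1 by (simp add: algebra_simps)
        qed
        then show ?thesis using g S'(1) T(1) by (intro exI[of _ "T \<union> S'"]) auto
      qed
    qed
  qed
qed

text \<open>Every leaf loses an area of at most \<open>3 \<mu> / \<epsilon>\<close>: either it is too thin to be an area container for
  items of size \<open>\<mu>\<close>, or it is filled up to a margin of width \<open>\<mu>\<close>.\<close>

lemma tight_packable_fill:
  assumes "tight_packable w h \<kappa> k W H A" "0 < \<kappa>" "0 < \<mu>" "0 < \<epsilon>" "\<epsilon> \<le> 1" "W \<le> 1" "H \<le> 1"
    "finite S" "\<And>i. i \<in> S \<Longrightarrow> 0 < w i \<and> w i \<le> \<mu> \<and> 0 < h i \<and> h i \<le> \<mu>" "A \<inter> S = {}"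
  shows "\<exists>S'\<subseteq>S. container_packable \<epsilon> w h k W H (A \<union> S') \<and>
    (S' = S \<or> W * H - area w h A / \<kappa> - k * (3 * \<mu> / \<epsilon>) \<le> area w h S')"
  using assms(1,6-)
proof (induction arbitrary: S rule: tight_packable.induct)
  case (empty k W H)
  let ?c = "3 * \<mu> / \<epsilon>"
  have c: "?c \<le> k * ?c" using empty.hyps(1) assms by (simp add: field_simps)
  have me: "\<mu> \<le> \<mu> / \<epsilon>" using assms by (simp add: field_simps)
  show ?case
  proof (cases "\<mu> / \<epsilon> \<le> W \<and> \<mu> / \<epsilon> \<le> H")
    case True
    then obtain S' where S': "S' \<subseteq> S" "packable w h W H S'" "S' = S \<or> (W - \<mu>) * (H - \<mu>) \<le> area w h S'"
      using shelf_fill_bound[of S w \<mu> h \<mu> W H] empty assms me by auto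
    have "container_packable \<epsilon> w h k W H S'"
    proof (rule container_packable.acont)
      fix i assume "i \<in> S'"
      then have i: "w i \<le> \<mu>" "h i \<le> \<mu>" using empty.prems S'(1) by auto
      have "\<mu> \<le> \<epsilon> * W" "\<mu> \<le> \<epsilon> * H" using True assms by (auto simp: field_simps)
      then show "w i \<le> \<epsilon> * W \<and> h i \<le> \<epsilon> * H" using i by linarith
    qed (use empty S' in auto)
    moreover have "W * H - k * ?c \<le> (W - \<mu>) * (H - \<mu>)"
    proof -
      have "\<mu> * W \<le> \<mu>" "\<mu> * H \<le> \<mu>" using empty.prems assms by (auto simp: mult_left_le)
      moreover have "(W - \<mu>) * (H - \<mu>) = W * H - \<mu> * W - \<mu> * H + \<mu> * \<mu>"
        by (simp add: algebra_simps)
      moreover have "2 * \<mu> \<le> ?c" using me assms by simp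
      moreover have "0 \<le> \<mu> * \<mu>" by simp
      ultimately show ?thesis using c by linarith
    qed
    ultimately show ?thesis using S' by (auto simp: area_def)
  next
    case False
    have "W * H \<le> \<mu> / \<epsilon>"
    proof (cases "W \<le> \<mu> / \<epsilon>")
      case True
      then have "W * H \<le> W" using empty by (simp add: mult_left_le)
      then show ?thesis using True by linarith
    next
      case False2: False
      then have "H \<le> \<mu> / \<epsilon>" using False by auto
      moreover have "W * H \<le> H" using empty by (simp add: mult_left_le_one_le)
      ultimately show ?thesis by linarith
    qed
    moreover have "\<mu> / \<epsilon> \<le> ?c" using assms by (simp add: field_simps)
    ultimately have "W * H - k * ?c \<le> 0" using c by linarith
    then show ?thesis using empty.hyps by (intro exI[of _ "{}"]) (auto simp: area_def intro: container_packable.empty)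
  qed
next
  case (hcont k A W)
  \<comment> \<open>Tightness enters here: the container counts as completely full once the area of
    its items is divided by \<open>\<kappa>\<close>, so it need not receive any small items.\<close>
  have "\<kappa> * (W * sum h A) \<le> area w h A"
    unfolding area_def sum_distrib_left
    by (rule sum_mono) (use hcont.hyps(4) in \<open>auto simp flip: mult.assoc intro!: mult_right_mono less_imp_le\<close>)
  then have "W * sum h A - area w h A / \<kappa> \<le> 0" using assms(2) by (simp add: field_simps)
  moreover have "0 \<le> k * (3 * \<mu> / \<epsilon>)" using assms by simp
  moreover have "container_packable \<epsilon> w h k W (sum h A) A" using hcont by (intro container_packable.hcont) auto
  ultimately show ?case by (intro exI[of _ "{}"]) (auto simp: area_def)
next
  case (vcont k A H)
  have "\<kappa> * (sum w A * H) \<le> area w h A"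
    unfolding area_def sum_distrib_left sum_distrib_right
  proof (rule sum_mono)
    fix i assume "i \<in> A"
    then have "\<kappa> * H \<le> h i" "0 < w i" using vcont.hyps(4) by auto
    then have "w i * (\<kappa> * H) \<le> w i * h i" by (intro mult_left_mono) auto
    then show "\<kappa> * (w i * H) \<le> w i * h i" by (simp add: mult.left_commute)
  qed
  then have "sum w A * H - area w h A / \<kappa> \<le> 0" using assms(2) by (simp add: field_simps)
  moreover have "0 \<le> k * (3 * \<mu> / \<epsilon>)" using assms by simp
  moreover have "container_packable \<epsilon> w h k (sum w A) H A" using vcont by (intro container_packable.vcont) auto
  ultimately show ?case by (intro exI[of _ "{}"]) (auto simp: area_def)
next
  case (vcut k1 W1 H A k2 W2 B)
  note f1 = tight_packable_facts[OF vcut.hyps(1)] and f2 = tight_packable_facts[OF vcut.hyps(2)]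
  obtain S1 where S1: "S1 \<subseteq> S" "container_packable \<epsilon> w h k1 W1 H (A \<union> S1)"
    "S1 = S \<or> W1 * H - area w h A / \<kappa> - k1 * (3 * \<mu> / \<epsilon>) \<le> area w h S1"
    using vcut.IH(1)[of S] vcut.prems f1 f2 by auto
  \<comment> \<open>The second part is offered what the first one left over. If one of the two takes
    all that it is offered, then all of \<open>S\<close> is packed; otherwise both area bounds hold
    and add up.\<close>
  obtain S2 where S2: "S2 \<subseteq> S - S1" "container_packable \<epsilon> w h k2 W2 H (B \<union> S2)"
    "S2 = S - S1 \<or> W2 * H - area w h B / \<kappa> - k2 * (3 * \<mu> / \<epsilon>) \<le> area w h S2"
    using vcut.IH(2)[of "S - S1"] vcut.prems f1 f2 by auto
  have "container_packable \<epsilon> w h (k1 + k2) (W1 + W2) H ((A \<union> S1) \<union> (B \<union> S2))"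
    using S1 S2 vcut.prems vcut.hyps(3) by (intro container_packable.vcut) auto
  moreover have ar1: "area w h (A \<union> B) = area w h A + area w h B"
    using f1 f2 vcut.hyps by (intro area_Un) auto
  moreover have ar2: "area w h (S1 \<union> S2) = area w h S1 + area w h S2"
    using S1(1) S2(1) vcut.prems(3) finite_subset by (intro area_Un) blast+
  moreover have "(A \<union> S1) \<union> (B \<union> S2) = (A \<union> B) \<union> (S1 \<union> S2)" by auto
  moreover have "S1 \<union> S2 = S \<or>
    (W1 + W2) * H - area w h (A \<union> B) / \<kappa> - (k1 + k2) * (3 * \<mu> / \<epsilon>) \<le> area w h (S1 \<union> S2)"
  proof (cases "S1 = S \<or> S2 = S - S1")
    case True
    then show ?thesis using S1(1) S2(1) by auto
  next
    case False
    then show ?thesis using S1(3) S2(3) ar1 ar2 by (simp add: add_divide_distrib distrib_right distrib_left)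
  qed
  ultimately show ?case using S1(1) S2(1) by (intro exI[of _ "S1 \<union> S2"]) auto
next
  case (hcut k1 W H1 A k2 H2 B)
  note f1 = tight_packable_facts[OF hcut.hyps(1)] and f2 = tight_packable_facts[OF hcut.hyps(2)]
  obtain S1 where S1: "S1 \<subseteq> S" "container_packable \<epsilon> w h k1 W H1 (A \<union> S1)"
    "S1 = S \<or> W * H1 - area w h A / \<kappa> - k1 * (3 * \<mu> / \<epsilon>) \<le> area w h S1"
    using hcut.IH(1)[of S] hcut.prems f1 f2 by auto
  obtain S2 where S2: "S2 \<subseteq> S - S1" "container_packable \<epsilon> w h k2 W H2 (B \<union> S2)"
    "S2 = S - S1 \<or> W * H2 - area w h B / \<kappa> - k2 * (3 * \<mu> / \<epsilon>) \<le> area w h S2"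
    using hcut.IH(2)[of "S - S1"] hcut.prems f1 f2 by auto
  have "container_packable \<epsilon> w h (k1 + k2) W (H1 + H2) ((A \<union> S1) \<union> (B \<union> S2))"
    using S1 S2 hcut.prems hcut.hyps(3) by (intro container_packable.hcut) auto
  moreover have ar1: "area w h (A \<union> B) = area w h A + area w h B"
    using f1 f2 hcut.hyps by (intro area_Un) auto
  moreover have ar2: "area w h (S1 \<union> S2) = area w h S1 + area w h S2"
    using S1(1) S2(1) hcut.prems(3) finite_subset by (intro area_Un) blast+
  moreover have "(A \<union> S1) \<union> (B \<union> S2) = (A \<union> B) \<union> (S1 \<union> S2)" by auto
  moreover have "S1 \<union> S2 = S \<or>
    W * (H1 + H2) - area w h (A \<union> B) / \<kappa> - (k1 + k2) * (3 * \<mu> / \<epsilon>) \<le> area w h (S1 \<union> S2)"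
  proof (cases "S1 = S \<or> S2 = S - S1")
    case True
    then show ?thesis using S1(1) S2(1) by auto
  next
    case False
    then show ?thesis using S1(3) S2(3) ar1 ar2 by (simp add: add_divide_distrib distrib_right distrib_left)
  qed
  ultimately show ?case using S1(1) S2(1) by (intro exI[of _ "S1 \<union> S2"]) auto
qed

section \<open>Boxes that only contain wide items\<close>

text \<open>A stack of boxes, each cut vertically into two boxes, sorted by the position of that cut.\<close>

inductive chain :: "(nat \<Rightarrow> real) \<Rightarrow> (nat \<Rightarrow> real) \<Rightarrow> real \<Rightarrow> real \<Rightarrow> real \<Rightarrow> real \<Rightarrow> nat set \<Rightarrow> bool"
  for w h :: "nat \<Rightarrow> real" and \<delta> W :: real where
  nil: "chain w h \<delta> W x0 0 {}"
| cons: "x0 \<le> x \<Longrightarrow> x \<le> W - \<delta> \<Longrightarrow> packable w h x u L \<Longrightarrow> packable w h (W - x) u R \<Longrightarrow> chain w h \<delta> W x U A \<Longrightarrow>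
    L \<inter> R = {} \<Longrightarrow> (L \<union> R) \<inter> A = {} \<Longrightarrow> chain w h \<delta> W x0 (u + U) ((L \<union> R) \<union> A)"

lemma chain_nonneg: "chain w h \<delta> W x0 U A \<Longrightarrow> 0 \<le> U"
  by (induction rule: chain.induct) (auto dest: packable_nonneg)

lemma chain_finite: "chain w h \<delta> W x0 U A \<Longrightarrow> finite A"
  by (induction rule: chain.induct) (auto dest: packable_finite)

lemma chain_height: "chain w h \<delta> W x0 U A \<Longrightarrow> i \<in> A \<Longrightarrow> 0 < h i \<and> h i \<le> U"
proof (induction rule: chain.induct)
  case (cons x0 x u L R U A)
  have "0 \<le> U" "0 \<le> u" using chain_nonneg[OF cons.hyps(5)] packable_nonneg[OF cons.hyps(3)] by auto
  then show ?case using cons.IH cons.prems packable_dims[OF cons.hyps(3), of i] packable_dims[OF cons.hyps(4), of i]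
    by auto
qed auto

text \<open>Slabs of a stack can be permuted, so a new slab can be inserted at the place that its
  cut position demands, as in insertion sort.\<close>

lemma chain_insert:
  assumes "chain w h \<delta> W x0 U A" "x0 \<le> x" "x \<le> W - \<delta>" "packable w h x u L" "packable w h (W - x) u R"
    "L \<inter> R = {}" "(L \<union> R) \<inter> A = {}"
  shows "chain w h \<delta> W x0 (u + U) ((L \<union> R) \<union> A)"
  using assms
proof (induction rule: chain.induct)
  case (nil x0)
  then show ?case by (intro chain.cons chain.nil) auto
next
  case (cons x0 x' u' L' R' U A)
  show ?case
  proof (cases "x \<le> x'")
    case True
    have "chain w h \<delta> W x (u' + U) ((L' \<union> R') \<union> A)"
      using cons True by (intro chain.cons[OF True cons.hyps(2-5)]) auto
    with cons.prems show ?thesis by (intro chain.cons[OF cons.prems(1-4)]) auto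
  next
    case False
    then have "chain w h \<delta> W x' (u + U) ((L \<union> R) \<union> A)"
      using cons by (intro cons.IH) auto
    then have "chain w h \<delta> W x0 (u' + (u + U)) ((L' \<union> R') \<union> ((L \<union> R) \<union> A))"
      using cons.hyps(6,7) cons.prems by (intro chain.cons[OF cons.hyps(1-4)]) auto
    then show ?thesis by (simp add: Un_ac add_ac)
  qed
qed

lemma chain_append:
  assumes "chain w h \<delta> W y U A" "x0 \<le> y" "chain w h \<delta> W x0 V B" "A \<inter> B = {}"
  shows "chain w h \<delta> W x0 (U + V) (A \<union> B)"
  using assms
proof (induction rule: chain.induct)
  case (cons y x u L R U A)
  have "chain w h \<delta> W x0 (U + V) (A \<union> B)" using cons by (intro cons.IH) auto
  then have "chain w h \<delta> W x0 (u + (U + V)) ((L \<union> R) \<union> (A \<union> B))"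
    using cons.hyps cons.prems by (intro chain_insert) auto
  then show ?case by (simp add: Un_ac add_ac)
qed auto

text \<open>The additional width goes to the right parts; the positions of the cuts and their order
  stay the same.\<close>

lemma chain_mono:
  "chain w h \<delta> W x0 U A \<Longrightarrow> W \<le> W' \<Longrightarrow> chain w h \<delta> W' x0 U A"
proof (induction rule: chain.induct)
  case (cons x0 x u L R U A)
  then show ?case by (intro chain.cons) (auto intro: packable_mono)
qed (auto intro: chain.nil)

text \<open>Cut positions increase along the chain. In the first stretch of height \<open>s\<close>
  all left parts therefore fit into width \<open>x1\<close>, the last position reached, and all
  right parts into width \<open>W - x0\<close>. The two halves are returned separately because they
  will be used in different segments. The end of the stretch splits one slab at most, which costs at
  most \<open>W / \<delta>\<close> items.\<close>

lemma chain_take: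
  assumes "chain w h \<delta> W x0 U A" "0 \<le> s" "s \<le> U" "x0 \<le> W - \<delta>" "0 \<le> x0" "0 \<le> \<delta>"
    "\<And>i. i \<in> A \<Longrightarrow> \<delta> < w i"
  shows "\<exists>A1 A2 A3 D x1. A = A1 \<union> A2 \<union> A3 \<union> D \<and> A1 \<inter> A2 = {} \<and> (A1 \<union> A2) \<inter> A3 = {} \<and>
    (A1 \<union> A2 \<union> A3) \<inter> D = {} \<and> x0 \<le> x1 \<and> x1 \<le> W - \<delta> \<and>
    packable w h x1 s A1 \<and> packable w h (W - x0) s A2 \<and> chain w h \<delta> W x1 (U - s) A3 \<and> \<delta> * card D \<le> W"
  using assms
proof (induction arbitrary: s rule: chain.induct)
  case (nil x0)
  then have "s = 0" by simp
  then show ?case using nil by (intro exI[of _ "{}"] exI[of _ x0]) (auto intro: packable.empty chain.nil)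
next
  case (cons x0 x u L R U A)
  show ?case
  proof (cases "s \<le> u")
    case True
    obtain L1 L2 D where L: "L = L1 \<union> L2 \<union> D" "L1 \<inter> L2 = {}" "L1 \<inter> D = {}" "L2 \<inter> D = {}"
      "packable w h x s L1" "packable w h x (u - s) L2" "\<delta> * card D \<le> x"
      using packable_split_wide[OF cons.hyps(3), of \<delta> s] cons.prems True by auto
    obtain R1 R2 E where R: "R = R1 \<union> R2 \<union> E" "R1 \<inter> R2 = {}" "R1 \<inter> E = {}" "R2 \<inter> E = {}"
      "packable w h (W - x) s R1" "packable w h (W - x) (u - s) R2" "\<delta> * card E \<le> W - x"
      using packable_split_wide[OF cons.hyps(4), of \<delta> s] cons.prems True by auto
    have "card (D \<union> E) \<le> card D + card E" by (rule card_Un_le)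
    then have "\<delta> * card (D \<union> E) \<le> \<delta> * (card D + card E)"
      using cons.prems by (intro mult_left_mono) auto
    then have c: "\<delta> * card (D \<union> E) \<le> W" using L(7) R(7) by (simp add: distrib_left)
    have "chain w h \<delta> W x ((u - s) + U) ((L2 \<union> R2) \<union> A)"
      using cons.hyps L R by (intro chain.cons) auto
    then have ch: "chain w h \<delta> W x (u + U - s) (L2 \<union> R2 \<union> A)" by (simp add: algebra_simps)
    have g: "packable w h (W - x0) s R1" using packable_mono[OF R(5)] cons.hyps(1) by auto
    have "(L \<union> R) \<union> A = L1 \<union> R1 \<union> (L2 \<union> R2 \<union> A) \<union> (D \<union> E)" using L(1) R(1) by auto
    moreover have "L1 \<inter> R1 = {}" "(L1 \<union> R1) \<inter> (L2 \<union> R2 \<union> A) = {}"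
      "(L1 \<union> R1 \<union> (L2 \<union> R2 \<union> A)) \<inter> (D \<union> E) = {}"
      using L(1-4) R(1-4) cons.hyps(6,7) by blast+
    ultimately show ?thesis using c ch g L(5) cons.hyps(1,2) by blast
  next
    case False
    have u: "0 \<le> u" using packable_nonneg[OF cons.hyps(3)] by simp
    obtain A1 A2 A3 D x1 where I: "A = A1 \<union> A2 \<union> A3 \<union> D" "A1 \<inter> A2 = {}" "(A1 \<union> A2) \<inter> A3 = {}"
      "(A1 \<union> A2 \<union> A3) \<inter> D = {}" "x \<le> x1" "x1 \<le> W - \<delta>"
      "packable w h x1 (s - u) A1" "packable w h (W - x) (s - u) A2" "chain w h \<delta> W x1 (U - (s - u)) A3"
      "\<delta> * card D \<le> W"
      using cons.IH[of "s - u"] cons.prems cons.hyps(1,2) False by force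
    have 1: "packable w h x1 s (L \<union> A1)"
      using packable_mono[OF cons.hyps(3), of x1 u] I cons.hyps(7)
      by (intro packable_hcutI[OF _ I(7)]) auto
    have 2: "packable w h (W - x0) s (R \<union> A2)"
      using packable_mono[OF cons.hyps(4), of "W - x0" u] packable_mono[OF I(8), of "W - x0" "s - u"] cons.hyps(1,7) I(1)
      by (intro packable_hcutI[of _ _ _ u _ "s - u"]) auto
    have 3: "chain w h \<delta> W x1 (u + U - s) A3" using I(9) by (simp add: algebra_simps)
    have "(L \<union> R) \<union> A = (L \<union> A1) \<union> (R \<union> A2) \<union> A3 \<union> D" using I(1) by auto
    moreover have "(L \<union> A1) \<inter> (R \<union> A2) = {}" "((L \<union> A1) \<union> (R \<union> A2)) \<inter> A3 = {}"
      "((L \<union> A1) \<union> (R \<union> A2) \<union> A3) \<inter> D = {}"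
      using I(1-4) cons.hyps(6,7) by blast+
    moreover have "x0 \<le> x1" using I(5) cons.hyps(1) by simp
    ultimately show ?thesis using 1 2 3 I(6,10) by blast
  qed
qed

text \<open>Following the horizontal cuts down to the first vertical one yields slabs that are
  either single items, stacked in \<open>X\<close>, or cut vertically with items on both sides. In
  the second case an item wider than \<open>\<delta>\<close> on each side keeps the cut at distance
  at least \<open>\<delta>\<close> from both ends, which makes an induction on the width
  possible.\<close>

lemma packable_chain:
  assumes "packable w h W q A" "0 \<le> \<delta>" "\<And>i. i \<in> A \<Longrightarrow> \<delta> < w i"
  shows "\<exists>X C U. A = X \<union> C \<and> X \<inter> C = {} \<and> sum h X + U \<le> q \<and> chain w h \<delta> W \<delta> U C"
  using assms
proof (induction rule: packable.induct)
  case (empty W H)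
  then show ?case by (intro exI[of _ "{}"] exI[of _ 0]) (auto intro: chain.nil)
next
  case (item i W H)
  then show ?case by (intro exI[of _ "{i}"] exI[of _ "{}"] exI[of _ 0]) (auto intro: chain.nil)
next
  case (vcut W1 H A W2 B)
  note nn = packable_nonneg[OF vcut.hyps(1)] packable_nonneg[OF vcut.hyps(2)]
  show ?case
  \<comment> \<open>A vertical cut with an empty side is discarded and the decomposition of the
    other side is kept in the wider box.\<close>
  proof (cases "A = {} \<or> B = {}")
    case True
    then show ?thesis
    proof
      assume A: "A = {}"
      obtain X C U where "B = X \<union> C" "X \<inter> C = {}" "sum h X + U \<le> H" "chain w h \<delta> W2 \<delta> U C"
        using vcut.IH(2) vcut.prems by auto
      then show ?thesis using chain_mono[of w h \<delta> W2 \<delta> U C "W1 + W2"] A nn by auto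
    next
      assume B: "B = {}"
      obtain X C U where "A = X \<union> C" "X \<inter> C = {}" "sum h X + U \<le> H" "chain w h \<delta> W1 \<delta> U C"
        using vcut.IH(1) vcut.prems by auto
      then show ?thesis using chain_mono[of w h \<delta> W1 \<delta> U C "W1 + W2"] B nn by auto
    qed
  next
    case False
    then obtain a b where ab: "a \<in> A" "b \<in> B" by auto
    have "\<delta> < W1" "\<delta> < W2"
      using vcut.prems(2)[of a] vcut.prems(2)[of b] packable_dims[OF vcut.hyps(1) ab(1)]
        packable_dims[OF vcut.hyps(2) ab(2)] ab by auto
    then have "chain w h \<delta> (W1 + W2) \<delta> (H + 0) ((A \<union> B) \<union> {})"
      using vcut.hyps by (intro chain.cons[of _ W1] chain.nil) auto
    then show ?thesis using nn by (intro exI[of _ "{}"] exI[of _ "A \<union> B"] exI[of _ H]) auto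
  qed
next
  case (hcut W H1 A H2 B)
  obtain X C U where 1: "A = X \<union> C" "X \<inter> C = {}" "sum h X + U \<le> H1" "chain w h \<delta> W \<delta> U C"
    using hcut.IH(1) hcut.prems by auto
  obtain Y D V where 2: "B = Y \<union> D" "Y \<inter> D = {}" "sum h Y + V \<le> H2" "chain w h \<delta> W \<delta> V D"
    using hcut.IH(2) hcut.prems by auto
  have fin: "finite X" "finite Y"
    using packable_finite[OF hcut.hyps(1)] packable_finite[OF hcut.hyps(2)] 1(1) 2(1) by auto
  have dis: "X \<inter> Y = {}" "C \<inter> D = {}" "(X \<union> Y) \<inter> (C \<union> D) = {}" "A \<union> B = (X \<union> Y) \<union> (C \<union> D)"
    using 1(1,2) 2(1,2) hcut.hyps(3) by blast+
  have "chain w h \<delta> W \<delta> (U + V) (C \<union> D)" using 1(4) 2(4) dis(2) by (intro chain_append) auto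
  moreover have "sum h (X \<union> Y) = sum h X + sum h Y" using fin dis(1) by (rule sum.union_disjoint)
  then have "sum h (X \<union> Y) + (U + V) \<le> H1 + H2" using 1(3) 2(3) by simp
  ultimately show ?case using dis by blast
qed

text \<open>The left halves of one segment of the chain are paired with the right halves of the next one; as the
  chain is sorted, all of them fit with a common vertical cut. This costs one additional segment.\<close>

lemma chain_shift:
  fixes c k l r :: nat and \<delta> W s F :: real
  assumes IH: "\<And>x u B. packable w h x u B \<Longrightarrow> (\<And>i. i \<in> B \<Longrightarrow> \<delta> < w i) \<Longrightarrow> x \<le> W - \<delta> \<Longrightarrow>
      \<exists>B'\<subseteq>B. card (B - B') \<le> l \<and> tight_packable w h \<kappa> k x (u * F) B'"
    and "0 < \<delta>" "W \<le> c * \<delta>" "0 \<le> s" "0 \<le> F"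
    and "chain w h \<delta> W x0 U A" "packable w h x0 s P" "P \<inter> A = {}" "\<And>i. i \<in> P \<union> A \<Longrightarrow> \<delta> < w i"
    and "U \<le> r * s" "\<delta> \<le> x0" "x0 \<le> W - \<delta>"
  shows "\<exists>A'\<subseteq>P \<union> A. card (P \<union> A - A') \<le> r * (c + 2 * l) + 2 * l \<and>
    tight_packable w h \<kappa> ((r + 1) * (2 * k)) W ((r + 1) * (s * F)) A'"
  using assms(6-)
proof (induction r arbitrary: x0 U A P)
  case 0
  have "A = {}" using chain_height[OF 0(1)] 0(5) by fastforce
  obtain P' where P': "P' \<subseteq> P" "card (P - P') \<le> l" "tight_packable w h \<kappa> k x0 (s * F) P'"
    using IH[OF 0(2)] 0 by auto
  \<comment> \<open>The pending left parts of the last segment have no right parts to be paired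
    with; this is the additional segment, with an empty leaf at the right.\<close>
  have "tight_packable w h \<kappa> (k + k) (x0 + (W - x0)) (s * F) (P' \<union> {})"
    using P'(3) tight_packable_facts[OF P'(3)] 0 assms(2,4,5) by (intro tight_packable.vcut tight_packable.empty) auto
  then show ?case using P' \<open>A = {}\<close> by (intro exI[of _ P']) (auto simp: mult_2)
next
  case (Suc r)
  have U: "0 \<le> U" using chain_nonneg Suc.prems(1) by auto
  \<comment> \<open>The last segment may be lower than \<open>s\<close>; its parts are then treated
    as parts of height \<open>s\<close>.\<close>
  define s' where "s' = min s U"
  obtain A1 A2 A3 D x1 where T: "A = A1 \<union> A2 \<union> A3 \<union> D" "A1 \<inter> A2 = {}" "(A1 \<union> A2) \<inter> A3 = {}"
      "(A1 \<union> A2 \<union> A3) \<inter> D = {}" "x0 \<le> x1" "x1 \<le> W - \<delta>"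
      "packable w h x1 s' A1" "packable w h (W - x0) s' A2" "chain w h \<delta> W x1 (U - s') A3" "\<delta> * card D \<le> W"
    using chain_take[OF Suc.prems(1), of s'] Suc.prems assms(2,4) U unfolding s'_def by force
  have fin: "finite P" "finite A1" "finite A2" "finite A3" "finite D"
    using packable_finite[OF Suc.prems(2)] chain_finite[OF Suc.prems(1)] T(1) by auto
  have "\<delta> * card D \<le> \<delta> * c" using T(10) assms(3) by (simp add: mult.commute)
  then have cD: "card D \<le> c" using assms(2) by simp
  obtain P' where P': "P' \<subseteq> P" "card (P - P') \<le> l" "tight_packable w h \<kappa> k x0 (s * F) P'"
    using IH[OF Suc.prems(2)] Suc.prems by auto
  have "packable w h (W - x0) s A2" using packable_mono[OF T(8), of _ s] by (simp add: s'_def)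
  then obtain R' where R': "R' \<subseteq> A2" "card (A2 - R') \<le> l" "tight_packable w h \<kappa> k (W - x0) (s * F) R'"
    using IH[of "W - x0" s A2] Suc.prems T(1) by auto
  have pend: "packable w h x1 s A1" using packable_mono[OF T(7), of _ s] by (simp add: s'_def)
  have "U - s' \<le> r * s"
    using Suc.prems(5) assms(4) by (auto simp: s'_def min_def algebra_simps)
  then have "\<exists>Q\<subseteq>A1 \<union> A3. card (A1 \<union> A3 - Q) \<le> r * (c + 2 * l) + 2 * l \<and>
    tight_packable w h \<kappa> ((r + 1) * (2 * k)) W ((r + 1) * (s * F)) Q"
  proof (intro Suc.IH[OF T(9) pend])
    show "A1 \<inter> A3 = {}" using T(3) by auto
    show "\<delta> < w i" if "i \<in> A1 \<union> A3" for i using that Suc.prems(4) T(1) by auto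
  qed (use Suc.prems T(5,6) in auto)
  then obtain Q where Q: "Q \<subseteq> A1 \<union> A3" "card (A1 \<union> A3 - Q) \<le> r * (c + 2 * l) + 2 * l"
    "tight_packable w h \<kappa> ((r + 1) * (2 * k)) W ((r + 1) * (s * F)) Q" by blast
  have PA: "P \<inter> A2 = {}" "P \<inter> (A1 \<union> A3) = {}" using Suc.prems(3) T(1) by auto
  \<comment> \<open>The common cut is at \<open>x0\<close>: the pending left parts need at most this
    width, and the right parts of the current segment, cut at \<open>x0\<close> or later, need at
    most \<open>W - x0\<close>.\<close>
  have 1: "tight_packable w h \<kappa> (k + k) (x0 + (W - x0)) (s * F) (P' \<union> R')"
    using P' R' PA by (intro tight_packable.vcut) auto
  have "(P' \<union> R') \<inter> Q = {}" using P'(1) R'(1) Q(1) PA T(2,3) by blast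
  then have "tight_packable w h \<kappa> ((k + k) + (r + 1) * (2 * k)) (x0 + (W - x0)) (s * F + (r + 1) * (s * F)) ((P' \<union> R') \<union> Q)"
    using 1 Q(3) by (intro tight_packable.hcut) auto
  then have tight_packable: "tight_packable w h \<kappa> ((Suc r + 1) * (2 * k)) W ((Suc r + 1) * (s * F)) ((P' \<union> R') \<union> Q)"
    by (simp add: algebra_simps mult_2)
  have "P \<union> A - ((P' \<union> R') \<union> Q) \<subseteq> (P - P') \<union> ((A2 - R') \<union> (D \<union> (A1 \<union> A3 - Q)))" using T(1) by auto
  then have "card (P \<union> A - ((P' \<union> R') \<union> Q)) \<le> card ((P - P') \<union> ((A2 - R') \<union> (D \<union> (A1 \<union> A3 - Q))))"
    using fin by (intro card_mono) auto
  also have "\<dots> \<le> card (P - P') + (card (A2 - R') + (card D + card (A1 \<union> A3 - Q)))"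
    by (meson add_mono card_Un_le le_refl order_trans)
  also have "\<dots> \<le> l + (l + (c + (r * (c + 2 * l) + 2 * l)))"
    using P'(2) R'(2) cD Q(2) by linarith
  also have "\<dots> = Suc r * (c + 2 * l) + 2 * l" by simp
  finally have "card (P \<union> A - ((P' \<union> R') \<union> Q)) \<le> Suc r * (c + 2 * l) + 2 * l" .
  moreover have "(P' \<union> R') \<union> Q \<subseteq> P \<union> A" using P'(1) R'(1) Q(1) T(1) by auto
  ultimately show ?case using tight_packable by blast
qed

text \<open>Induction on the width in units of \<open>\<delta>\<close>: the cuts of a chain keep
  distance \<open>\<delta>\<close> from both ends, so both parts are narrower by at least
  \<open>\<delta>\<close>. On each level of the recursion a chain is divided into \<open>m\<close>
  segments and one segment is added, which is the factor \<open>1 + 1 / m\<close>. The numbers of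
  segments and levels are bounded, and so are the numbers of pieces and of lost items.\<close>

lemma tight_packable_wide:
  fixes \<delta> \<kappa> :: real and m d :: nat
  assumes "0 < \<delta>" "0 < \<kappa>" "\<kappa> < 1" "1 \<le> m"
  shows "\<exists>k l. \<forall>w h W q A. packable w h W q A \<longrightarrow> (\<forall>i\<in>A. \<delta> < w i) \<longrightarrow> W \<le> d * \<delta> \<longrightarrow> W \<le> 1 \<longrightarrow>
    (\<exists>A'\<subseteq>A. card (A - A') \<le> l \<and> tight_packable w h \<kappa> k W (q * (1 + 1 / m) ^ d) A')"
proof (induction d)
  case 0
  show ?case
  proof (rule exI[of _ 1], rule exI[of _ 0], intro allI impI)
    fix w h W q A assume *: "packable w h W q A" "\<forall>i\<in>A. \<delta> < w i" "W \<le> real 0 * \<delta>" "W \<le> 1"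
    have "A = {}" using packable_dims[OF *(1)] *(3) by fastforce
    then show "\<exists>A'\<subseteq>A. card (A - A') \<le> 0 \<and> tight_packable w h \<kappa> 1 W (q * (1 + 1 / m) ^ 0) A'"
      using packable_nonneg[OF *(1)] by (auto intro: tight_packable.empty)
  qed
next
  case (Suc d)
  define F where "F = (1 + 1 / real m) ^ d"
  have F: "1 \<le> F" unfolding F_def by (intro one_le_power) auto
  obtain k l where "\<forall>w h W q A. packable w h W q A \<longrightarrow> (\<forall>i\<in>A. \<delta> < w i) \<longrightarrow> W \<le> d * \<delta> \<longrightarrow> W \<le> 1 \<longrightarrow>
    (\<exists>A'\<subseteq>A. card (A - A') \<le> l \<and> tight_packable w h \<kappa> k W (q * F) A')"
    using Suc.IH unfolding F_def by (elim exE)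
  note kl = this[rule_format]
  obtain k0 where "\<forall>w h W q X. finite X \<longrightarrow> sum h X \<le> q \<longrightarrow>
    (\<forall>i\<in>X. 0 < h i \<and> \<delta> < w i \<and> w i \<le> W) \<longrightarrow> 0 \<le> W \<longrightarrow> W \<le> 1 \<longrightarrow> tight_packable w h \<kappa> k0 W q X"
    using tight_packable_tight_stack[OF assms(1-3)] by (elim exE)
  note k0 = this[rule_format]
  define k' where "k' = (m + 1) * (2 * k) + k0 + 2"
  define l' where "l' = m * (Suc d + 2 * l) + 2 * l"
  show ?case
  proof (rule exI[of _ k'], rule exI[of _ l'], intro allI impI)
    fix w h W q A assume *: "packable w h W q A" "\<forall>i\<in>A. \<delta> < w i" "W \<le> real (Suc d) * \<delta>" "W \<le> 1"
    note nn = packable_nonneg[OF *(1)] and dims = packable_dims[OF *(1)] and finA = packable_finite[OF *(1)]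
    obtain X C U where XC: "A = X \<union> C" "X \<inter> C = {}" "sum h X + U \<le> q" "chain w h \<delta> W \<delta> U C"
      using packable_chain[OF *(1), of \<delta>] *(2) assms(1) by auto
    have U: "0 \<le> U" using chain_nonneg XC(4) by auto
    have pX: "tight_packable w h \<kappa> k0 W (q - U) X"
      using XC dims *(2,4) finA nn by (intro k0) auto
    have "\<exists>C'\<subseteq>C. card (C - C') \<le> l' \<and> tight_packable w h \<kappa> ((m + 1) * (2 * k)) W ((m + 1) * (U / m * F)) C'"
    proof (cases "\<delta> \<le> W - \<delta>")
      case True
      have "\<exists>A'\<subseteq>{} \<union> C. card ({} \<union> C - A') \<le> m * (Suc d + 2 * l) + 2 * l \<and>
        tight_packable w h \<kappa> ((m + 1) * (2 * k)) W ((m + 1) * (U / m * F)) A'"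
      proof (rule chain_shift[OF _ assms(1) *(3) _ _ XC(4)])
        fix x u B assume B: "packable w h x u B" "\<And>i. i \<in> B \<Longrightarrow> \<delta> < w i" "x \<le> W - \<delta>"
        have "x \<le> d * \<delta>" using B(3) *(3) by (simp add: algebra_simps)
        then show "\<exists>B'\<subseteq>B. card (B - B') \<le> l \<and> tight_packable w h \<kappa> k x (u * F) B'"
          using B *(4) assms(1) by (intro kl) auto
      qed (use True U F assms(1,4) *(2) XC(1) in \<open>auto intro: packable.empty\<close>)
      then show ?thesis unfolding l'_def by simp
    next
      case False
      \<comment> \<open>With width below \<open>2 * \<delta>\<close> there is no position for a cut
        at distance \<open>\<delta>\<close> from both ends.\<close>
      have "C = {}"
      proof (rule ccontr)
        assume "C \<noteq> {}"
        with XC(4) show False using False by (cases rule: chain.cases) auto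
      qed
      \<comment> \<open>Applying the induction hypothesis to an empty box yields
        \<open>1 \<le> k\<close>, since every packing counts at least one leaf.\<close>
      have "tight_packable w h \<kappa> k 0 0 {}" using kl[OF packable.empty, of 0 0] assms(1) tight_packable.empty[of k 0 0] by auto
      then have "1 \<le> k" using tight_packable_facts by blast
      then have "tight_packable w h \<kappa> ((m + 1) * (2 * k)) W ((m + 1) * (U / m * F)) {}"
        using nn U F by (intro tight_packable.empty) auto
      then show ?thesis using \<open>C = {}\<close> by auto
    qed
    then obtain C' where C': "C' \<subseteq> C" "card (C - C') \<le> l'"
      "tight_packable w h \<kappa> ((m + 1) * (2 * k)) W ((m + 1) * (U / m * F)) C'" by auto
    have "tight_packable w h \<kappa> ((m + 1) * (2 * k) + k0) W ((m + 1) * (U / m * F) + (q - U)) (C' \<union> X)"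
      using C' pX XC(2) by (intro tight_packable.hcut) auto
    moreover have "(m + 1) * (U / m * F) + (q - U) \<le> q * (1 + 1 / m) ^ Suc d"
    proof -
      define Z where "Z = (1 + 1 / real m) * F"
      have Z: "(1 + 1 / real m) ^ Suc d = Z" by (simp add: Z_def F_def)
      have "1 \<le> Z" unfolding Z[symmetric] by (rule one_le_power) simp
      moreover have "0 \<le> sum h X" using dims XC(1) by (intro sum_nonneg) force
      ultimately have "(q - U) * 1 \<le> (q - U) * Z"
        using XC(3) by (intro mult_left_mono) auto
      moreover have "(m + 1) * (U / m * F) = U * Z" using assms(4) by (simp add: Z_def field_simps)
      ultimately show ?thesis unfolding Z by (simp add: algebra_simps)
    qed
    ultimately have "tight_packable w h \<kappa> k' W (q * (1 + 1 / m) ^ Suc d) (C' \<union> X)"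
      unfolding k'_def by (intro tight_packable_pad) auto
    moreover have "A - (C' \<union> X) = C - C'" using XC(1,2) by auto
    ultimately show "\<exists>A'\<subseteq>A. card (A - A') \<le> l' \<and> tight_packable w h \<kappa> k' W (q * (1 + 1 / m) ^ Suc d) A'"
      using C' XC(1) by (intro exI[of _ "C' \<union> X"]) auto
  qed
qed

section \<open>Boxes made of rows\<close>

text \<open>A box made of \<open>r\<close> rows of height \<open>g\<close>: all horizontal cuts run between rows, unless they are inside a
  single row that only contains wide items.\<close>

inductive rowed :: "(nat \<Rightarrow> real) \<Rightarrow> (nat \<Rightarrow> real) \<Rightarrow> real \<Rightarrow> real \<Rightarrow> nat \<Rightarrow> real \<Rightarrow> nat set \<Rightarrow> bool"
  for w h :: "nat \<Rightarrow> real" and \<delta> g :: real where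
  empty: "0 \<le> W \<Longrightarrow> rowed w h \<delta> g r W {}"
| tall: "0 < w i \<Longrightarrow> w i \<le> W \<Longrightarrow> \<delta> < h i \<Longrightarrow> h i \<le> r * g \<Longrightarrow> rowed w h \<delta> g r W {i}"
| wide: "packable w h W g A \<Longrightarrow> (\<And>i. i \<in> A \<Longrightarrow> \<delta> < w i) \<Longrightarrow> rowed w h \<delta> g 1 W A"
| vcut: "rowed w h \<delta> g r W1 A \<Longrightarrow> rowed w h \<delta> g r W2 B \<Longrightarrow> A \<inter> B = {} \<Longrightarrow>
    rowed w h \<delta> g r (W1 + W2) (A \<union> B)"
| hcut: "rowed w h \<delta> g r1 W A \<Longrightarrow> rowed w h \<delta> g r2 W B \<Longrightarrow> A \<inter> B = {} \<Longrightarrow>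
    rowed w h \<delta> g (r1 + r2) W (A \<union> B)"

lemma rowed_facts: "rowed w h \<delta> g r W A \<Longrightarrow> 0 \<le> W \<and> finite A"
  by (induction rule: rowed.induct) (auto dest: packable_nonneg packable_finite)

lemma rowed_0: "rowed w h \<delta> g r W A \<Longrightarrow> r = 0 \<Longrightarrow> 0 < \<delta> \<Longrightarrow> A = {}"
  by (induction rule: rowed.induct) auto

text \<open>The case \<open>j = 0\<close> collects the boxes without a first horizontal cut.\<close>

definition cut_after ::
  "(nat \<Rightarrow> real) \<Rightarrow> (nat \<Rightarrow> real) \<Rightarrow> real \<Rightarrow> real \<Rightarrow> nat \<Rightarrow> nat \<Rightarrow> real \<Rightarrow> nat set \<Rightarrow> bool" where
  "cut_after w h \<delta> g r j W A \<longleftrightarrow> (if j = 0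
     then \<exists>X Y W1 W2. A = X \<union> Y \<and> X \<inter> Y = {} \<and> W = W1 + W2 \<and> finite X \<and> sum w X \<le> W1 \<and>
       (\<forall>i\<in>X. 0 < w i \<and> \<delta> < h i \<and> h i \<le> r * g) \<and> packable w h W2 g Y \<and> (\<forall>i\<in>Y. \<delta> < w i) \<and> (Y = {} \<or> r = 1)
     else \<exists>X Y. A = X \<union> Y \<and> X \<inter> Y = {} \<and> rowed w h \<delta> g j W X \<and> rowed w h \<delta> g (r - j) W Y)"

lemma cut_after_empty: "0 \<le> g \<Longrightarrow> cut_after w h \<delta> g r j 0 {}"
proof (cases "j = 0")
  case True
  assume "0 \<le> g"
  then have "packable w h 0 g {}" by (intro packable.empty) auto
  then show ?thesis using True
    by (auto simp: cut_after_def intro!: exI[of _ "{}"] exI[of _ 0])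
qed (auto simp: cut_after_def intro: rowed.empty)

lemma cut_after_Un:
  assumes "cut_after w h \<delta> g r j W A" "cut_after w h \<delta> g r j V B" "A \<inter> B = {}"
  shows "cut_after w h \<delta> g r j (W + V) (A \<union> B)"
proof (cases "j = 0")
  case True
  obtain X Y W1 W2 where 1: "A = X \<union> Y" "X \<inter> Y = {}" "W = W1 + W2" "finite X" "sum w X \<le> W1"
    "\<forall>i\<in>X. 0 < w i \<and> \<delta> < h i \<and> h i \<le> r * g" "packable w h W2 g Y" "\<forall>i\<in>Y. \<delta> < w i" "Y = {} \<or> r = 1"
    using assms(1) True unfolding cut_after_def by auto
  obtain X' Y' V1 V2 where 2: "B = X' \<union> Y'" "X' \<inter> Y' = {}" "V = V1 + V2" "finite X'" "sum w X' \<le> V1"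
    "\<forall>i\<in>X'. 0 < w i \<and> \<delta> < h i \<and> h i \<le> r * g" "packable w h V2 g Y'" "\<forall>i\<in>Y'. \<delta> < w i" "Y' = {} \<or> r = 1"
    using assms(2) True unfolding cut_after_def by auto
  have d: "A \<union> B = (X \<union> X') \<union> (Y \<union> Y')" "(X \<union> X') \<inter> (Y \<union> Y') = {}" "X \<inter> X' = {}" "Y \<inter> Y' = {}"
    using 1(1,2) 2(1,2) assms(3) by blast+
  have "sum w (X \<union> X') \<le> W1 + V1" using 1(4,5) 2(4,5) d(3) by (simp add: sum.union_disjoint)
  moreover have "packable w h (W2 + V2) g (Y \<union> Y')" using 1(7) 2(7) d(4) by (intro packable.vcut)
  moreover have "W + V = (W1 + V1) + (W2 + V2)" using 1(3) 2(3) by simp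
  moreover have "finite (X \<union> X')" "\<forall>i\<in>X \<union> X'. 0 < w i \<and> \<delta> < h i \<and> h i \<le> r * g" "\<forall>i\<in>Y \<union> Y'. \<delta> < w i"
    "Y \<union> Y' = {} \<or> r = 1"
    using 1(4,6,8,9) 2(4,6,8,9) by auto
  ultimately show ?thesis using d(1,2) True unfolding cut_after_def by auto
next
  case False
  obtain X Y where 1: "A = X \<union> Y" "X \<inter> Y = {}" "rowed w h \<delta> g j W X" "rowed w h \<delta> g (r - j) W Y"
    using assms(1) False unfolding cut_after_def by auto
  obtain X' Y' where 2: "B = X' \<union> Y'" "X' \<inter> Y' = {}" "rowed w h \<delta> g j V X'" "rowed w h \<delta> g (r - j) V Y'"
    using assms(2) False unfolding cut_after_def by auto
  have d: "A \<union> B = (X \<union> X') \<union> (Y \<union> Y')" "(X \<union> X') \<inter> (Y \<union> Y') = {}" "X \<inter> X' = {}" "Y \<inter> Y' = {}"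
    using 1(1,2) 2(1,2) assms(3) by blast+
  have "rowed w h \<delta> g j (W + V) (X \<union> X')" "rowed w h \<delta> g (r - j) (W + V) (Y \<union> Y')"
    using 1 2 d by (auto intro: rowed.vcut)
  then show ?thesis using d(1,2) False unfolding cut_after_def by auto
qed

lemma cut_after_family_single:
  assumes "cut_after w h \<delta> g r j W A" "j < r" "0 \<le> g"
  shows "\<exists>Wf G. (\<forall>i<r. cut_after w h \<delta> g r i (Wf i) (G i)) \<and> sum Wf {..<r} = W \<and>
    disjoint_family_on G {..<r} \<and> (\<Union>i<r. G i) = A"
proof (intro exI conjI)
  let ?W = "\<lambda>i. if i = j then W else 0" and ?G = "\<lambda>i. if i = j then A else {}"
  show "\<forall>i<r. cut_after w h \<delta> g r i (?W i) (?G i)" using assms cut_after_empty by auto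
  show "sum ?W {..<r} = W" using assms(2) by (simp add: sum.delta)
  show "disjoint_family_on ?G {..<r}" by (auto simp: disjoint_family_on_def)
  show "(\<Union>i<r. ?G i) = A" using assms(2) by auto
qed

text \<open>Above its horizontal cuts, a box is a sequence of boxes side by side, each of which is a
  leaf or starts with a horizontal cut after some number \<open>j\<close> of rows. Their order is
  irrelevant, so they can be collected by \<open>j\<close>; the group with \<open>j = 0\<close>
  consists of leaves. A cut with no rows on one side has nothing on that side and is
  skipped.\<close>

lemma rowed_cut_family:
  assumes "rowed w h \<delta> g r W A" "1 \<le> r" "0 \<le> g" "0 < \<delta>"
  shows "\<exists>Wf G. (\<forall>i<r. cut_after w h \<delta> g r i (Wf i) (G i)) \<and> sum Wf {..<r} = W \<and>
    disjoint_family_on G {..<r} \<and> (\<Union>i<r. G i) = A"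
  using assms
proof (induction rule: rowed.induct)
  case (empty W r)
  then have ge: "packable w h W g {}" by (intro packable.empty) auto
  have "cut_after w h \<delta> g r 0 W {}" unfolding cut_after_def if_P[OF refl]
    by (rule exI[of _ "{}"], rule exI[of _ "{}"], rule exI[of _ 0], rule exI[of _ W])
      (use ge in auto)
  then show ?case using empty by (intro cut_after_family_single) auto
next
  case (tall i W r)
  have ge: "packable w h 0 g {}" using tall by (intro packable.empty) auto
  have "cut_after w h \<delta> g r 0 W {i}" unfolding cut_after_def if_P[OF refl]
    by (rule exI[of _ "{i}"], rule exI[of _ "{}"], rule exI[of _ W], rule exI[of _ 0])
      (use ge tall in auto)
  then show ?case using tall by (intro cut_after_family_single) auto
next
  case (wide W A)
  have "cut_after w h \<delta> g 1 0 W A" unfolding cut_after_def if_P[OF refl]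
    by (rule exI[of _ "{}"], rule exI[of _ A], rule exI[of _ 0], rule exI[of _ W])
      (use wide in auto)
  then show ?case using wide by (intro cut_after_family_single) auto
next
  case (vcut r W1 A W2 B)
  obtain Wf G where 1: "\<And>i. i < r \<Longrightarrow> cut_after w h \<delta> g r i (Wf i) (G i)" "sum Wf {..<r} = W1"
    "disjoint_family_on G {..<r}" "(\<Union>i<r. G i) = A" using vcut.IH(1) vcut.prems by blast
  obtain Vf K where 2: "\<And>i. i < r \<Longrightarrow> cut_after w h \<delta> g r i (Vf i) (K i)" "sum Vf {..<r} = W2"
    "disjoint_family_on K {..<r}" "(\<Union>i<r. K i) = B" using vcut.IH(2) vcut.prems by blast
  show ?case
  proof (intro exI conjI)
    show "\<forall>i<r. cut_after w h \<delta> g r i (Wf i + Vf i) (G i \<union> K i)"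
      using 1(1,4) 2(1,4) vcut.hyps(3) by (intro allI impI cut_after_Un) auto
    show "sum (\<lambda>i. Wf i + Vf i) {..<r} = W1 + W2" using 1(2) 2(2) by (simp add: sum.distrib)
    show "(\<Union>i<r. G i \<union> K i) = A \<union> B" using 1(4) 2(4) by auto
    show "disjoint_family_on (\<lambda>i. G i \<union> K i) {..<r}"
    proof (unfold disjoint_family_on_def, intro ballI impI)
      fix i j assume ij: "i \<in> {..<r}" "j \<in> {..<r}" "i \<noteq> j"
      have "G i \<inter> G j = {}" "K i \<inter> K j = {}" using 1(3) 2(3) ij by (auto simp: disjoint_family_on_def)
      moreover have "G i \<subseteq> A" "G j \<subseteq> A" "K i \<subseteq> B" "K j \<subseteq> B" using 1(4) 2(4) ij by auto
      ultimately show "(G i \<union> K i) \<inter> (G j \<union> K j) = {}" using vcut.hyps(3) by blast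
    qed
  qed
next
  case (hcut r1 W A r2 B)
  note f = rowed_facts[OF hcut.hyps(1)] and z = rowed_0[OF hcut.hyps(1)] rowed_0[OF hcut.hyps(2)]
  show ?case
  proof (cases "r1 = 0 \<or> r2 = 0")
    case True
    then show ?thesis using hcut z by auto
  next
    case False
    then have "cut_after w h \<delta> g (r1 + r2) r1 W (A \<union> B)"
      using hcut.hyps unfolding cut_after_def by auto
    then show ?thesis using hcut.prems False by (intro cut_after_family_single) auto
  qed
qed

lemma tight_packable_family_lossy:
  fixes r :: nat
  assumes "\<And>i. i < r \<Longrightarrow> \<exists>G'\<subseteq>G i. card (G i - G') \<le> l \<and> tight_packable w h \<kappa> k (Wf i) H G'"
    and "disjoint_family_on G {..<r}" "0 \<le> H" "\<And>i. i < r \<Longrightarrow> finite (G i)"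
  shows "\<exists>A'\<subseteq>(\<Union>i<r. G i). card ((\<Union>i<r. G i) - A') \<le> r * l \<and> tight_packable w h \<kappa> (r * k + 1) (sum Wf {..<r}) H A'"
proof -
  obtain G' where G': "\<And>i. i < r \<Longrightarrow> G' i \<subseteq> G i \<and> card (G i - G' i) \<le> l \<and> tight_packable w h \<kappa> k (Wf i) H (G' i)"
    using assms(1) by metis
  have "disjoint_family_on G' {..<r}"
    using assms(2) G' unfolding disjoint_family_on_def by (metis Int_mono bot.extremum_uniqueI lessThan_iff)
  then have 1: "tight_packable w h \<kappa> (r * k + 1) (sum Wf {..<r}) H (\<Union>i<r. G' i)"
    using G' assms(3) by (intro tight_packable_vcut_family) auto
  have "card ((\<Union>i<r. G i) - (\<Union>i<r. G' i)) \<le> card (\<Union>i<r. G i - G' i)"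
    using assms(4) by (intro card_mono) auto
  also have "\<dots> \<le> (\<Sum>i<r. card (G i - G' i))" by (intro card_UN_le) auto
  also have "\<dots> \<le> (\<Sum>i<r. l)" using G' by (intro sum_mono) auto
  finally have "card ((\<Union>i<r. G i) - (\<Union>i<r. G' i)) \<le> r * l" by simp
  moreover have "(\<Union>i<r. G' i) \<subseteq> (\<Union>i<r. G i)" using G' by (intro UN_mono) auto
  ultimately show ?thesis using 1 by blast
qed

text \<open>Boxes that start with the same horizontal cut can be placed next to each other, so that this cut becomes
  a single one. The number of pieces therefore only depends on the number of rows.\<close>

lemma tight_packable_rowed:
  fixes \<delta> \<kappa> g F :: real and k1 l1 R :: nat
  assumes "0 < \<delta>" "0 < \<kappa>" "\<kappa> < 1" "0 < g" "1 \<le> F" "R * (g * F) \<le> 2"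
    and wide: "\<And>w h W A. packable w h W g A \<Longrightarrow> (\<And>i. i \<in> A \<Longrightarrow> \<delta> < w i) \<Longrightarrow> W \<le> 1 \<Longrightarrow>
      \<exists>A'\<subseteq>A. card (A - A') \<le> l1 \<and> tight_packable w h \<kappa> k1 W (g * F) A'"
    and tight: "\<And>w h W q X. finite X \<Longrightarrow> sum w X \<le> W \<Longrightarrow> (\<And>i. i \<in> X \<Longrightarrow> 0 < w i \<and> \<delta> < h i \<and> h i \<le> q) \<Longrightarrow>
      0 \<le> q \<Longrightarrow> q \<le> 2 \<Longrightarrow> tight_packable w h \<kappa> k1 W q X"
  shows "\<exists>k l. \<forall>r\<le>R. \<forall>w h W A. rowed w h \<delta> g r W A \<longrightarrow> W \<le> 1 \<longrightarrow>
    (\<exists>A'\<subseteq>A. card (A - A') \<le> l \<and> tight_packable w h \<kappa> k W (r * (g * F)) A')"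
  using assms(6)
proof (induction R)
  case 0
  show ?case
  proof (rule exI[of _ 1], rule exI[of _ 0], intro allI impI)
    fix r w h W A assume *: "r \<le> (0::nat)" "rowed w h \<delta> g r W A" "W \<le> 1"
    have "A = {}" using rowed_0[OF *(2)] * assms(1) by auto
    then show "\<exists>A'\<subseteq>A. card (A - A') \<le> 0 \<and> tight_packable w h \<kappa> 1 W (r * (g * F)) A'"
      using rowed_facts[OF *(2)] * by (auto intro: tight_packable.empty)
  qed
next
  case (Suc R)
  have gF: "0 < g * F" "g \<le> g * F" using assms(4,5) by auto
  have "R * (g * F) \<le> 2" using Suc.prems gF by (simp add: algebra_simps)
  from Suc.IH[OF this] obtain k l where "\<forall>r\<le>R. \<forall>w h W A. rowed w h \<delta> g r W A \<longrightarrow> W \<le> 1 \<longrightarrow>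
    (\<exists>A'\<subseteq>A. card (A - A') \<le> l \<and> tight_packable w h \<kappa> k W (r * (g * F)) A')" by (elim exE)
  note IH = this[rule_format]
  \<comment> \<open>One constant for both kinds of groups: leaves need \<open>k1 + (k1 + 1)\<close>
    pieces, and the two parts of a horizontal cut need \<open>k + k\<close> by the induction
    hypothesis. \<open>ll\<close> combines the numbers of lost items in the same way.\<close>
  define kk where "kk = k1 + k1 + 2 * k + 1"
  define ll where "ll = l1 + 2 * l"
  define k' where "k' = Suc R * kk + 1"
  define l' where "l' = Suc R * ll"
  have *: "\<exists>A'\<subseteq>A. card (A - A') \<le> l' \<and> tight_packable w h \<kappa> k' W (r * (g * F)) A'"
    if A: "r = Suc R" "rowed w h \<delta> g r W A" "W \<le> 1" for r w h W A
  proof -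
    obtain Wf G where G: "\<And>i. i < r \<Longrightarrow> cut_after w h \<delta> g r i (Wf i) (G i)" "sum Wf {..<r} = W"
      "disjoint_family_on G {..<r}" "(\<Union>i<r. G i) = A"
      using rowed_cut_family[OF A(2)] A(1) assms(1,4) by auto
    have fin: "finite (G i)" if "i < r" for i using rowed_facts[OF A(2)] G(4) that
      by (metis UN_upper finite_subset lessThan_iff)
    have Wf0: "0 \<le> Wf i" if ir: "i < r" for i
    proof (cases "i = 0")
      case True
      obtain X Y W1 W2 where x: "Wf i = W1 + W2" "sum w X \<le> W1" "\<forall>j\<in>X. 0 < w j" "packable w h W2 g Y"
        using G(1)[OF ir] True unfolding cut_after_def by auto
      have "0 \<le> sum w X" using x(3) by (intro sum_nonneg) auto
      then show ?thesis using x packable_nonneg[OF x(4)] by simp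
    next
      case False
      then show ?thesis using G(1)[OF ir] rowed_facts unfolding cut_after_def by metis
    qed
    have Wf1: "Wf i \<le> 1" if "i < r" for i
      using member_le_sum[of i "{..<r}" Wf] Wf0 G(2) A(3) that by fastforce
    have Q: "\<exists>G'\<subseteq>G i. card (G i - G') \<le> ll \<and> tight_packable w h \<kappa> kk (Wf i) (r * (g * F)) G'" if i: "i < r" for i
    proof (cases "i = 0")
      case True
      obtain X Y W1 W2 where x: "G i = X \<union> Y" "X \<inter> Y = {}" "Wf i = W1 + W2" "finite X" "sum w X \<le> W1"
        "\<forall>j\<in>X. 0 < w j \<and> \<delta> < h j \<and> h j \<le> r * g" "packable w h W2 g Y" "\<forall>j\<in>Y. \<delta> < w j" "Y = {} \<or> r = 1"
        using G(1)[OF i] True unfolding cut_after_def by auto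
      have "0 \<le> sum w X" using x(6) by (intro sum_nonneg) auto
      then have W2: "0 \<le> W2" "W2 \<le> 1" using Wf1[OF i] x(3,5) packable_nonneg[OF x(7)] by auto
      have rg: "r * g \<le> r * (g * F)" using gF by (intro mult_left_mono) auto
      have p1: "tight_packable w h \<kappa> k1 W1 (r * (g * F)) X"
      proof (rule tight)
        show "0 < w j \<and> \<delta> < h j \<and> h j \<le> r * (g * F)" if "j \<in> X" for j
          using x(6) that rg by fastforce
        show "r * (g * F) \<le> 2" using Suc.prems A(1) by simp
      qed (use x(4,5) gF in auto)
      \<comment> \<open>The bound \<open>k1 + 1\<close> instead of \<open>k1\<close> guarantees the
        one leaf that an empty part still needs.\<close>
      obtain Y' where Y': "Y' \<subseteq> Y" "card (Y - Y') \<le> l1" "tight_packable w h \<kappa> (k1 + 1) W2 (r * (g * F)) Y'"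
      proof (cases "Y = {}")
        case True
        have "tight_packable w h \<kappa> (k1 + 1) W2 (r * (g * F)) {}" using W2 gF by (intro tight_packable.empty) auto
        then show thesis using that[of "{}"] True by auto
      next
        case False
        then have "r = 1" using x(9) by auto
        then show thesis using wide[OF x(7)] x(8) W2 that tight_packable_mono_k[of w h \<kappa> k1 W2 "g * F" _ "k1 + 1"] by force
      qed
      have "tight_packable w h \<kappa> (k1 + (k1 + 1)) (W1 + W2) (r * (g * F)) (X \<union> Y')"
        using p1 Y' x(2) by (intro tight_packable.vcut) auto
      then have "tight_packable w h \<kappa> kk (Wf i) (r * (g * F)) (X \<union> Y')"
        unfolding x(3) by (rule tight_packable_mono_k) (simp add: kk_def)
      moreover have "G i - (X \<union> Y') = Y - Y'" using x(1,2) by auto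
      ultimately show ?thesis using Y' x(1) by (intro exI[of _ "X \<union> Y'"]) (auto simp: ll_def)
    next
      case False
      obtain X Y where x: "G i = X \<union> Y" "X \<inter> Y = {}" "rowed w h \<delta> g i (Wf i) X" "rowed w h \<delta> g (r - i) (Wf i) Y"
        using G(1)[OF i] False unfolding cut_after_def by auto
      obtain X' where X': "X' \<subseteq> X" "card (X - X') \<le> l" "tight_packable w h \<kappa> k (Wf i) (i * (g * F)) X'"
        using IH[OF _ x(3)] i A(1) Wf1[OF i] by auto
      have ri: "r - i \<le> R" using i A(1) False by auto
      obtain Y' where Y': "Y' \<subseteq> Y" "card (Y - Y') \<le> l" "tight_packable w h \<kappa> k (Wf i) (real (r - i) * (g * F)) Y'"
        using IH[OF ri x(4)] Wf1[OF i] by auto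
      have "tight_packable w h \<kappa> (k + k) (Wf i) (i * (g * F) + real (r - i) * (g * F)) (X' \<union> Y')"
        using X' Y' x(2) by (intro tight_packable.hcut) auto
      moreover have "i * (g * F) + real (r - i) * (g * F) = r * (g * F)"
        using i by (simp add: of_nat_diff algebra_simps)
      ultimately have "tight_packable w h \<kappa> kk (Wf i) (r * (g * F)) (X' \<union> Y')"
        using tight_packable_mono_k[of w h \<kappa> "k + k" _ _ _ kk] by (simp add: kk_def)
      moreover have "card (G i - (X' \<union> Y')) \<le> ll"
      proof -
        have "G i - (X' \<union> Y') \<subseteq> (X - X') \<union> (Y - Y')" using x(1) by auto
        then have "card (G i - (X' \<union> Y')) \<le> card ((X - X') \<union> (Y - Y'))"
          using fin[OF i] x(1) by (intro card_mono) auto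
        also have "\<dots> \<le> card (X - X') + card (Y - Y')" by (rule card_Un_le)
        finally show ?thesis using X'(2) Y'(2) by (simp add: ll_def)
      qed
      ultimately show ?thesis using X'(1) Y'(1) x(1) by (intro exI[of _ "X' \<union> Y'"]) auto
    qed
    have "0 \<le> r * (g * F)" using gF by simp
    from tight_packable_family_lossy[OF Q G(3) this fin]
    show ?thesis using G(2,4) A(1) by (auto simp: k'_def l'_def)
  qed
  show ?case
  proof (rule exI[of _ "k' + k"], rule exI[of _ "l' + l"], intro allI impI)
    fix r w h W A assume A: "r \<le> Suc R" "rowed w h \<delta> g r W A" "W \<le> 1"
    show "\<exists>A'\<subseteq>A. card (A - A') \<le> l' + l \<and> tight_packable w h \<kappa> (k' + k) W (r * (g * F)) A'"
    proof (cases "r \<le> R")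
      case True
      obtain A' where "A' \<subseteq> A" "card (A - A') \<le> l" "tight_packable w h \<kappa> k W (r * (g * F)) A'"
        using IH[OF True A(2,3)] by auto
      then show ?thesis using tight_packable_mono_k[of w h \<kappa> k _ _ A' "k' + k"] by (intro exI[of _ A']) auto
    next
      case False
      obtain A' where "A' \<subseteq> A" "card (A - A') \<le> l'" "tight_packable w h \<kappa> k' W (r * (g * F)) A'"
        using *[OF _ A(2,3)] A(1) False by auto
      then show ?thesis using tight_packable_mono_k[of w h \<kappa> k' _ _ A' "k' + k"] by (intro exI[of _ A']) auto
    qed
  qed
qed

section \<open>Packing with a free horizontal strip\<close>

text \<open>Positions are measured in rows, so that row boundaries are the integers; the boundaries inside
  the half-open interval from \<open>y\<close> to \<open>z\<close> are \<open>\<lfloor>y\<rfloor> + 1, \<dots>, \<lfloor>z\<rfloor>\<close>.\<close>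

definition aligned ::
  "(nat \<Rightarrow> real) \<Rightarrow> (nat \<Rightarrow> real) \<Rightarrow> real \<Rightarrow> real \<Rightarrow> real \<Rightarrow> real \<Rightarrow> real \<Rightarrow> nat set \<Rightarrow> bool" where
  "aligned w h \<delta> g y z W A \<longleftrightarrow> (if \<lfloor>y\<rfloor> = \<lfloor>z\<rfloor>
     then packable w h W ((z - y) * g) A \<and> (\<forall>i\<in>A. \<delta> < w i)
     else \<exists>A1 A2 A3. A = A1 \<union> A2 \<union> A3 \<and> A1 \<inter> A2 = {} \<and> (A1 \<union> A2) \<inter> A3 = {} \<and> (\<forall>i\<in>A1 \<union> A3. \<delta> < w i) \<and>
       packable w h W ((real_of_int \<lfloor>y\<rfloor> + 1 - y) * g) A1 \<and> rowed w h \<delta> g (nat (\<lfloor>z\<rfloor> - \<lfloor>y\<rfloor> - 1)) W A2 \<and>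
       packable w h W ((z - real_of_int \<lfloor>z\<rfloor>) * g) A3)"

lemma alignedI:
  assumes "\<lfloor>y\<rfloor> \<noteq> \<lfloor>z\<rfloor>" "A = A1 \<union> A2 \<union> A3" "A1 \<inter> A2 = {}" "(A1 \<union> A2) \<inter> A3 = {}"
    "\<forall>i\<in>A1 \<union> A3. \<delta> < w i" "packable w h W ((real_of_int \<lfloor>y\<rfloor> + 1 - y) * g) A1"
    "rowed w h \<delta> g (nat (\<lfloor>z\<rfloor> - \<lfloor>y\<rfloor> - 1)) W A2" "packable w h W ((z - real_of_int \<lfloor>z\<rfloor>) * g) A3"
  shows "aligned w h \<delta> g y z W A"
  unfolding aligned_def if_not_P[OF assms(1)] using assms(2-) by (intro exI conjI)

lemma aligned_vcut:
  assumes "aligned w h \<delta> g y z W A" "aligned w h \<delta> g y z V B" "A \<inter> B = {}"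
  shows "aligned w h \<delta> g y z (W + V) (A \<union> B)"
proof (cases "\<lfloor>y\<rfloor> = \<lfloor>z\<rfloor>")
  case True
  then show ?thesis using assms by (auto simp: aligned_def intro: packable.vcut)
next
  case False
  obtain A1 A2 A3 where 1: "A = A1 \<union> A2 \<union> A3" "A1 \<inter> A2 = {}" "(A1 \<union> A2) \<inter> A3 = {}" "\<forall>i\<in>A1 \<union> A3. \<delta> < w i"
    "packable w h W ((real_of_int \<lfloor>y\<rfloor> + 1 - y) * g) A1" "rowed w h \<delta> g (nat (\<lfloor>z\<rfloor> - \<lfloor>y\<rfloor> - 1)) W A2"
    "packable w h W ((z - real_of_int \<lfloor>z\<rfloor>) * g) A3"
    using assms(1) False unfolding aligned_def by auto
  obtain B1 B2 B3 where 2: "B = B1 \<union> B2 \<union> B3" "B1 \<inter> B2 = {}" "(B1 \<union> B2) \<inter> B3 = {}" "\<forall>i\<in>B1 \<union> B3. \<delta> < w i"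
    "packable w h V ((real_of_int \<lfloor>y\<rfloor> + 1 - y) * g) B1" "rowed w h \<delta> g (nat (\<lfloor>z\<rfloor> - \<lfloor>y\<rfloor> - 1)) V B2"
    "packable w h V ((z - real_of_int \<lfloor>z\<rfloor>) * g) B3"
    using assms(2) False unfolding aligned_def by auto
  have d: "A \<union> B = (A1 \<union> B1) \<union> (A2 \<union> B2) \<union> (A3 \<union> B3)" using 1(1) 2(1) by auto
  have e: "A1 \<inter> B1 = {}" "A2 \<inter> B2 = {}" "A3 \<inter> B3 = {}" using 1(1) 2(1) assms(3) by auto
  have "(A1 \<union> B1) \<inter> (A2 \<union> B2) = {}" "((A1 \<union> B1) \<union> (A2 \<union> B2)) \<inter> (A3 \<union> B3) = {}"
    using 1(1-3) 2(1-3) assms(3) by blast+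
  moreover have "packable w h (W + V) ((real_of_int \<lfloor>y\<rfloor> + 1 - y) * g) (A1 \<union> B1)" using 1(5) 2(5) e(1) by (rule packable.vcut)
  moreover have "rowed w h \<delta> g (nat (\<lfloor>z\<rfloor> - \<lfloor>y\<rfloor> - 1)) (W + V) (A2 \<union> B2)" using 1(6) 2(6) e(2) by (rule rowed.vcut)
  moreover have "packable w h (W + V) ((z - real_of_int \<lfloor>z\<rfloor>) * g) (A3 \<union> B3)" using 1(7) 2(7) e(3) by (rule packable.vcut)
  moreover have "\<forall>i\<in>(A1 \<union> B1) \<union> (A3 \<union> B3). \<delta> < w i" using 1(4) 2(4) by auto
  ultimately show ?thesis using d by (intro alignedI[OF False])
qed

text \<open>If both boxes contain a row boundary, the wide items at the end of the lower box and at
  the beginning of the upper box share the row around \<open>c\<close>: their heights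
  \<open>(c - \<lfloor>c\<rfloor>) * g\<close> and \<open>(\<lfloor>c\<rfloor> + 1 - c) * g\<close>
  add up to one row, which becomes a \<open>wide\<close> row. If only one of them contains a
  boundary, the other one merely extends a partial row.\<close>

lemma aligned_hcut:
  assumes "aligned w h \<delta> g y c W A" "aligned w h \<delta> g c z W B" "A \<inter> B = {}" "y \<le> c" "c \<le> z"
  shows "aligned w h \<delta> g y z W (A \<union> B)"
proof -
  have mono: "\<lfloor>y\<rfloor> \<le> \<lfloor>c\<rfloor>" "\<lfloor>c\<rfloor> \<le> \<lfloor>z\<rfloor>" using assms(4,5) by (auto intro: floor_mono)
  consider "\<lfloor>y\<rfloor> = \<lfloor>c\<rfloor>" "\<lfloor>c\<rfloor> = \<lfloor>z\<rfloor>" | "\<lfloor>y\<rfloor> \<noteq> \<lfloor>c\<rfloor>" "\<lfloor>c\<rfloor> = \<lfloor>z\<rfloor>" | "\<lfloor>y\<rfloor> = \<lfloor>c\<rfloor>" "\<lfloor>c\<rfloor> \<noteq> \<lfloor>z\<rfloor>"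
    | "\<lfloor>y\<rfloor> \<noteq> \<lfloor>c\<rfloor>" "\<lfloor>c\<rfloor> \<noteq> \<lfloor>z\<rfloor>" by blast
  then show ?thesis
  proof cases
    case 1
    have "packable w h W ((c - y) * g) A" "packable w h W ((z - c) * g) B" "\<forall>i\<in>A \<union> B. \<delta> < w i"
      using assms(1,2) 1 by (auto simp: aligned_def)
    then have "packable w h W ((c - y) * g + (z - c) * g) (A \<union> B)" using assms(3) by (intro packable.hcut)
    then show ?thesis using 1 \<open>\<forall>i\<in>A \<union> B. \<delta> < w i\<close> by (simp add: aligned_def algebra_simps)
  next
    case 2
    have ne: "\<lfloor>y\<rfloor> \<noteq> \<lfloor>z\<rfloor>" using 2 by simp
    obtain A1 A2 A3 where A: "A = A1 \<union> A2 \<union> A3" "A1 \<inter> A2 = {}" "(A1 \<union> A2) \<inter> A3 = {}" "\<forall>i\<in>A1 \<union> A3. \<delta> < w i"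
      "packable w h W ((real_of_int \<lfloor>y\<rfloor> + 1 - y) * g) A1" "rowed w h \<delta> g (nat (\<lfloor>c\<rfloor> - \<lfloor>y\<rfloor> - 1)) W A2"
      "packable w h W ((c - real_of_int \<lfloor>c\<rfloor>) * g) A3"
      using assms(1) 2 unfolding aligned_def by auto
    have B: "packable w h W ((z - c) * g) B" "\<forall>i\<in>B. \<delta> < w i" using assms(2) 2 by (auto simp: aligned_def)
    have "packable w h W ((c - real_of_int \<lfloor>c\<rfloor>) * g + (z - c) * g) (A3 \<union> B)"
      using A(1,7) B(1) assms(3) by (intro packable.hcut) auto
    then have "packable w h W ((z - real_of_int \<lfloor>z\<rfloor>) * g) (A3 \<union> B)" using 2 by (simp add: algebra_simps)
    moreover have "A \<union> B = A1 \<union> A2 \<union> (A3 \<union> B)" "(A1 \<union> A2) \<inter> (A3 \<union> B) = {}" "\<forall>i\<in>A1 \<union> (A3 \<union> B). \<delta> < w i"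
      using A(1,3,4) B(2) assms(3) by auto
    ultimately show ?thesis using A(2,5,6) unfolding 2(2) by (intro alignedI[OF ne])
  next
    case 3
    have ne: "\<lfloor>y\<rfloor> \<noteq> \<lfloor>z\<rfloor>" using 3 by simp
    obtain B1 B2 B3 where B: "B = B1 \<union> B2 \<union> B3" "B1 \<inter> B2 = {}" "(B1 \<union> B2) \<inter> B3 = {}" "\<forall>i\<in>B1 \<union> B3. \<delta> < w i"
      "packable w h W ((real_of_int \<lfloor>c\<rfloor> + 1 - c) * g) B1" "rowed w h \<delta> g (nat (\<lfloor>z\<rfloor> - \<lfloor>c\<rfloor> - 1)) W B2"
      "packable w h W ((z - real_of_int \<lfloor>z\<rfloor>) * g) B3"
      using assms(2) 3 unfolding aligned_def by auto
    have A: "packable w h W ((c - y) * g) A" "\<forall>i\<in>A. \<delta> < w i" using assms(1) 3 by (auto simp: aligned_def)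
    have "packable w h W ((c - y) * g + (real_of_int \<lfloor>c\<rfloor> + 1 - c) * g) (A \<union> B1)"
      using B(1,5) A(1) assms(3) by (intro packable.hcut) auto
    then have "packable w h W ((real_of_int \<lfloor>y\<rfloor> + 1 - y) * g) (A \<union> B1)" using 3 by (simp add: algebra_simps)
    moreover have "A \<union> B = (A \<union> B1) \<union> B2 \<union> B3" "(A \<union> B1) \<inter> B2 = {}" "((A \<union> B1) \<union> B2) \<inter> B3 = {}"
      "\<forall>i\<in>(A \<union> B1) \<union> B3. \<delta> < w i"
      using B(1-4) A(2) assms(3) by auto
    ultimately show ?thesis using B(6,7) unfolding 3(1)[symmetric] by (intro alignedI[OF ne])
  next
    case 4
    have ne: "\<lfloor>y\<rfloor> \<noteq> \<lfloor>z\<rfloor>" using 4 mono by simp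
    obtain A1 A2 A3 where A: "A = A1 \<union> A2 \<union> A3" "A1 \<inter> A2 = {}" "(A1 \<union> A2) \<inter> A3 = {}" "\<forall>i\<in>A1 \<union> A3. \<delta> < w i"
      "packable w h W ((real_of_int \<lfloor>y\<rfloor> + 1 - y) * g) A1" "rowed w h \<delta> g (nat (\<lfloor>c\<rfloor> - \<lfloor>y\<rfloor> - 1)) W A2"
      "packable w h W ((c - real_of_int \<lfloor>c\<rfloor>) * g) A3"
      using assms(1) 4 unfolding aligned_def by auto
    obtain B1 B2 B3 where B: "B = B1 \<union> B2 \<union> B3" "B1 \<inter> B2 = {}" "(B1 \<union> B2) \<inter> B3 = {}" "\<forall>i\<in>B1 \<union> B3. \<delta> < w i"
      "packable w h W ((real_of_int \<lfloor>c\<rfloor> + 1 - c) * g) B1" "rowed w h \<delta> g (nat (\<lfloor>z\<rfloor> - \<lfloor>c\<rfloor> - 1)) W B2"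
      "packable w h W ((z - real_of_int \<lfloor>z\<rfloor>) * g) B3"
      using assms(2) 4 unfolding aligned_def by auto
    have "packable w h W ((c - real_of_int \<lfloor>c\<rfloor>) * g + (real_of_int \<lfloor>c\<rfloor> + 1 - c) * g) (A3 \<union> B1)"
      using A(1,7) B(1,5) assms(3) by (intro packable.hcut) auto
    then have "packable w h W g (A3 \<union> B1)" by (simp add: algebra_simps)
    then have "rowed w h \<delta> g 1 W (A3 \<union> B1)" using A(4) B(4) by (intro rowed.wide) auto
    then have "rowed w h \<delta> g (nat (\<lfloor>c\<rfloor> - \<lfloor>y\<rfloor> - 1) + (1 + nat (\<lfloor>z\<rfloor> - \<lfloor>c\<rfloor> - 1))) W (A2 \<union> ((A3 \<union> B1) \<union> B2))"
      using A(1,3,6) B(1,2,6) assms(3) by (intro rowed.hcut) auto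
    moreover have "nat (\<lfloor>c\<rfloor> - \<lfloor>y\<rfloor> - 1) + (1 + nat (\<lfloor>z\<rfloor> - \<lfloor>c\<rfloor> - 1)) = nat (\<lfloor>z\<rfloor> - \<lfloor>y\<rfloor> - 1)"
      using mono 4 by linarith
    ultimately have "rowed w h \<delta> g (nat (\<lfloor>z\<rfloor> - \<lfloor>y\<rfloor> - 1)) W (A2 \<union> ((A3 \<union> B1) \<union> B2))" by simp
    moreover have "A \<union> B = A1 \<union> (A2 \<union> ((A3 \<union> B1) \<union> B2)) \<union> B3" using A(1) B(1) by auto
    moreover have "A1 \<inter> (A2 \<union> ((A3 \<union> B1) \<union> B2)) = {}" "(A1 \<union> (A2 \<union> ((A3 \<union> B1) \<union> B2))) \<inter> B3 = {}"
      using A(1-3) B(1-3) assms(3) by auto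
    moreover have "\<forall>i\<in>A1 \<union> B3. \<delta> < w i" using A(4) B(4) by auto
    ultimately show ?thesis using A(5) B(7) by (intro alignedI[OF ne])
  qed
qed

text \<open>Stretching by \<open>f\<close> gives an item higher than \<open>\<delta>\<close> a slack
  of at least \<open>(f - 1) * \<delta> \<ge> 2 * g\<close>, so it still fits into the whole rows
  after losing a partial row at each end. A wide item is dropped if its leaf contains a row
  boundary; the leaves at one boundary lie side by side, so a boundary costs at most
  \<open>W / \<delta>\<close> items. As the intervals are half-open, the number of boundaries is
  additive under horizontal cuts.\<close>

lemma packable_align:
  fixes \<delta> g f :: real
  assumes "packable w h W q A" "\<And>i. i \<in> A \<Longrightarrow> \<delta> < h i \<or> \<delta> < w i" "1 \<le> f" "0 < g" "2 * g \<le> (f - 1) * \<delta>" "0 < \<delta>"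
  shows "\<exists>D\<subseteq>A. \<delta> * card D \<le> W * (\<lfloor>y + f * q / g\<rfloor> - \<lfloor>y\<rfloor>) \<and> aligned w h \<delta> g y (y + f * q / g) W (A - D)"
  using assms(1,2)
proof (induction arbitrary: y rule: packable.induct)
  case (empty W q)
  define z where "z = y + f * q / g"
  have yz: "y \<le> z" "\<lfloor>y\<rfloor> \<le> \<lfloor>z\<rfloor>" using empty assms(3,4) by (auto simp: z_def intro!: floor_mono)
  have "aligned w h \<delta> g y z W {}"
  proof (cases "\<lfloor>y\<rfloor> = \<lfloor>z\<rfloor>")
    case True
    then show ?thesis using yz empty assms(4) by (auto simp: aligned_def intro!: packable.empty mult_nonneg_nonneg)
  next
    case False
    have "packable w h W ((real_of_int \<lfloor>y\<rfloor> + 1 - y) * g) {}" "packable w h W ((z - real_of_int \<lfloor>z\<rfloor>) * g) {}"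
      using empty assms(4) by (auto intro!: packable.empty mult_nonneg_nonneg)
    then show ?thesis using False empty by (auto simp: aligned_def intro: rowed.empty)
  qed
  then show ?case using yz empty unfolding z_def by (intro exI[of _ "{}"]) auto
next
  case (item i W q)
  define z where "z = y + f * q / g"
  have qp: "0 < q" using item by simp
  have yz: "y \<le> z" "\<lfloor>y\<rfloor> \<le> \<lfloor>z\<rfloor>" using qp assms(3,4) by (auto simp: z_def intro!: floor_mono)
  have zg: "(z - y) * g = f * q" using assms(4) by (simp add: z_def)
  have W: "0 \<le> W" using item by simp
  show ?case
  proof (cases "\<delta> < h i")
    case True
    have "(f - 1) * \<delta> \<le> (f - 1) * h i" using True assms(3) by (intro mult_left_mono) auto
    moreover have "f * h i \<le> f * q" using item assms(3) by (intro mult_left_mono) auto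
    ultimately have "h i \<le> f * q - 2 * g" using assms(5) by (simp add: algebra_simps)
    also have "\<dots> = (z - y - 2) * g" using zg by (simp add: algebra_simps)
    also have "\<dots> \<le> real_of_int (\<lfloor>z\<rfloor> - \<lfloor>y\<rfloor> - 1) * g" using assms(4) by (intro mult_right_mono) linarith+
    finally have hi: "h i \<le> real_of_int (\<lfloor>z\<rfloor> - \<lfloor>y\<rfloor> - 1) * g" .
    have "0 < real_of_int (\<lfloor>z\<rfloor> - \<lfloor>y\<rfloor> - 1) * g" using hi item by linarith
    then have "0 < real_of_int (\<lfloor>z\<rfloor> - \<lfloor>y\<rfloor> - 1)" using assms(4) by (simp add: zero_less_mult_iff)
    then have pos: "0 < \<lfloor>z\<rfloor> - \<lfloor>y\<rfloor> - 1" by linarith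
    have "rowed w h \<delta> g (nat (\<lfloor>z\<rfloor> - \<lfloor>y\<rfloor> - 1)) W {i}"
      using item True hi pos by (intro rowed.tall) (auto simp: of_nat_nat)
    moreover have "packable w h W ((real_of_int \<lfloor>y\<rfloor> + 1 - y) * g) {}" "packable w h W ((z - real_of_int \<lfloor>z\<rfloor>) * g) {}"
      using W assms(4) by (auto intro!: packable.empty mult_nonneg_nonneg)
    ultimately have "aligned w h \<delta> g y z W {i}" using pos
      by (intro alignedI[of y z _ "{}" "{i}" "{}"]) auto
    then show ?thesis using yz W unfolding z_def by (intro exI[of _ "{}"]) auto
  next
    case False
    then have wi: "\<delta> < w i" using item.prems by auto
    show ?thesis
    proof (cases "\<lfloor>y\<rfloor> = \<lfloor>z\<rfloor>")
      case True
      have "q \<le> f * q" using qp assms(3) by simp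
      then have "packable w h W ((z - y) * g) {i}" unfolding zg using item by (intro packable.item) linarith+
      then have "aligned w h \<delta> g y z W {i}" using True wi by (simp add: aligned_def)
      then show ?thesis using yz W unfolding z_def by (intro exI[of _ "{}"]) auto
    next
      case False
      have "packable w h W ((real_of_int \<lfloor>y\<rfloor> + 1 - y) * g) {}" "packable w h W ((z - real_of_int \<lfloor>z\<rfloor>) * g) {}"
        using W assms(4) by (auto intro!: packable.empty mult_nonneg_nonneg)
      then have "aligned w h \<delta> g y z W {}" using False W by (auto simp: aligned_def intro: rowed.empty)
      moreover have "\<delta> * card {i} \<le> W * (\<lfloor>z\<rfloor> - \<lfloor>y\<rfloor>)"
      proof -
        have "1 \<le> real_of_int (\<lfloor>z\<rfloor> - \<lfloor>y\<rfloor>)" using False yz by linarith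
        then have "W * 1 \<le> W * real_of_int (\<lfloor>z\<rfloor> - \<lfloor>y\<rfloor>)" using W by (intro mult_left_mono) auto
        moreover have "\<delta> * card {i} \<le> W * 1" using wi item by simp
        ultimately show ?thesis by (rule order_trans[rotated])
      qed
      ultimately show ?thesis unfolding z_def by (intro exI[of _ "{i}"]) auto
    qed
  qed
next
  case (vcut W1 q A W2 B)
  let ?z = "y + f * q / g"
  obtain D where D: "D \<subseteq> A" "\<delta> * card D \<le> W1 * (\<lfloor>?z\<rfloor> - \<lfloor>y\<rfloor>)" "aligned w h \<delta> g y ?z W1 (A - D)"
    using vcut.IH(1)[of y] vcut.prems by auto
  obtain E where E: "E \<subseteq> B" "\<delta> * card E \<le> W2 * (\<lfloor>?z\<rfloor> - \<lfloor>y\<rfloor>)" "aligned w h \<delta> g y ?z W2 (B - E)"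
    using vcut.IH(2)[of y] vcut.prems by auto
  have eq: "(A \<union> B) - (D \<union> E) = (A - D) \<union> (B - E)" using D(1) E(1) vcut.hyps(3) by auto
  have "aligned w h \<delta> g y ?z (W1 + W2) ((A \<union> B) - (D \<union> E))"
    unfolding eq using D(3) E(3) vcut.hyps(3) by (intro aligned_vcut) auto
  moreover have "\<delta> * card (D \<union> E) \<le> \<delta> * (card D + card E)"
    using assms(6) of_nat_mono[OF card_Un_le[of D E], where ?'a = real] by (intro mult_left_mono) auto
  then have "\<delta> * card (D \<union> E) \<le> (W1 + W2) * (\<lfloor>?z\<rfloor> - \<lfloor>y\<rfloor>)"
    using D(2) E(2) by (simp add: distrib_left distrib_right)
  ultimately show ?case using D(1) E(1) by (intro exI[of _ "D \<union> E"]) auto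
next
  case (hcut W q1 A q2 B)
  let ?c = "y + f * q1 / g"
  let ?z = "y + f * (q1 + q2) / g"
  have z: "?c + f * q2 / g = ?z" by (simp add: distrib_left add_divide_distrib)
  obtain D where D: "D \<subseteq> A" "\<delta> * card D \<le> W * (\<lfloor>?c\<rfloor> - \<lfloor>y\<rfloor>)" "aligned w h \<delta> g y ?c W (A - D)"
    using hcut.IH(1)[of y] hcut.prems by auto
  obtain E where E: "E \<subseteq> B" "\<delta> * card E \<le> W * (\<lfloor>?z\<rfloor> - \<lfloor>?c\<rfloor>)" "aligned w h \<delta> g ?c ?z W (B - E)"
    using hcut.IH(2)[of ?c] hcut.prems unfolding z by auto
  have eq: "(A \<union> B) - (D \<union> E) = (A - D) \<union> (B - E)" using D(1) E(1) hcut.hyps(3) by auto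
  have nn: "0 \<le> q1" "0 \<le> q2" using packable_nonneg[OF hcut.hyps(1)] packable_nonneg[OF hcut.hyps(2)] by auto
  have "y \<le> ?c" "?c \<le> ?z" using nn assms(3,4) by (auto intro!: divide_right_mono mult_left_mono)
  then have "aligned w h \<delta> g y ?z W ((A \<union> B) - (D \<union> E))"
    unfolding eq using D(3) E(3) hcut.hyps(3) by (intro aligned_hcut[of _ _ _ _ _ ?c]) auto
  moreover have "\<delta> * card (D \<union> E) \<le> \<delta> * (card D + card E)"
    using assms(6) of_nat_mono[OF card_Un_le[of D E], where ?'a = real] by (intro mult_left_mono) auto
  then have "\<delta> * card (D \<union> E) \<le> W * (\<lfloor>?z\<rfloor> - \<lfloor>y\<rfloor>)"
    using D(2) E(2) by (simp add: algebra_simps)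
  ultimately show ?case using D(1) E(1) by (intro exI[of _ "D \<union> E"]) auto
qed

text \<open>Position \<open>0\<close> is a row boundary, so only the partial row at the other end
  has to be completed; this is the \<open>+ 1\<close>.\<close>

lemma aligned_rowed:
  assumes "aligned w h \<delta> g 0 z W A" "0 \<le> z" "0 < g"
  shows "rowed w h \<delta> g (nat \<lfloor>z\<rfloor> + 1) W A"
proof (cases "\<lfloor>z\<rfloor> = 0")
  case True
  then have *: "packable w h W (z * g) A" "\<forall>i\<in>A. \<delta> < w i" using assms(1) by (auto simp: aligned_def)
  have "z \<le> 1" using True by linarith
  then have "packable w h W g A" using packable_mono[OF *(1), of W g] assms(3) by simp
  then show ?thesis using *(2) True rowed.wide[of w h W g A \<delta>] by simp
next
  case False
  obtain A1 A2 A3 where A: "A = A1 \<union> A2 \<union> A3" "A1 \<inter> A2 = {}" "(A1 \<union> A2) \<inter> A3 = {}" "\<forall>i\<in>A1 \<union> A3. \<delta> < w i"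
    "packable w h W g A1" "rowed w h \<delta> g (nat (\<lfloor>z\<rfloor> - 1)) W A2" "packable w h W ((z - real_of_int \<lfloor>z\<rfloor>) * g) A3"
    using assms(1) False unfolding aligned_def by auto
  have "(z - real_of_int \<lfloor>z\<rfloor>) * g \<le> 1 * g" using assms(3) by (intro mult_right_mono) linarith+
  then have "packable w h W g A3" using packable_mono[OF A(7), of W g] by simp
  then have "rowed w h \<delta> g 1 W A1" "rowed w h \<delta> g 1 W A3"
    using A(4,5) rowed.wide[of w h W g A1 \<delta>] rowed.wide[of w h W g A3 \<delta>] by auto
  then have "rowed w h \<delta> g ((1 + nat (\<lfloor>z\<rfloor> - 1)) + 1) W ((A1 \<union> A2) \<union> A3)"
    using A(2,3,6) by (intro rowed.hcut) auto
  moreover have "1 + nat (\<lfloor>z\<rfloor> - 1) = nat \<lfloor>z\<rfloor>" using False assms(2) by linarith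
  ultimately show ?thesis using A(1) by simp
qed

text \<open>If no item is small in both directions, an arbitrarily small additional height
  \<open>\<tau>\<close> pays for everything: the factor \<open>f\<close> for aligning tall items,
  one incomplete row \<open>g\<close>, and the factor \<open>F\<close> for rearranging the wide
  items inside a row. They are chosen such that
  \<open>(f * q + g) * F \<le> q + \<tau>\<close>.\<close>

lemma tight_packable_with_slack:
  fixes \<delta> \<kappa> \<tau> :: real
  assumes "0 < \<delta>" "0 < \<kappa>" "\<kappa> < 1" "0 < \<tau>" "\<tau> \<le> 1"
  shows "\<exists>k l. \<forall>w h W q A. packable w h W q A \<longrightarrow> (\<forall>i\<in>A. \<delta> < h i \<or> \<delta> < w i) \<longrightarrow> W \<le> 1 \<longrightarrow> q \<le> 1 \<longrightarrow>
    (\<exists>A'\<subseteq>A. card (A - A') \<le> l \<and> tight_packable w h \<kappa> k W (q + \<tau>) A')"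
proof -
  define d where "d = nat \<lceil>1 / \<delta>\<rceil>"
  have "1 / \<delta> \<le> real d" unfolding d_def by linarith
  then have d: "1 \<le> d * \<delta>" using assms(1) by (simp add: field_simps)
  have "(\<lambda>m::nat. (1 + 1 / real m) ^ d) \<longlonglongrightarrow> (1 + 0) ^ d"
    by (intro tendsto_intros lim_1_over_n)
  then have "\<forall>\<^sub>F m::nat in sequentially. (1 + 1 / real m) ^ d < 1 + \<tau> / 4"
    using assms(4) by (intro order_tendstoD(2)) auto
  moreover have "\<forall>\<^sub>F m::nat in sequentially. 1 \<le> m" by (rule eventually_ge_at_top)
  ultimately have "\<forall>\<^sub>F m::nat in sequentially. (1 + 1 / real m) ^ d < 1 + \<tau> / 4 \<and> 1 \<le> m"
    by (rule eventually_conj)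
  then obtain m :: nat where m: "(1 + 1 / real m) ^ d < 1 + \<tau> / 4" "1 \<le> m"
    using eventually_sequentially by auto
  define F where "F = (1 + 1 / real m) ^ d"
  have F: "1 \<le> F" "F \<le> 1 + \<tau> / 4" using m unfolding F_def by (auto intro: one_le_power)
  define f where "f = 1 + \<tau> / 4"
  \<comment> \<open>Since \<open>(f - 1) * \<delta> = \<tau> * \<delta> / 4\<close>, the first entry
    yields \<open>2 * g \<le> (f - 1) * \<delta>\<close>, as aligning demands; the second one limits
    the cost of the incomplete row.\<close>
  define g where "g = min (\<tau> * \<delta> / 8) (\<tau> / 8)"
  have g: "0 < g" "2 * g \<le> (f - 1) * \<delta>" "g \<le> \<tau> / 8"
    using assms(1,4) by (auto simp: g_def f_def min_def field_simps)
  define R where "R = nat \<lfloor>f / g\<rfloor> + 1"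
  have bound: "(f * q + g) * F \<le> q + \<tau>" if "0 \<le> q" "q \<le> 1" for q
  proof -
    have "(f * q + g) * F \<le> (f * q + g) * (1 + \<tau> / 4)"
      using F that g f_def assms(4) by (intro mult_left_mono) auto
    also have "\<dots> = q + q * (\<tau> / 2) + q * (\<tau> * \<tau> / 16) + g * (1 + \<tau> / 4)"
      by (simp add: f_def field_simps)
    also have "\<dots> \<le> q + \<tau> / 2 + \<tau> / 16 + \<tau> / 8 * (5 / 4)"
    proof -
      have "q * (\<tau> / 2) \<le> 1 * (\<tau> / 2)" using that assms(4) by (intro mult_right_mono) auto
      moreover have "q * (\<tau> * \<tau> / 16) \<le> 1 * (\<tau> * 1 / 16)"
        using that assms(4,5) by (intro mult_mono divide_right_mono mult_left_mono) auto
      moreover have "g * (1 + \<tau> / 4) \<le> \<tau> / 8 * (5 / 4)"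
        using g assms(4,5) by (intro mult_mono) auto
      ultimately show ?thesis by linarith
    qed
    also have "\<dots> \<le> q + \<tau>" using assms(4) by simp
    finally show ?thesis .
  qed
  have rows: "(real (nat \<lfloor>f * q / g\<rfloor> + 1)) * (g * F) \<le> q + \<tau>" if "0 \<le> q" "q \<le> 1" for q
  proof -
    have "0 \<le> f * q / g" using that g assms(4) by (auto simp: f_def)
    then have "real (nat \<lfloor>f * q / g\<rfloor> + 1) \<le> f * q / g + 1" by linarith
    then have "(real (nat \<lfloor>f * q / g\<rfloor> + 1)) * (g * F) \<le> (f * q / g + 1) * (g * F)"
      using g F by (intro mult_right_mono) auto
    also have "\<dots> = (f * q + g) * F" using g by (simp add: field_simps)
    finally show ?thesis using bound[OF that] by simp
  qed
  obtain k1 l1 where "\<forall>w h W q A. packable w h W q A \<longrightarrow> (\<forall>i\<in>A. \<delta> < w i) \<longrightarrow> W \<le> d * \<delta> \<longrightarrow> W \<le> 1 \<longrightarrow>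
    (\<exists>A'\<subseteq>A. card (A - A') \<le> l1 \<and> tight_packable w h \<kappa> k1 W (q * F) A')"
    using tight_packable_wide[OF assms(1-3) m(2), of d] unfolding F_def by (elim exE)
  note wide = this[rule_format]
  obtain k2 where "\<forall>w h W q X. finite X \<longrightarrow> sum w X \<le> W \<longrightarrow>
    (\<forall>i\<in>X. 0 < w i \<and> \<delta> < h i \<and> h i \<le> q) \<longrightarrow> 0 \<le> q \<longrightarrow> q \<le> 2 \<longrightarrow> tight_packable w h \<kappa> k2 W q X"
    using tight_packable_tight_row[OF assms(1-3)] by (elim exE)
  note tight = this[rule_format]
  have "\<exists>k l. \<forall>r\<le>R. \<forall>w h W A. rowed w h \<delta> g r W A \<longrightarrow> W \<le> 1 \<longrightarrow>
    (\<exists>A'\<subseteq>A. card (A - A') \<le> l \<and> tight_packable w h \<kappa> k W (r * (g * F)) A')"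
  proof (rule tight_packable_rowed[OF assms(1-3) g(1) F(1), where ?k1.0 = "k1 + k2" and ?l1.0 = l1])
    show "R * (g * F) \<le> 2" using rows[of 1] assms(5) unfolding R_def by simp
    fix w h :: "nat \<Rightarrow> real" and W A assume A: "packable w h W g A" "\<And>i. i \<in> A \<Longrightarrow> \<delta> < w i" "W \<le> 1"
    then obtain A' where "A' \<subseteq> A" "card (A - A') \<le> l1" "tight_packable w h \<kappa> k1 W (g * F) A'"
      using wide[OF A(1)] d by auto
    then show "\<exists>A'\<subseteq>A. card (A - A') \<le> l1 \<and> tight_packable w h \<kappa> (k1 + k2) W (g * F) A'"
      using tight_packable_mono_k[of w h \<kappa> k1 W _ A' "k1 + k2"] by auto
  next
    fix w h :: "nat \<Rightarrow> real" and W q X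
    assume "finite X" "sum w X \<le> W" "\<And>i. i \<in> X \<Longrightarrow> 0 < w i \<and> \<delta> < h i \<and> h i \<le> q" "0 \<le> q" "q \<le> 2"
    then have "tight_packable w h \<kappa> k2 W q X" by (intro tight) auto
    then show "tight_packable w h \<kappa> (k1 + k2) W q X" by (rule tight_packable_mono_k) simp
  qed
  then obtain k l where "\<forall>r\<le>R. \<forall>w h W A. rowed w h \<delta> g r W A \<longrightarrow> W \<le> 1 \<longrightarrow>
    (\<exists>A'\<subseteq>A. card (A - A') \<le> l \<and> tight_packable w h \<kappa> k W (r * (g * F)) A')" by (elim exE)
  note reg = this[rule_format]
  \<comment> \<open>There are at most \<open>f / g\<close> row boundaries, each of which costs at
    most \<open>1 / \<delta>\<close> wide items.\<close>
  define l0 where "l0 = nat \<lceil>f / g / \<delta>\<rceil>"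
  show ?thesis
  proof (rule exI[of _ "k + 2"], rule exI[of _ "l0 + l"], intro allI impI)
    fix w h W q A assume A: "packable w h W q A" "\<forall>i\<in>A. \<delta> < h i \<or> \<delta> < w i" "W \<le> 1" "q \<le> 1"
    note nn = packable_nonneg[OF A(1)] and finA = packable_finite[OF A(1)]
    define z where "z = f * q / g"
    have z: "0 \<le> z" "z \<le> f / g" using nn A(4) g assms(4) by (auto simp: z_def f_def mult_left_le intro!: divide_right_mono)
    obtain D where D: "D \<subseteq> A" "\<delta> * card D \<le> W * (\<lfloor>0 + z\<rfloor> - \<lfloor>0\<rfloor>)" "aligned w h \<delta> g 0 (0 + z) W (A - D)"
      using packable_align[OF A(1) _ _ g(1,2) assms(1), of 0] A(2) assms(4) unfolding z_def f_def by force
    have "W * real_of_int \<lfloor>z\<rfloor> \<le> 1 * (f / g)"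
      using z nn A(3) by (intro mult_mono) (auto, linarith)
    then have "\<delta> * card D \<le> f / g" using D(2) by simp
    then have "real (card D) \<le> f / g / \<delta>" using assms(1)
      by (subst pos_le_divide_eq[OF assms(1)]) (simp only: mult.commute)
    then have cD: "card D \<le> l0" unfolding l0_def by linarith
    have r: "rowed w h \<delta> g (nat \<lfloor>z\<rfloor> + 1) W (A - D)" using D(3) z g by (intro aligned_rowed) auto
    have "nat \<lfloor>z\<rfloor> + 1 \<le> R" unfolding R_def using z(2) by (simp add: floor_mono nat_mono)
    from reg[OF this r A(3)] obtain A' where A': "A' \<subseteq> A - D" "card (A - D - A') \<le> l"
      "tight_packable w h \<kappa> k W (real (nat \<lfloor>z\<rfloor> + 1) * (g * F)) A'" by blast
    have "tight_packable w h \<kappa> (k + 2) W (q + \<tau>) A'"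
      using tight_packable_pad[OF A'(3), of W "q + \<tau>"] rows[of q] nn A(4) unfolding z_def by simp
    moreover have "card (A - A') \<le> l0 + l"
    proof -
      have "A - A' = D \<union> (A - D - A')" using D(1) A'(1) by auto
      then have "card (A - A') \<le> card D + card (A - D - A')" using card_Un_le by metis
      then show ?thesis using cD A'(2) by simp
    qed
    ultimately show "\<exists>A'\<subseteq>A. card (A - A') \<le> l0 + l \<and> tight_packable w h \<kappa> (k + 2) W (q + \<tau>) A'"
      using A'(1) by auto
  qed
qed

section \<open>Freeing a strip by removing half of the tall items\<close>

text \<open>\<open>y i\<close> is the distance of a wide item \<open>i\<close> from the top. Removing \<open>D\<close> makes it possible to have, above
  every level \<open>t \<le> \<delta>\<close>, only wide items and tall items that reach that level from the bottom.\<close>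

definition combed ::
  "(nat \<Rightarrow> real) \<Rightarrow> (nat \<Rightarrow> real) \<Rightarrow> real \<Rightarrow> nat set \<Rightarrow> real \<Rightarrow> real \<Rightarrow> nat set \<Rightarrow> nat set \<Rightarrow> (nat \<Rightarrow> real) \<Rightarrow> bool" where
  "combed w h \<delta> V W q A D y \<longleftrightarrow> D \<subseteq> A \<inter> V \<and> 2 * card D \<le> card {i \<in> A \<inter> V. h i < 1 - \<delta>} \<and>
     (\<forall>i\<in>D. h i < 1 - \<delta>) \<and> (\<forall>i\<in>A - V. 0 \<le> y i \<and> y i + h i \<le> q) \<and>
     (\<forall>t. 0 \<le> t \<longrightarrow> t \<le> \<delta> \<longrightarrow> t \<le> q \<longrightarrow>
       packable w h (W - sum w {i \<in> A \<inter> V - D. q - t \<le> h i}) (q - t)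
         ({i \<in> A \<inter> V - D. h i < q - t} \<union> {i \<in> A - V. t \<le> y i}) \<and>
       area w h {i \<in> A - V. y i + h i \<le> t} \<le> W * t \<and>
       sum w {i \<in> A - V. y i < t \<and> t < y i + h i} \<le> W)"

lemma combed_item_wide:
  assumes "0 < w i" "w i \<le> W" "0 < h i" "h i \<le> q" "i \<notin> V"
  shows "combed w h \<delta> V W q {i} {} (\<lambda>_. 0)"
  unfolding combed_def
proof (intro conjI allI impI)
  have iV: "{i} \<inter> V - {} = {}" "{i} - V = {i}" using assms(5) by auto
  fix t assume t: "0 \<le> t" "t \<le> \<delta>" "t \<le> q"
  have e1: "{j \<in> {i}. t \<le> 0} = (if t = 0 then {i} else {})" using t by auto
  have "packable w h W (q - t) {j \<in> {i}. t \<le> 0}" unfolding e1 using assms t by (auto intro: packable.intros)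
  then show "packable w h (W - sum w {j \<in> {i} \<inter> V - {}. q - t \<le> h j}) (q - t)
    ({j \<in> {i} \<inter> V - {}. h j < q - t} \<union> {j \<in> {i} - V. t \<le> 0})" unfolding iV by simp
  have "{j \<in> {i}. 0 + h j \<le> t} = (if h i \<le> t then {i} else {})" by auto
  then show "area w h {j \<in> {i} - V. 0 + h j \<le> t} \<le> W * t"
    unfolding iV using assms t by (auto simp: area_def intro!: mult_mono)
  have "{j \<in> {i}. 0 < t \<and> t < 0 + h j} \<subseteq> {i}" by auto
  then have "sum w {j \<in> {i}. 0 < t \<and> t < 0 + h j} \<le> sum w {i}" using assms by (intro sum_mono2) auto
  then show "sum w {j \<in> {i} - V. 0 < t \<and> t < 0 + h j} \<le> W" unfolding iV using assms by simp
qed (use assms in auto)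

lemma combed_empty: "0 \<le> W \<Longrightarrow> combed w h \<delta> V W q {} {} y"
  by (auto simp: combed_def area_def intro: packable.empty)

lemma combed_vcut:
  assumes "packable w h W1 q A" "packable w h W2 q B" "A \<inter> B = {}" "combed w h \<delta> V W1 q A D y" "combed w h \<delta> V W2 q B E y'"
  shows "\<exists>z. combed w h \<delta> V (W1 + W2) q (A \<union> B) (D \<union> E) z"
proof -
  note fin = packable_finite[OF assms(1)] packable_finite[OF assms(2)]
  note D = assms(4)[unfolded combed_def] and E = assms(5)[unfolded combed_def]
  have cDE: "2 * card D \<le> card {i \<in> A \<inter> V. h i < 1 - \<delta>}" "2 * card E \<le> card {i \<in> B \<inter> V. h i < 1 - \<delta>}"
    using D E by blast+
  define z where "z i = (if i \<in> A then y i else y' i)" for i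
  have split: "{i \<in> A \<union> B - V. P (z i) i} = {i \<in> A - V. P (y i) i} \<union> {i \<in> B - V. P (y' i) i}" for P
    using assms(3) by (auto simp: z_def)
  have sub: "D \<subseteq> A \<inter> V" "E \<subseteq> B \<inter> V" using D E by auto
  have splitV: "{i \<in> (A \<union> B) \<inter> V - (D \<union> E). P i} = {i \<in> A \<inter> V - D. P i} \<union> {i \<in> B \<inter> V - E. P i}" for P
    using assms(3) sub by auto
  have "combed w h \<delta> V (W1 + W2) q (A \<union> B) (D \<union> E) z"
    unfolding combed_def
  proof (intro conjI allI impI)
    have "card (D \<union> E) \<le> card D + card E" by (rule card_Un_le)
    moreover have e: "{i \<in> (A \<union> B) \<inter> V. h i < 1 - \<delta>} = {i \<in> A \<inter> V. h i < 1 - \<delta>} \<union> {i \<in> B \<inter> V. h i < 1 - \<delta>}" by auto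
    moreover have "card ({i \<in> A \<inter> V. h i < 1 - \<delta>} \<union> {i \<in> B \<inter> V. h i < 1 - \<delta>}) =
      card {i \<in> A \<inter> V. h i < 1 - \<delta>} + card {i \<in> B \<inter> V. h i < 1 - \<delta>}"
      using fin assms(3) by (intro card_Un_disjoint) auto
    ultimately show "2 * card (D \<union> E) \<le> card {i \<in> (A \<union> B) \<inter> V. h i < 1 - \<delta>}"
      unfolding e using cDE by linarith
    fix t assume t: "0 \<le> t" "t \<le> \<delta>" "t \<le> q"
    have g1: "packable w h (W1 - sum w {i \<in> A \<inter> V - D. q - t \<le> h i}) (q - t)
         ({i \<in> A \<inter> V - D. h i < q - t} \<union> {i \<in> A - V. t \<le> y i})"
      and g2: "packable w h (W2 - sum w {i \<in> B \<inter> V - E. q - t \<le> h i}) (q - t)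
         ({i \<in> B \<inter> V - E. h i < q - t} \<union> {i \<in> B - V. t \<le> y' i})"
      using D E t by blast+
    have e1: "sum w {i \<in> (A \<union> B) \<inter> V - (D \<union> E). q - t \<le> h i} =
      sum w {i \<in> A \<inter> V - D. q - t \<le> h i} + sum w {i \<in> B \<inter> V - E. q - t \<le> h i}"
      unfolding splitV using fin assms(3) by (intro sum.union_disjoint) auto
    have e2: "{i \<in> (A \<union> B) \<inter> V - (D \<union> E). h i < q - t} \<union> {i \<in> A \<union> B - V. t \<le> z i} =
      ({i \<in> A \<inter> V - D. h i < q - t} \<union> {i \<in> A - V. t \<le> y i}) \<union>
      ({i \<in> B \<inter> V - E. h i < q - t} \<union> {i \<in> B - V. t \<le> y' i})"
      unfolding splitV split[of "\<lambda>z i. t \<le> z"] by auto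
    show "packable w h (W1 + W2 - sum w {i \<in> (A \<union> B) \<inter> V - (D \<union> E). q - t \<le> h i}) (q - t)
         ({i \<in> (A \<union> B) \<inter> V - (D \<union> E). h i < q - t} \<union> {i \<in> A \<union> B - V. t \<le> z i})"
      unfolding e1 e2 by (rule packable_vcutI[OF g1 g2]) (use assms(3) in auto)
    have "area w h {i \<in> A - V. y i + h i \<le> t} \<le> W1 * t" "area w h {i \<in> B - V. y' i + h i \<le> t} \<le> W2 * t"
      using D E t by blast+
    then show "area w h {i \<in> A \<union> B - V. z i + h i \<le> t} \<le> (W1 + W2) * t"
      unfolding split[of "\<lambda>z i. z + h i \<le> t"] using assms(3) fin
      by (subst area_Un) (auto simp: distrib_right)
    have "sum w {i \<in> A - V. y i < t \<and> t < y i + h i} \<le> W1" "sum w {i \<in> B - V. y' i < t \<and> t < y' i + h i} \<le> W2"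
      using D E t by blast+
    then show "sum w {i \<in> A \<union> B - V. z i < t \<and> t < z i + h i} \<le> W1 + W2"
      unfolding split[of "\<lambda>z i. z < t \<and> t < z + h i"] using assms(3) fin
      by (subst sum.union_disjoint) auto
  qed (use D E assms(3) in \<open>auto simp: z_def\<close>)
  then show ?thesis by blast
qed

text \<open>The part \<open>A\<close> without tall items is put on top. A level
  \<open>t < q1\<close> ends inside \<open>A\<close>, and no tall item reaches it because all of
  them fit into height \<open>q2\<close>; so there are no columns to be split off. A level
  \<open>t \<ge> q1\<close> is the level \<open>t - q1\<close> of \<open>B\<close>, with
  \<open>A\<close> entirely above it.\<close>

lemma combed_under_wide:
  assumes "packable w h W q1 A" "A \<inter> V = {}" "combed w h \<delta> V W q2 B D y" "packable w h W q2 B" "A \<inter> B = {}"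
    "combed w h \<delta> V W q1 A {} y'"
  shows "\<exists>z. combed w h \<delta> V W (q1 + q2) (A \<union> B) D z"
proof -
  have AV: "A \<inter> V - {} = {}" "A - V = A" using assms(2) by auto
  have y': "\<forall>i\<in>A. 0 \<le> y' i \<and> y' i + h i \<le> q1"
    "\<And>t. 0 \<le> t \<Longrightarrow> t \<le> \<delta> \<Longrightarrow> t \<le> q1 \<Longrightarrow> packable w h W (q1 - t) {i \<in> A. t \<le> y' i} \<and>
       area w h {i \<in> A. y' i + h i \<le> t} \<le> W * t \<and> sum w {i \<in> A. y' i < t \<and> t < y' i + h i} \<le> W"
    using assms(6) unfolding combed_def AV by simp_all
  define z where "z i = (if i \<in> A then y' i else q1 + y i)" for i
  note fin = packable_finite[OF assms(1)] packable_finite[OF assms(4)]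
  note dA = packable_dims[OF assms(1)] and dB = packable_dims[OF assms(4)]
  have nn: "0 \<le> W" "0 \<le> q1" "0 \<le> q2" using packable_nonneg[OF assms(1)] packable_nonneg[OF assms(4)] by auto
  have c: "D \<subseteq> B \<inter> V" "2 * card D \<le> card {i \<in> B \<inter> V. h i < 1 - \<delta>}" "\<forall>i\<in>D. h i < 1 - \<delta>" "\<forall>i\<in>B - V. 0 \<le> y i \<and> y i + h i \<le> q2"
    "\<And>t. 0 \<le> t \<Longrightarrow> t \<le> \<delta> \<Longrightarrow> t \<le> q2 \<Longrightarrow>
       packable w h (W - sum w {i \<in> B \<inter> V - D. q2 - t \<le> h i}) (q2 - t)
         ({i \<in> B \<inter> V - D. h i < q2 - t} \<union> {i \<in> B - V. t \<le> y i}) \<and>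
       area w h {i \<in> B - V. y i + h i \<le> t} \<le> W * t \<and>
       sum w {i \<in> B - V. y i < t \<and> t < y i + h i} \<le> W"
    using assms(3) unfolding combed_def by blast+
  have VB: "(A \<union> B) \<inter> V = B \<inter> V" using assms(2) by auto
  have split: "{i \<in> A \<union> B - V. P (z i) i} = {i \<in> A. P (y' i) i} \<union> {i \<in> B - V. P (q1 + y i) i}" for P
    using assms(2,5) by (auto simp: z_def)
  have "combed w h \<delta> V W (q1 + q2) (A \<union> B) D z"
    unfolding combed_def VB
  proof (intro conjI allI impI)
    fix t assume t: "0 \<le> t" "t \<le> \<delta>" "t \<le> q1 + q2"
    show "packable w h (W - sum w {i \<in> B \<inter> V - D. q1 + q2 - t \<le> h i}) (q1 + q2 - t)
         ({i \<in> B \<inter> V - D. h i < q1 + q2 - t} \<union> {i \<in> A \<union> B - V. t \<le> z i})"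
    proof (cases "t < q1")
      case True
      have e1: "{i \<in> B \<inter> V - D. q1 + q2 - t \<le> h i} = {}" using True dB by force
      have g: "packable w h W ((q1 - t) + q2) ({i \<in> A. t \<le> y' i} \<union> (B - D))"
        using y'(2)[of t] t True assms(5) by (intro packable.hcut packable_subset[OF assms(4)]) auto
      have e2: "{i \<in> B \<inter> V - D. h i < q1 + q2 - t} \<union> {i \<in> A \<union> B - V. t \<le> z i} = {i \<in> A. t \<le> y' i} \<union> (B - D)"
      proof -
        have "{i \<in> B \<inter> V - D. h i < q1 + q2 - t} = B \<inter> V - D" using True dB by force
        moreover have "{i \<in> B - V. t \<le> q1 + y i} = B - V" using True c(4) by force
        ultimately show ?thesis unfolding split[of "\<lambda>z i. t \<le> z"] using c(1) by auto
      qed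
      have e3: "q1 - t + q2 = q1 + q2 - t" by simp
      show ?thesis using g unfolding e1 e2 e3 by simp
    next
      case False
      have e1: "{i \<in> A. t \<le> y' i} = {}" using False y'(1) dA by force
      have e2: "{i \<in> B - V. t \<le> q1 + y i} = {i \<in> B - V. t - q1 \<le> y i}" by auto
      have e3: "q1 + q2 - t = q2 - (t - q1)" by simp
      have "0 \<le> t - q1" "t - q1 \<le> \<delta>" "t - q1 \<le> q2" using t False nn by auto
      then show ?thesis unfolding split[of "\<lambda>z i. t \<le> z"] e1 e2 e3 Un_empty_left
        using c(5)[of "t - q1"] by blast
    qed
    show "area w h {i \<in> A \<union> B - V. z i + h i \<le> t} \<le> W * t"
    proof (cases "t \<le> q1")
      case True
      have e1: "{i \<in> B - V. q1 + y i + h i \<le> t} = {}" using True c(4) dB by force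
      show ?thesis unfolding split[of "\<lambda>z i. z + h i \<le> t"] e1 Un_empty_right using y'(2)[OF t(1,2) True] by blast
    next
      case False
      have e1: "{i \<in> A. y' i + h i \<le> t} = A" using False y'(1) by force
      have e2: "{i \<in> B - V. q1 + y i + h i \<le> t} = {i \<in> B - V. y i + h i \<le> t - q1}" by auto
      have "W * q1 + W * (t - q1) = W * t" by (simp add: algebra_simps)
      moreover have "area w h (A \<union> {i \<in> B - V. y i + h i \<le> t - q1}) \<le> W * q1 + W * (t - q1)"
        using packable_area[OF assms(1)] c(5)[of "t - q1"] t False nn assms(5) fin
        by (subst area_Un) auto
      ultimately show ?thesis unfolding split[of "\<lambda>z i. z + h i \<le> t"] e1 e2 by linarith
    qed
    show "sum w {i \<in> A \<union> B - V. z i < t \<and> t < z i + h i} \<le> W"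
    proof (cases "t \<le> q1")
      case True
      have e1: "{i \<in> B - V. q1 + y i < t \<and> t < q1 + y i + h i} = {}" using True c(4) by force
      show ?thesis unfolding split[of "\<lambda>z i. z < t \<and> t < z + h i"] e1 Un_empty_right using y'(2)[OF t(1,2) True] by blast
    next
      case False
      have e1: "{i \<in> A. y' i < t \<and> t < y' i + h i} = {}" using False y'(1) by force
      have e2: "{i \<in> B - V. q1 + y i < t \<and> t < q1 + y i + h i} = {i \<in> B - V. y i < t - q1 \<and> t - q1 < y i + h i}"
        by auto
      have "0 \<le> t - q1" "t - q1 \<le> q2" using t False by auto
      then show ?thesis unfolding split[of "\<lambda>z i. z < t \<and> t < z + h i"] e1 e2 Un_empty_left
        using c(5)[of "t - q1"] t(2) nn(2) by force
    qed
  qed (use c(1-4) y'(1) nn assms(2,5) in \<open>auto simp: z_def\<close>)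
  then show ?thesis by blast
qed

lemma combed_wide: "packable w h W q A \<Longrightarrow> A \<inter> V = {} \<Longrightarrow> \<exists>y. combed w h \<delta> V W q A {} y"
proof (induction rule: packable.induct)
  case (empty W q)
  then show ?case using combed_empty by blast
next
  case (item i W q)
  then show ?case using combed_item_wide[of w i W h q V \<delta>] by blast
next
  case (vcut W1 q A W2 B)
  then obtain y y' where "combed w h \<delta> V W1 q A {} y" "combed w h \<delta> V W2 q B {} y'" by blast
  from combed_vcut[OF vcut.hyps this] show ?case by simp
next
  case (hcut W q1 A q2 B)
  then obtain y y' where "combed w h \<delta> V W q1 A {} y" "combed w h \<delta> V W q2 B {} y'" by blast
  then show ?case using combed_under_wide[OF hcut.hyps(1) _ _ hcut.hyps(2,3)] hcut.prems by blast
qed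

text \<open>Tall items on both sides force \<open>\<delta> < q1\<close> and
  \<open>\<delta> < q2\<close>, so each tall item of the box is lower than
  \<open>1 - \<delta>\<close>. The removed ones, at most half of them, are thus charged to such
  items only, and almost full columns remain untouched. Moreover every level
  \<open>t \<le> \<delta>\<close> ends inside the cleared part \<open>A\<close>, so the inner
  structure of \<open>B\<close> does not matter.\<close>

lemma combed_above_removed:
  assumes "packable w h W q1 A" "\<And>i. i \<in> A \<inter> V \<Longrightarrow> \<delta> < h i" "packable w h W q2 B" "\<And>i. i \<in> B \<inter> V \<Longrightarrow> \<delta> < h i"
    "A \<inter> B = {}" "q1 + q2 \<le> 1" "A \<inter> V \<noteq> {}" "B \<inter> V \<noteq> {}" "card (A \<inter> V) \<le> card (B \<inter> V)" "0 \<le> \<delta>"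
  shows "\<exists>z. combed w h \<delta> V W (q1 + q2) (A \<union> B) (A \<inter> V) z"
proof -
  have "packable w h W q1 (A - V)" using assms(1) by (rule packable_subset) auto
  then obtain y' where "combed w h \<delta> V W q1 (A - V) {} y'" using combed_wide by blast
  moreover have AV: "(A - V) \<inter> V - {} = {}" "A - V - V = A - V" by auto
  ultimately have y': "\<forall>i\<in>A - V. 0 \<le> y' i \<and> y' i + h i \<le> q1"
    "\<And>t. 0 \<le> t \<Longrightarrow> t \<le> \<delta> \<Longrightarrow> t \<le> q1 \<Longrightarrow> packable w h W (q1 - t) {i \<in> A - V. t \<le> y' i} \<and>
       area w h {i \<in> A - V. y' i + h i \<le> t} \<le> W * t \<and> sum w {i \<in> A - V. y' i < t \<and> t < y' i + h i} \<le> W"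
    unfolding combed_def by simp_all
  \<comment> \<open>All wide items of \<open>B\<close> get the depth \<open>q1\<close>. It exceeds
    every level \<open>t \<le> \<delta>\<close>, so their true depths are irrelevant.\<close>
  define z where "z i = (if i \<in> A then y' i else q1)" for i
  note fin = packable_finite[OF assms(1)] packable_finite[OF assms(3)]
  note dA = packable_dims[OF assms(1)] and dB = packable_dims[OF assms(3)]
  have q: "\<delta> < q1" "\<delta> < q2" using assms(2,4,7,8) dA dB by force+
  have short: "h i < 1 - \<delta>" if "i \<in> (A \<union> B) \<inter> V" for i
    using that dA dB q assms(6) by force
  have split: "{i \<in> A \<union> B - V. P (z i) i} = {i \<in> A - V. P (y' i) i} \<union> {i \<in> B - V. P q1 i}" for P
    using assms(5) by (auto simp: z_def)
  have "combed w h \<delta> V W (q1 + q2) (A \<union> B) (A \<inter> V) z"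
    unfolding combed_def
  proof (intro conjI allI impI)
    have "{i \<in> (A \<union> B) \<inter> V. h i < 1 - \<delta>} = (A \<inter> V) \<union> (B \<inter> V)" using short by auto
    moreover have "card ((A \<inter> V) \<union> (B \<inter> V)) = card (A \<inter> V) + card (B \<inter> V)"
      using fin assms(5) by (intro card_Un_disjoint) auto
    ultimately show "2 * card (A \<inter> V) \<le> card {i \<in> (A \<union> B) \<inter> V. h i < 1 - \<delta>}" using assms(9) by simp
    fix t assume t: "0 \<le> t" "t \<le> \<delta>" "t \<le> q1 + q2"
    have tq: "t < q1" using t q by simp
    have VB: "(A \<union> B) \<inter> V - A \<inter> V = B \<inter> V" using assms(5) by auto
    have e1: "{i \<in> B \<inter> V. q1 + q2 - t \<le> h i} = {}" using tq dB by force
    have "packable w h W ((q1 - t) + q2) ({i \<in> A - V. t \<le> y' i} \<union> B)"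
      using y'(2)[of t] t tq assms(3,5) by (intro packable.hcut) auto
    moreover have "{i \<in> B \<inter> V. h i < q1 + q2 - t} \<union> {i \<in> A \<union> B - V. t \<le> z i} = {i \<in> A - V. t \<le> y' i} \<union> B"
    proof -
      have "{i \<in> B \<inter> V. h i < q1 + q2 - t} = B \<inter> V" using tq dB by force
      moreover have "{i \<in> B - V. t \<le> q1} = B - V" using tq by force
      ultimately show ?thesis unfolding split[of "\<lambda>z i. t \<le> z"] by auto
    qed
    ultimately show "packable w h (W - sum w {i \<in> (A \<union> B) \<inter> V - A \<inter> V. q1 + q2 - t \<le> h i}) (q1 + q2 - t)
         ({i \<in> (A \<union> B) \<inter> V - A \<inter> V. h i < q1 + q2 - t} \<union> {i \<in> A \<union> B - V. t \<le> z i})"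
      unfolding VB e1 by (simp add: add_diff_eq diff_add_eq)
    have e1: "{i \<in> B - V. q1 + h i \<le> t} = {}" using tq dB by force
    show "area w h {i \<in> A \<union> B - V. z i + h i \<le> t} \<le> W * t" unfolding split[of "\<lambda>z i. z + h i \<le> t"] e1 Un_empty_right using y'(2)[OF t(1,2) less_imp_le[OF tq]] by blast
    have e1: "{i \<in> B - V. q1 < t \<and> t < q1 + h i} = {}" using tq by force
    show "sum w {i \<in> A \<union> B - V. z i < t \<and> t < z i + h i} \<le> W" unfolding split[of "\<lambda>z i. z < t \<and> t < z + h i"] e1 Un_empty_right using y'(2)[OF t(1,2) less_imp_le[OF tq]] by blast
  qed (use short y'(1) q assms(10) dB in \<open>force simp: z_def\<close>)+
  then show ?thesis by blast
qed

lemma packable_combed: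
  assumes "packable w h W q A" "\<And>i. i \<in> A \<inter> V \<Longrightarrow> \<delta> < h i" "q \<le> 1" "0 \<le> \<delta>"
  shows "\<exists>D y. combed w h \<delta> V W q A D y"
  using assms(1-3)
proof (induction rule: packable.induct)
  case (empty W q)
  then show ?case using combed_empty by blast
next
  case (item i W q)
  show ?case
  proof (cases "i \<in> V")
    case True
    have "combed w h \<delta> V W q {i} {} (\<lambda>_. 0)"
      unfolding combed_def
    proof (intro conjI allI impI)
      fix t assume t: "0 \<le> t" "t \<le> \<delta>" "t \<le> q"
      have e: "{j \<in> {i} \<inter> V - {}. q - t \<le> h j} = (if q - t \<le> h i then {i} else {})"
        "{j \<in> {i} \<inter> V - {}. h j < q - t} \<union> {j \<in> {i} - V. t \<le> 0} = (if q - t \<le> h i then {} else {i})"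
        using True by auto
      have "packable w h (W - w i) (q - t) {}" using item t by (intro packable.empty) auto
      moreover have "packable w h W (q - t) {i}" if "\<not> q - t \<le> h i" using item that by (intro packable.item) auto
      ultimately show "packable w h (W - sum w {j \<in> {i} \<inter> V - {}. q - t \<le> h j}) (q - t)
         ({j \<in> {i} \<inter> V - {}. h j < q - t} \<union> {j \<in> {i} - V. t \<le> 0})"
        unfolding e by (cases "q - t \<le> h i") auto
    qed (use True item in \<open>auto simp: area_def\<close>)
    then show ?thesis by blast
  next
    case False
    then show ?thesis using combed_item_wide[of w i W h q V \<delta>] item.hyps by blast
  qed
next
  case (vcut W1 q A W2 B)
  then obtain D y E y' where "combed w h \<delta> V W1 q A D y" "combed w h \<delta> V W2 q B E y'" by auto
  from combed_vcut[OF vcut.hyps this] show ?case by blast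
next
  case (hcut W q1 A q2 B)
  note nn = packable_nonneg[OF hcut.hyps(1)] packable_nonneg[OF hcut.hyps(2)]
  have BA: "B \<inter> A = {}" using hcut.hyps(3) by auto
  consider "A \<inter> V = {}" | "B \<inter> V = {}" | "A \<inter> V \<noteq> {}" "B \<inter> V \<noteq> {}" by blast
  then show ?case
  proof cases
    case 1
    obtain D y where "combed w h \<delta> V W q2 B D y" using hcut.IH(2) hcut.prems nn by auto
    from combed_under_wide[OF hcut.hyps(1) 1 this hcut.hyps(2,3)] show ?thesis
      using combed_wide[OF hcut.hyps(1) 1] by blast
  next
    case 2
    obtain D y where "combed w h \<delta> V W q1 A D y" using hcut.IH(1) hcut.prems nn by auto
    from combed_under_wide[OF hcut.hyps(2) 2 this hcut.hyps(1) BA] show ?thesis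
      using combed_wide[OF hcut.hyps(2) 2] by (simp add: Un_commute add.commute) blast
  next
    case 3
    have V: "\<And>i. i \<in> A \<inter> V \<Longrightarrow> \<delta> < h i" "\<And>i. i \<in> B \<inter> V \<Longrightarrow> \<delta> < h i" using hcut.prems by auto
    show ?thesis
    proof (cases "card (A \<inter> V) \<le> card (B \<inter> V)")
      case True
      from combed_above_removed[OF hcut.hyps(1) V(1) hcut.hyps(2) V(2) hcut.hyps(3) hcut.prems(2) 3 True assms(4)]
      show ?thesis by blast
    next
      case False
      have "q2 + q1 \<le> 1" "card (B \<inter> V) \<le> card (A \<inter> V)" using hcut.prems False by auto
      from combed_above_removed[OF hcut.hyps(2) V(2) hcut.hyps(1) V(1) BA this(1) 3(2,1) this(2) assms(4)]
      show ?thesis by (simp add: Un_commute add.commute) blast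
    qed
  qed
qed

section \<open>From abstract packings to coordinates\<close>

definition proper :: "rect \<Rightarrow> bool" where
  "proper r \<longleftrightarrow> 0 < rect_width r \<and> 0 < rect_height r"

text \<open>Containment by coordinates. It stays meaningful for degenerate boxes, and for a proper
  \<open>r\<close> it agrees with the inclusion both of the closed rectangle and of its interior in
  the closed \<open>R\<close>.\<close>

definition fits :: "rect \<Rightarrow> rect \<Rightarrow> bool" where
  "fits r R \<longleftrightarrow> fst (fst R) \<le> fst (fst r) \<and> snd (fst R) \<le> snd (fst r) \<and>
     fst (snd r) \<le> fst (snd R) \<and> snd (snd r) \<le> snd (snd R)"

lemma rect_open_eq: "rect_open r = {fst (fst r)<..<fst (snd r)} \<times> {snd (fst r)<..<snd (snd r)}"
  by (cases r) (auto simp: rect_open_def mem_box Basis_prod_def)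

lemma rect_closed_eq: "rect_closed r = {fst (fst r)..fst (snd r)} \<times> {snd (fst r)..snd (snd r)}"
  by (cases r) (auto simp: rect_closed_def cbox_Pair_eq)

lemma fits_trans: "fits r R \<Longrightarrow> fits R R' \<Longrightarrow> fits r R'"
  by (auto simp: fits_def)

lemma closed_subset_iff: "proper r \<Longrightarrow> rect_closed r \<subseteq> rect_closed R \<longleftrightarrow> fits r R"
  by (auto simp: proper_def rect_width_def rect_height_def rect_closed_eq fits_def times_subset_iff)

lemma open_subset_closed_iff: "proper r \<Longrightarrow> rect_open r \<subseteq> rect_closed R \<longleftrightarrow> fits r R"
  by (auto simp: proper_def rect_width_def rect_height_def rect_open_eq rect_closed_eq fits_def
      times_subset_iff greaterThanLessThan_subseteq_atLeastAtMost_iff)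

lemma fits_open: "fits r R \<Longrightarrow> rect_open r \<subseteq> rect_open R"
  by (auto simp: rect_open_eq fits_def)

lemma proper_open_nonempty: "proper r \<Longrightarrow> rect_open r \<noteq> {}"
  by (auto simp: proper_def rect_width_def rect_height_def rect_open_eq times_eq_iff)

text \<open>Cuts in \<open>guillotine_separable\<close> lie strictly inside the rectangle, whereas
  an abstract packing may use boxes of width zero. If the cut is at the border, one side has no room
  for a proper rectangle and the cut can be omitted.\<close>

lemma guillotine_vcut:
  assumes "x1 \<le> c" "c \<le> x2" "\<And>r. r \<in> F \<Longrightarrow> proper r \<and> fits r ((x1, y1), (c, y2))"
    "\<And>r. r \<in> G \<Longrightarrow> proper r \<and> fits r ((c, y1), (x2, y2))"
    "guillotine_separable ((x1, y1), (c, y2)) F" "guillotine_separable ((c, y1), (x2, y2)) G"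
  shows "guillotine_separable ((x1, y1), (x2, y2)) (F \<union> G)"
proof -
  consider "c = x1" | "c = x2" | "x1 < c" "c < x2" using assms(1,2) by fastforce
  then show ?thesis
  proof cases
    case 1
    then have "F = {}" using assms(3) by (fastforce simp: proper_def rect_width_def fits_def)
    then show ?thesis using 1 assms by simp
  next
    case 2
    then have "G = {}" using assms(4) by (fastforce simp: proper_def rect_width_def fits_def)
    then show ?thesis using 2 assms by simp
  next
    case 3
    have F: "{r \<in> F \<union> G. rect_closed r \<subseteq> rect_closed ((x1, y1), (c, y2))} = F"
    proof -
      have "\<not> fits r ((x1, y1), (c, y2))" if "r \<in> G" for r
        using assms(4)[OF that] by (auto simp: proper_def rect_width_def fits_def)
      then show ?thesis using assms(3,4) closed_subset_iff by blast
    qed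
    have G: "{r \<in> F \<union> G. rect_closed r \<subseteq> rect_closed ((c, y1), (x2, y2))} = G"
    proof -
      have "\<not> fits r ((c, y1), (x2, y2))" if "r \<in> F" for r
        using assms(3)[OF that] by (auto simp: proper_def rect_width_def fits_def)
      then show ?thesis using assms(3,4) closed_subset_iff by blast
    qed
    have "rect_open r \<inter> ({c} \<times> {y1..y2}) = {}" if "r \<in> F \<union> G" for r
      using that assms(3)[of r] assms(4)[of r] by (auto simp: rect_open_eq fits_def)
    then show ?thesis using 3 F G assms(5,6)
      by (intro guillotine_separable.vertical_cut[OF 3]) auto
  qed
qed

lemma guillotine_hcut:
  assumes "y1 \<le> c" "c \<le> y2" "\<And>r. r \<in> F \<Longrightarrow> proper r \<and> fits r ((x1, y1), (x2, c))"
    "\<And>r. r \<in> G \<Longrightarrow> proper r \<and> fits r ((x1, c), (x2, y2))"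
    "guillotine_separable ((x1, y1), (x2, c)) F" "guillotine_separable ((x1, c), (x2, y2)) G"
  shows "guillotine_separable ((x1, y1), (x2, y2)) (F \<union> G)"
proof -
  consider "c = y1" | "c = y2" | "y1 < c" "c < y2" using assms(1,2) by fastforce
  then show ?thesis
  proof cases
    case 1
    then have "F = {}" using assms(3) by (fastforce simp: proper_def rect_height_def fits_def)
    then show ?thesis using 1 assms by simp
  next
    case 2
    then have "G = {}" using assms(4) by (fastforce simp: proper_def rect_height_def fits_def)
    then show ?thesis using 2 assms by simp
  next
    case 3
    have F: "{r \<in> F \<union> G. rect_closed r \<subseteq> rect_closed ((x1, y1), (x2, c))} = F"
    proof -
      have "\<not> fits r ((x1, y1), (x2, c))" if "r \<in> G" for r
        using assms(4)[OF that] by (auto simp: proper_def rect_height_def fits_def)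
      then show ?thesis using assms(3,4) closed_subset_iff by blast
    qed
    have G: "{r \<in> F \<union> G. rect_closed r \<subseteq> rect_closed ((x1, c), (x2, y2))} = G"
    proof -
      have "\<not> fits r ((x1, c), (x2, y2))" if "r \<in> F" for r
        using assms(3)[OF that] by (auto simp: proper_def rect_height_def fits_def)
      then show ?thesis using assms(3,4) closed_subset_iff by blast
    qed
    have "rect_open r \<inter> ({x1..x2} \<times> {c}) = {}" if "r \<in> F \<union> G" for r
      using that assms(3)[of r] assms(4)[of r] by (auto simp: rect_open_eq fits_def)
    then show ?thesis using 3 F G assms(5,6)
      by (intro guillotine_separable.horizontal_cut[OF 3]) auto
  qed
qed

section \<open>Placing items in boxes with a given lower left corner\<close>

definition rbox :: "real \<Rightarrow> real \<Rightarrow> real \<Rightarrow> real \<Rightarrow> rect" where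
  "rbox x y W H = ((x, y), (x + W, y + H))"

definition placed ::
  "(nat \<Rightarrow> nat) \<Rightarrow> (nat \<Rightarrow> nat) \<Rightarrow> (nat \<Rightarrow> real \<times> real) \<Rightarrow> nat set \<Rightarrow> rect \<Rightarrow> bool" where
  "placed w h pos A R \<longleftrightarrow> (\<forall>i\<in>A. proper (item_rect w h pos i) \<and> fits (item_rect w h pos i) R) \<and>
     disjoint_family_on (\<lambda>i. rect_open (item_rect w h pos i)) A \<and>
     guillotine_separable R (item_rect w h pos ` A)"

lemma proper_item: "proper (item_rect w h pos i) \<longleftrightarrow> 0 < w i \<and> 0 < h i"
  by (auto simp: proper_def rect_width_def rect_height_def item_rect_def)

lemma item_rect_cong: "pos i = pos' i \<Longrightarrow> item_rect w h pos i = item_rect w h pos' i"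
  by (simp add: item_rect_def)

lemma placed_cong:
  assumes "placed w h pos A R" "\<And>i. i \<in> A \<Longrightarrow> pos i = pos' i"
  shows "placed w h pos' A R"
proof -
  have *: "item_rect w h pos' i = item_rect w h pos i" if "i \<in> A" for i
    using assms(2)[OF that] by (simp add: item_rect_def)
  then have "item_rect w h pos' ` A = item_rect w h pos ` A" by (intro image_cong) auto
  then show ?thesis using assms(1) * unfolding placed_def disjoint_family_on_def by simp
qed

lemma placed_empty: "placed w h pos {} R"
  by (auto simp: placed_def disjoint_family_on_def intro: guillotine_separable.at_most_one)

lemma placed_item:
  assumes "0 < w i" "0 < h i" "fits (item_rect w h pos i) R"
  shows "placed w h pos {i} R"
  using assms by (auto simp: placed_def disjoint_family_on_def proper_item intro: guillotine_separable.at_most_one)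

lemma disjoint_family_on_Un:
  assumes "disjoint_family_on f A" "disjoint_family_on f B" "\<And>a b. a \<in> A \<Longrightarrow> b \<in> B \<Longrightarrow> f a \<inter> f b = {}"
  shows "disjoint_family_on f (A \<union> B)"
  unfolding disjoint_family_on_def
proof (intro ballI impI)
  fix a b assume "a \<in> A \<union> B" "b \<in> A \<union> B" "a \<noteq> b"
  then show "f a \<inter> f b = {}"
    using disjoint_family_onD[OF assms(1), of a b] disjoint_family_onD[OF assms(2), of a b]
      assms(3)[of a b] assms(3)[of b a] by (auto simp: Int_commute)
qed

lemma placed_Un_disjoint:
  assumes "placed w h pos A R" "placed w h pos B S" "rect_open R \<inter> rect_open S = {}"
  shows "disjoint_family_on (\<lambda>i. rect_open (item_rect w h pos i)) (A \<union> B)"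
proof -
  have "rect_open (item_rect w h pos i) \<subseteq> rect_open R" if "i \<in> A" for i
    using assms(1) that by (auto simp: placed_def intro!: fits_open)
  moreover have "rect_open (item_rect w h pos i) \<subseteq> rect_open S" if "i \<in> B" for i
    using assms(2) that by (auto simp: placed_def intro!: fits_open)
  ultimately have "rect_open (item_rect w h pos i) \<inter> rect_open (item_rect w h pos j) = {}" if "i \<in> A" "j \<in> B" for i j
    using that assms(3) by blast
  then show ?thesis using assms(1,2) by (intro disjoint_family_on_Un) (auto simp: placed_def)
qed

lemma placed_vcut:
  assumes "placed w h pos A (rbox x y W1 H)" "placed w h pos B (rbox (x + W1) y W2 H)" "0 \<le> W1" "0 \<le> W2"
  shows "placed w h pos (A \<union> B) (rbox x y (W1 + W2) H)"
proof -
  have "guillotine_separable ((x, y), (x + W1 + W2, y + H)) (item_rect w h pos ` A \<union> item_rect w h pos ` B)"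
    using assms by (intro guillotine_vcut[of _ "x + W1"]) (auto simp: placed_def rbox_def)
  moreover have "disjoint_family_on (\<lambda>i. rect_open (item_rect w h pos i)) (A \<union> B)"
    using assms by (intro placed_Un_disjoint) (auto simp: rect_open_eq rbox_def)
  moreover have "fits (item_rect w h pos i) (rbox x y (W1 + W2) H)" if "i \<in> A \<union> B" for i
    using that assms by (force simp: placed_def rbox_def fits_def)
  ultimately show ?thesis using assms(1,2) by (auto simp: placed_def rbox_def image_Un add.assoc)
qed

lemma placed_hcut:
  assumes "placed w h pos A (rbox x y W H1)" "placed w h pos B (rbox x (y + H1) W H2)" "0 \<le> H1" "0 \<le> H2"
  shows "placed w h pos (A \<union> B) (rbox x y W (H1 + H2))"
proof -
  have "guillotine_separable ((x, y), (x + W, y + H1 + H2)) (item_rect w h pos ` A \<union> item_rect w h pos ` B)"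
    using assms by (intro guillotine_hcut[of _ "y + H1"]) (auto simp: placed_def rbox_def)
  moreover have "disjoint_family_on (\<lambda>i. rect_open (item_rect w h pos i)) (A \<union> B)"
    using assms by (intro placed_Un_disjoint) (auto simp: rect_open_eq rbox_def)
  moreover have "fits (item_rect w h pos i) (rbox x y W (H1 + H2))" if "i \<in> A \<union> B" for i
    using that assms by (force simp: placed_def rbox_def fits_def)
  ultimately show ?thesis using assms(1,2) by (auto simp: placed_def rbox_def image_Un add.assoc)
qed

definition merge :: "nat set \<Rightarrow> (nat \<Rightarrow> 'a) \<Rightarrow> (nat \<Rightarrow> 'a) \<Rightarrow> nat \<Rightarrow> 'a" where
  "merge A f g i = (if i \<in> A then f i else g i)"

lemma placed_merge:
  assumes "placed w h p A R" "placed w h q B S" "A \<inter> B = {}"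
  shows "placed w h (merge A p q) A R" "placed w h (merge A p q) B S"
  using assms by (auto intro!: placed_cong[OF assms(1)] placed_cong[OF assms(2)] simp: merge_def)

lemma packable_placed:
  assumes "packable (\<lambda>i. real (w i)) (\<lambda>i. real (h i)) W H A"
  shows "\<exists>pos. placed w h pos A (rbox x y W H)"
  using assms
proof (induction arbitrary: x y rule: packable.induct)
  case (item i W H)
  then show ?case
    by (intro exI[of _ "\<lambda>_. (x, y)"] placed_item) (auto simp: fits_def item_rect_def rbox_def)
next
  case (vcut W1 H A W2 B)
  obtain p where p: "placed w h p A (rbox x y W1 H)" using vcut.IH(1) by blast
  obtain q where q: "placed w h q B (rbox (x + W1) y W2 H)" using vcut.IH(2) by blast
  show ?case using placed_merge[OF p q vcut.hyps(3)] packable_nonneg[OF vcut.hyps(1)] packable_nonneg[OF vcut.hyps(2)]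
    by (intro exI[of _ "merge A p q"] placed_vcut) auto
next
  case (hcut W H1 A H2 B)
  obtain p where p: "placed w h p A (rbox x y W H1)" using hcut.IH(1) by blast
  obtain q where q: "placed w h q B (rbox x (y + H1) W H2)" using hcut.IH(2) by blast
  show ?case using placed_merge[OF p q hcut.hyps(3)] packable_nonneg[OF hcut.hyps(1)] packable_nonneg[OF hcut.hyps(2)]
    by (intro exI[of _ "merge A p q"] placed_hcut) auto
qed (auto intro: placed_empty)

lemma stack_placed:
  assumes "finite A" "\<And>i. i \<in> A \<Longrightarrow> 0 < w i \<and> 0 < h i \<and> real (w i) \<le> W" "(\<Sum>i\<in>A. real (h i)) \<le> H"
  shows "\<exists>pos. placed w h pos A (rbox x y W H) \<and>
    disjoint_family_on (\<lambda>i. {snd (pos i)<..<snd (pos i) + real (h i)}) A"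
  using assms
proof (induction arbitrary: y H rule: finite_induct)
  case empty
  then show ?case by (auto intro: placed_empty simp: disjoint_family_on_def)
next
  case (insert i A)
  have "(\<Sum>j\<in>A. real (h j)) \<le> H - h i" using insert by simp
  then obtain q where q: "placed w h q A (rbox x (y + h i) W (H - h i))"
    "disjoint_family_on (\<lambda>i. {snd (q i)<..<snd (q i) + real (h i)}) A"
    using insert.IH[of "H - h i" "y + h i"] insert.prems by auto
  have p: "placed w h (\<lambda>_. (x, y)) {i} (rbox x y W (h i))"
    using insert.prems by (intro placed_item) (auto simp: fits_def item_rect_def rbox_def)
  define r where "r = merge {i} (\<lambda>_. (x, y)) q"
  have "{i} \<inter> A = {}" using insert.hyps by simp
  note m = placed_merge[OF p q(1) this, folded r_def]
  have "0 \<le> (\<Sum>j\<in>A. real (h j))" by (intro sum_nonneg) auto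
  then have "0 \<le> H - h i" using insert.prems insert.hyps by simp
  then have "placed w h r ({i} \<union> A) (rbox x y W (real (h i) + (H - h i)))"
    by (intro placed_hcut[OF m]) auto
  moreover have "disjoint_family_on (\<lambda>i. {snd (r i)<..<snd (r i) + real (h i)}) (insert i A)"
  proof -
    have "y + h i \<le> snd (r j)" if "j \<in> A" for j
      using m(2) that by (auto simp: placed_def fits_def rbox_def item_rect_def)
    moreover have "r i = (x, y)" "\<And>j. j \<in> A \<Longrightarrow> r j = q j" using insert.hyps by (auto simp: r_def merge_def)
    ultimately show ?thesis using q(2) unfolding disjoint_family_on_def by fastforce
  qed
  ultimately show ?case by (intro exI[of _ r]) simp
qed

lemma row_placed:
  assumes "finite A" "\<And>i. i \<in> A \<Longrightarrow> 0 < w i \<and> 0 < h i \<and> real (h i) \<le> H" "(\<Sum>i\<in>A. real (w i)) \<le> W"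
  shows "\<exists>pos. placed w h pos A (rbox x y W H) \<and>
    disjoint_family_on (\<lambda>i. {fst (pos i)<..<fst (pos i) + real (w i)}) A"
  using assms
proof (induction arbitrary: x W rule: finite_induct)
  case empty
  then show ?case by (auto intro: placed_empty simp: disjoint_family_on_def)
next
  case (insert i A)
  have "(\<Sum>j\<in>A. real (w j)) \<le> W - w i" using insert by simp
  then obtain q where q: "placed w h q A (rbox (x + w i) y (W - w i) H)"
    "disjoint_family_on (\<lambda>i. {fst (q i)<..<fst (q i) + real (w i)}) A"
    using insert.IH[of "W - w i" "x + w i"] insert.prems by auto
  have p: "placed w h (\<lambda>_. (x, y)) {i} (rbox x y (w i) H)"
    using insert.prems by (intro placed_item) (auto simp: fits_def item_rect_def rbox_def)
  define r where "r = merge {i} (\<lambda>_. (x, y)) q"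
  have "{i} \<inter> A = {}" using insert.hyps by simp
  note m = placed_merge[OF p q(1) this, folded r_def]
  have "0 \<le> (\<Sum>j\<in>A. real (w j))" by (intro sum_nonneg) auto
  then have "0 \<le> W - w i" using insert.prems insert.hyps by simp
  then have "placed w h r ({i} \<union> A) (rbox x y (real (w i) + (W - w i)) H)"
    by (intro placed_vcut[OF m]) auto
  moreover have "disjoint_family_on (\<lambda>i. {fst (r i)<..<fst (r i) + real (w i)}) (insert i A)"
  proof -
    have "x + w i \<le> fst (r j)" if "j \<in> A" for j
      using m(2) that by (auto simp: placed_def fits_def rbox_def item_rect_def)
    moreover have "r i = (x, y)" "\<And>j. j \<in> A \<Longrightarrow> r j = q j" using insert.hyps by (auto simp: r_def merge_def)
    ultimately show ?thesis using q(2) unfolding disjoint_family_on_def by fastforce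
  qed
  ultimately show ?case by (intro exI[of _ r]) simp
qed

text \<open>\<open>c i\<close> is the container of item \<open>i\<close>.\<close>

definition contained ::
  "real \<Rightarrow> (nat \<Rightarrow> nat) \<Rightarrow> (nat \<Rightarrow> nat) \<Rightarrow> nat \<Rightarrow> (nat \<Rightarrow> real \<times> real) \<Rightarrow> container set \<Rightarrow>
   (nat \<Rightarrow> container) \<Rightarrow> nat set \<Rightarrow> rect \<Rightarrow> bool" where
  "contained \<epsilon> w h k pos Cs c A R \<longleftrightarrow> placed w h pos A R \<and> finite Cs \<and> card Cs \<le> k \<and>
     (\<forall>C\<in>Cs. proper (snd C) \<and> fits (snd C) R) \<and>
     disjoint_family_on (\<lambda>C. rect_open (snd C)) Cs \<and> guillotine_separable R (snd ` Cs) \<and>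
     (\<forall>i\<in>A. c i \<in> Cs) \<and>
     (\<forall>C\<in>Cs. respects_label \<epsilon> w h pos C {i \<in> A. c i = C} \<and> placed w h pos {i \<in> A. c i = C} (snd C))"

lemma respects_label_cong:
  assumes "respects_label \<epsilon> w h pos C T" "\<And>i. i \<in> T \<Longrightarrow> pos i = pos' i"
  shows "respects_label \<epsilon> w h pos' C T"
proof -
  obtain l r where "C = (l, r)" by (cases C)
  then show ?thesis using assms by (cases l) (auto simp: disjoint_family_on_def)
qed

lemma contained_cong:
  assumes "contained \<epsilon> w h k pos Cs c A R" "\<And>i. i \<in> A \<Longrightarrow> pos i = pos' i"
  shows "contained \<epsilon> w h k pos' Cs c A R"
  using assms unfolding contained_def
  by (auto intro: placed_cong[where pos = pos] respects_label_cong[where pos = pos])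

lemma contained_empty: "contained \<epsilon> w h k pos {} c {} R"
  by (auto simp: contained_def disjoint_family_on_def placed_empty intro: guillotine_separable.at_most_one)

lemma contained_single:
  assumes "placed w h pos A R" "proper R" "1 \<le> k" "respects_label \<epsilon> w h pos (l, R) A"
  shows "contained \<epsilon> w h k pos {(l, R)} (\<lambda>_. (l, R)) A R"
  using assms by (auto simp: contained_def disjoint_family_on_def fits_def intro: guillotine_separable.at_most_one)

text \<open>Containers are proper and lie in boxes with disjoint interiors, hence no container
  belongs to both sides. Therefore \<open>merge A c d\<close> assigns to every container exactly the
  items it had before.\<close>

lemma contained_Un:
  assumes 1: "contained \<epsilon> w h k1 p Cs c A R1" and 2: "contained \<epsilon> w h k2 q Ds d B R2"
    and "A \<inter> B = {}" "rect_open R1 \<inter> rect_open R2 = {}" "fits R1 R" "fits R2 R"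
    and "placed w h (merge A p q) (A \<union> B) R" "guillotine_separable R (snd ` Cs \<union> snd ` Ds)"
  shows "contained \<epsilon> w h (k1 + k2) (merge A p q) (Cs \<union> Ds) (merge A c d) (A \<union> B) R"
proof -
  have cA: "contained \<epsilon> w h k1 (merge A p q) Cs c A R1" using 1 by (rule contained_cong) (auto simp: merge_def)
  have cB: "contained \<epsilon> w h k2 (merge A p q) Ds d B R2"
    using 2 by (rule contained_cong) (use assms(3) in \<open>auto simp: merge_def\<close>)
  have oC: "rect_open (snd C) \<subseteq> rect_open R1" "rect_open (snd C) \<noteq> {}" if "C \<in> Cs" for C
    using 1 that by (auto simp: contained_def intro!: fits_open dest: proper_open_nonempty)
  have oD: "rect_open (snd C) \<subseteq> rect_open R2" "rect_open (snd C) \<noteq> {}" if "C \<in> Ds" for C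
    using 2 that by (auto simp: contained_def intro!: fits_open dest: proper_open_nonempty)
  have dA: "\<And>i. i \<in> A \<Longrightarrow> c i \<in> Cs" and dB: "\<And>i. i \<in> B \<Longrightarrow> d i \<in> Ds"
    using 1 2 by (auto simp: contained_def)
  have CD: "Cs \<inter> Ds = {}" using oC oD assms(4) by blast
  have dn: "d i \<noteq> C" if "i \<in> B" "C \<in> Cs" for i C using dB[OF that(1)] CD that(2) by blast
  have cn: "c i \<noteq> C" if "i \<in> A" "C \<in> Ds" for i C using dA[OF that(1)] CD that(2) by blast
  have "disjoint_family_on (\<lambda>C. rect_open (snd C)) (Cs \<union> Ds)"
  proof -
    have "rect_open (snd C) \<inter> rect_open (snd D) = {}" if "C \<in> Cs" "D \<in> Ds" for C D
      using oC[OF that(1)] oD[OF that(2)] assms(4) by blast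
    then show ?thesis using 1 2 by (intro disjoint_family_on_Un) (auto simp: contained_def)
  qed
  moreover have "card (Cs \<union> Ds) \<le> k1 + k2"
    using 1 2 card_Un_le[of Cs Ds] unfolding contained_def by linarith
  moreover have "merge A c d i \<in> Cs \<union> Ds" if "i \<in> A \<union> B" for i
    using that 1 2 by (auto simp: contained_def merge_def)
  moreover have "{i \<in> A \<union> B. merge A c d i = C} = {i \<in> A. c i = C}" if "C \<in> Cs" for C
    using dn[OF _ that] by (auto simp: merge_def)
  moreover have "{i \<in> A \<union> B. merge A c d i = C} = {i \<in> B. d i = C}" if "C \<in> Ds" for C
    using cn[OF _ that] assms(3) by (auto simp: merge_def)
  ultimately show ?thesis
    using cA cB assms(5-8) unfolding contained_def by (auto simp: image_Un intro: fits_trans)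
qed

lemma contained_vcut:
  assumes 1: "contained \<epsilon> w h k1 p Cs c A (rbox x y W1 H)" and 2: "contained \<epsilon> w h k2 q Ds d B (rbox (x + W1) y W2 H)"
    and "A \<inter> B = {}" "0 \<le> W1" "0 \<le> W2"
  shows "contained \<epsilon> w h (k1 + k2) (merge A p q) (Cs \<union> Ds) (merge A c d) (A \<union> B) (rbox x y (W1 + W2) H)"
proof (rule contained_Un[OF 1 2 assms(3)])
  have "placed w h p A (rbox x y W1 H)" "placed w h q B (rbox (x + W1) y W2 H)"
    using 1 2 by (auto simp: contained_def)
  from placed_merge[OF this assms(3)] show "placed w h (merge A p q) (A \<union> B) (rbox x y (W1 + W2) H)"
    using assms(4,5) by (intro placed_vcut)
  have "guillotine_separable ((x, y), (x + W1 + W2, y + H)) (snd ` Cs \<union> snd ` Ds)"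
    using 1 2 assms(4,5) by (intro guillotine_vcut[of _ "x + W1"]) (auto simp: contained_def rbox_def)
  then show "guillotine_separable (rbox x y (W1 + W2) H) (snd ` Cs \<union> snd ` Ds)"
    by (simp add: rbox_def add.assoc)
qed (use assms(4,5) in \<open>auto simp: rect_open_eq rbox_def fits_def\<close>)

lemma contained_hcut:
  assumes 1: "contained \<epsilon> w h k1 p Cs c A (rbox x y W H1)" and 2: "contained \<epsilon> w h k2 q Ds d B (rbox x (y + H1) W H2)"
    and "A \<inter> B = {}" "0 \<le> H1" "0 \<le> H2"
  shows "contained \<epsilon> w h (k1 + k2) (merge A p q) (Cs \<union> Ds) (merge A c d) (A \<union> B) (rbox x y W (H1 + H2))"
proof (rule contained_Un[OF 1 2 assms(3)])
  have "placed w h p A (rbox x y W H1)" "placed w h q B (rbox x (y + H1) W H2)"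
    using 1 2 by (auto simp: contained_def)
  from placed_merge[OF this assms(3)] show "placed w h (merge A p q) (A \<union> B) (rbox x y W (H1 + H2))"
    using assms(4,5) by (intro placed_hcut)
  have "guillotine_separable ((x, y), (x + W, y + H1 + H2)) (snd ` Cs \<union> snd ` Ds)"
    using 1 2 assms(4,5) by (intro guillotine_hcut[of _ "y + H1"]) (auto simp: contained_def rbox_def)
  then show "guillotine_separable (rbox x y W (H1 + H2)) (snd ` Cs \<union> snd ` Ds)"
    by (simp add: rbox_def add.assoc)
qed (use assms(4,5) in \<open>auto simp: rect_open_eq rbox_def fits_def\<close>)

lemma container_packable_nonneg: "container_packable \<epsilon> w h k W H A \<Longrightarrow> 0 \<le> W \<and> 0 \<le> H"
proof (induction rule: container_packable.induct)
  case (hcont k A W H)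
  then have "0 \<le> sum h A" by (intro sum_nonneg) force
  then show ?case using hcont by auto
next
  case (vcont k A H W)
  then have "0 \<le> sum w A" by (intro sum_nonneg) force
  then show ?case using vcont by auto
qed (auto dest: packable_nonneg)

lemma container_packable_contained:
  assumes "container_packable \<epsilon> (\<lambda>i. real (w i)) (\<lambda>i. real (h i)) k W H A"
  shows "\<exists>pos Cs c. contained \<epsilon> w h k pos Cs c A (rbox x y W H)"
  using assms
proof (induction arbitrary: x y rule: container_packable.induct)
  case (empty W H k)
  then show ?case using contained_empty by blast
next
  case (hcont k A W H)
  show ?case
  \<comment> \<open>Without items the box may be degenerate, while containers must have positive
    width and height; so no container is created.\<close>
  proof (cases "A = {}")
    case True
    then show ?thesis using contained_empty by blast
  next
    case False
    then obtain i where i: "i \<in> A" by auto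
    have "real (h i) \<le> (\<Sum>i\<in>A. real (h i))" using i hcont.hyps(2) by (intro member_le_sum) auto
    then have "proper (rbox x y W H)" using hcont.hyps(4)[OF i] hcont.hyps(5)
      by (auto simp: proper_def rbox_def rect_width_def rect_height_def)
    moreover obtain pos where "placed w h pos A (rbox x y W H)"
      "disjoint_family_on (\<lambda>i. {snd (pos i)<..<snd (pos i) + real (h i)}) A"
      using stack_placed[of A w h W H x y] hcont by auto
    ultimately show ?thesis
      using contained_single[of w h pos A "rbox x y W H" k \<epsilon> Horizontal] hcont.hyps(1) by auto
  qed
next
  case (vcont k A H W)
  show ?case
  proof (cases "A = {}")
    case True
    then show ?thesis using contained_empty by blast
  next
    case False
    then obtain i where i: "i \<in> A" by auto
    have "real (w i) \<le> (\<Sum>i\<in>A. real (w i))" using i vcont.hyps(2) by (intro member_le_sum) auto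
    then have "proper (rbox x y W H)" using vcont.hyps(4)[OF i] vcont.hyps(5)
      by (auto simp: proper_def rbox_def rect_width_def rect_height_def)
    moreover obtain pos where "placed w h pos A (rbox x y W H)"
      "disjoint_family_on (\<lambda>i. {fst (pos i)<..<fst (pos i) + real (w i)}) A"
      using row_placed[of A w h H W x y] vcont by auto
    ultimately show ?thesis
      using contained_single[of w h pos A "rbox x y W H" k \<epsilon> Vertical] vcont.hyps(1) by auto
  qed
next
  case (acont k W H A)
  show ?case
  proof (cases "A = {}")
    case True
    then show ?thesis using contained_empty by blast
  next
    case False
    then obtain i where i: "i \<in> A" by auto
    have "proper (rbox x y W H)" using packable_dims[OF acont.hyps(2) i]
      by (auto simp: proper_def rbox_def rect_width_def rect_height_def)
    moreover obtain pos where "placed w h pos A (rbox x y W H)" using packable_placed[OF acont.hyps(2)] by blast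
    moreover have "respects_label \<epsilon> w h pos (Area, rbox x y W H) A"
      using acont.hyps(3) by (auto simp: rbox_def rect_width_def rect_height_def)
    ultimately show ?thesis
      using contained_single[of w h pos A "rbox x y W H" k \<epsilon> Area] acont.hyps(1) by auto
  qed
next
  case (vcut k1 W1 H A k2 W2 B)
  obtain p Cs c where 1: "contained \<epsilon> w h k1 p Cs c A (rbox x y W1 H)" using vcut.IH(1) by blast
  obtain q Ds d where 2: "contained \<epsilon> w h k2 q Ds d B (rbox (x + W1) y W2 H)" using vcut.IH(2) by blast
  show ?case
    using contained_vcut[OF 1 2 vcut.hyps(3)] container_packable_nonneg[OF vcut.hyps(1)] container_packable_nonneg[OF vcut.hyps(2)] by blast
next
  case (hcut k1 W H1 A k2 H2 B)
  obtain p Cs c where 1: "contained \<epsilon> w h k1 p Cs c A (rbox x y W H1)" using hcut.IH(1) by blast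
  obtain q Ds d where 2: "contained \<epsilon> w h k2 q Ds d B (rbox x (y + H1) W H2)" using hcut.IH(2) by blast
  show ?case
    using contained_hcut[OF 1 2 hcut.hyps(3)] container_packable_nonneg[OF hcut.hyps(1)] container_packable_nonneg[OF hcut.hyps(2)] by blast
qed

section \<open>The boundary L\<close>

text \<open>Long items are placed one by one below or to the left of an inner box of size \<open>Wi \<times> Hi\<close>.\<close>

inductive nest :: "(nat \<Rightarrow> real) \<Rightarrow> (nat \<Rightarrow> real) \<Rightarrow> real \<Rightarrow> real \<Rightarrow> real \<Rightarrow> real \<Rightarrow> nat set \<Rightarrow> bool"
  for w h :: "nat \<Rightarrow> real" where
  inner: "0 \<le> W \<Longrightarrow> 0 \<le> H \<Longrightarrow> nest w h W H W H {}"
| bottom: "nest w h Wi Hi W H L \<Longrightarrow> i \<notin> L \<Longrightarrow> 0 < w i \<Longrightarrow> w i \<le> W \<Longrightarrow> 0 < h i \<Longrightarrow>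
    nest w h Wi Hi W (h i + H) (insert i L)"
| left: "nest w h Wi Hi W H L \<Longrightarrow> i \<notin> L \<Longrightarrow> 0 < w i \<Longrightarrow> h i \<le> H \<Longrightarrow> 0 < h i \<Longrightarrow>
    nest w h Wi Hi (w i + W) H (insert i L)"

lemma nest_facts: "nest w h Wi Hi W H L \<Longrightarrow> 0 \<le> Wi \<and> 0 \<le> Hi \<and> Wi \<le> W \<and> Hi \<le> H \<and> finite L"
  by (induction rule: nest.induct) auto

lemma nest_swap: "nest w h Wi Hi W H L \<Longrightarrow> nest h w Hi Wi H W L"
  by (induction rule: nest.induct) (auto intro: nest.intros)

lemma nest_scale:
  assumes "nest w h Wi Hi W H L" "0 < c"
  shows "nest (\<lambda>i. c * w i) (\<lambda>i. c * h i) (c * Wi) (c * Hi) (c * W) (c * H) L"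
  using assms(1)
proof (induction rule: nest.induct)
  case (bottom Wi Hi W H L i)
  then show ?case using assms(2) unfolding distrib_left by (intro nest.bottom) auto
next
  case (left Wi Hi W H L i)
  then show ?case using assms(2) unfolding distrib_left by (intro nest.left) auto
qed (use assms(2) in \<open>auto intro: nest.inner\<close>)

lemma nest_widen: "nest w h Wi Hi W H L \<Longrightarrow> 0 \<le> d \<Longrightarrow> nest w h (Wi + d) Hi (W + d) H L"
proof (induction rule: nest.induct)
  case (left Wi Hi W H L i)
  then show ?case unfolding add.assoc by (intro nest.left) auto
qed (auto intro: nest.intros)

lemma nest_left_row:
  assumes "finite A" "nest w h Wi Hi W H L" "A \<inter> L = {}" "\<And>i. i \<in> A \<Longrightarrow> 0 < w i \<and> 0 < h i \<and> h i \<le> H"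
  shows "nest w h Wi Hi (sum w A + W) H (A \<union> L)"
  using assms
proof (induction rule: finite_induct)
  case (insert i A)
  have "nest w h Wi Hi (w i + (sum w A + W)) H (insert i (A \<union> L))"
    using insert by (intro nest.left) auto
  then show ?case using insert by (simp add: add.assoc)
qed simp

text \<open>Two items higher than \<open>1 / 2\<close> do not fit above each other in height at most
  \<open>1\<close>, so every horizontal cut has an empty side and only vertical cuts remain.\<close>

lemma packable_tall_row:
  assumes "packable w h W H A" "H \<le> 1" "\<And>i. i \<in> A \<Longrightarrow> 1 / 2 < h i"
  shows "sum w A \<le> W"
  using assms
proof (induction rule: packable.induct)
  case (vcut W1 H A W2 B)
  then show ?case using packable_finite[OF vcut.hyps(1)] packable_finite[OF vcut.hyps(2)]
    by (subst sum.union_disjoint) auto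
next
  case (hcut W H1 A H2 B)
  have "A = {} \<or> B = {}"
  proof (rule ccontr)
    assume "\<not> ?thesis"
    then obtain a b where ab: "a \<in> A" "b \<in> B" by auto
    then have "1 / 2 < h a" "1 / 2 < h b" using hcut.prems(2) by auto
    then show False using packable_dims[OF hcut.hyps(1) ab(1)] packable_dims[OF hcut.hyps(2) ab(2)] hcut.prems(1) by linarith
  qed
  then show ?case using hcut packable_nonneg[OF hcut.hyps(1)] packable_nonneg[OF hcut.hyps(2)] by auto
qed auto

text \<open>The tall items form a row to the left of the nest. The width \<open>W1 - sum w A\<close>
  that they leave free is passed on through the nest to the inner box.\<close>

lemma nest_beside:
  assumes "packable w h W1 H A" "H \<le> 1" "\<And>i. i \<in> A \<Longrightarrow> 1 / 2 < h i" "nest w h Wi Hi W2 H B" "A \<inter> B = {}"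
  shows "nest w h (Wi + W1 - sum w A) Hi (W1 + W2) H (A \<union> B)"
proof -
  have s: "sum w A \<le> W1" using packable_tall_row[OF assms(1-3)] .
  have "nest w h (Wi + (W1 - sum w A)) Hi (W2 + (W1 - sum w A)) H B"
    using assms(4) s by (intro nest_widen) auto
  then have "nest w h (Wi + (W1 - sum w A)) Hi (sum w A + (W2 + (W1 - sum w A))) H (A \<union> B)"
    using packable_finite[OF assms(1)] packable_dims[OF assms(1)] assms(5) by (intro nest_left_row) auto
  then show ?thesis by (simp add: algebra_simps)
qed

text \<open>Two items wider than \<open>1 / 2\<close> do not fit side by side, so one side of a
  vertical cut contains tall items only and can be moved to the left of the other side. Horizontal
  cuts are treated by transposition. Since free space is always passed to the inner box, this box
  only loses the total width of the tall and the total height of the wide items.\<close>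

lemma packable_nest:
  assumes "packable w h W H A" "W \<le> 1" "H \<le> 1" "\<And>i. i \<in> A \<inter> V \<Longrightarrow> 1 / 2 < h i" "\<And>i. i \<in> A - V \<Longrightarrow> 1 / 2 < w i"
  shows "nest w h (W - sum w (A \<inter> V)) (H - sum h (A - V)) W H A"
  using assms
proof (induction rule: packable.induct)
  case (empty W H)
  then show ?case by (auto intro: nest.inner)
next
  case (item i W H)
  show ?case
  proof (cases "i \<in> V")
    case True
    have "nest w h (W - w i) H (w i + (W - w i)) H (insert i {})"
      using item by (intro nest.left nest.inner) auto
    then show ?thesis using True by simp
  next
    case False
    have "nest w h W (H - h i) W (h i + (H - h i)) (insert i {})"
      using item by (intro nest.bottom nest.inner) auto
    moreover have "{i} - V = {i}" "{i} \<inter> V = {}" using False by auto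
    ultimately show ?thesis by simp
  qed
next
  case (vcut W1 H A W2 B)
  note nn = packable_nonneg[OF vcut.hyps(1)] packable_nonneg[OF vcut.hyps(2)]
  note fin = packable_finite[OF vcut.hyps(1)] packable_finite[OF vcut.hyps(2)]
  have 1: "nest w h (W1 - sum w (A \<inter> V)) (H - sum h (A - V)) W1 H A"
    using vcut.IH(1) vcut.prems nn by auto
  have 2: "nest w h (W2 - sum w (B \<inter> V)) (H - sum h (B - V)) W2 H B"
    using vcut.IH(2) vcut.prems nn by auto
  have "(A \<union> B) \<inter> V = A \<inter> V \<union> B \<inter> V" "(A \<union> B) - V = (A - V) \<union> (B - V)" by auto
  then have sums: "sum w ((A \<union> B) \<inter> V) = sum w (A \<inter> V) + sum w (B \<inter> V)"
    "sum h ((A \<union> B) - V) = sum h (A - V) + sum h (B - V)"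
    using fin vcut.hyps(3) by (auto intro!: sum.union_disjoint)
  have "A - V = {} \<or> B - V = {}"
  proof (rule ccontr)
    assume "\<not> ?thesis"
    then obtain a b where ab: "a \<in> A - V" "b \<in> B - V" by blast
    then have "1 / 2 < w a" "1 / 2 < w b" using vcut.prems(4) by auto
    then show False using packable_dims[OF vcut.hyps(1), of a] packable_dims[OF vcut.hyps(2), of b] ab vcut.prems(1) by auto
  qed
  then show ?case
  proof
    assume e: "A - V = {}"
    then have AV: "A \<inter> V = A" by auto
    have "nest w h ((W2 - sum w (B \<inter> V)) + W1 - sum w A) (H - sum h (B - V)) (W1 + W2) H (A \<union> B)"
      using vcut.hyps(3) vcut.prems(2,3) AV by (intro nest_beside[OF vcut.hyps(1) _ _ 2]) auto
    then show ?thesis unfolding sums e AV by (simp add: algebra_simps)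
  next
    assume e: "B - V = {}"
    then have BV: "B \<inter> V = B" by auto
    have "nest w h ((W1 - sum w (A \<inter> V)) + W2 - sum w B) (H - sum h (A - V)) (W2 + W1) H (B \<union> A)"
      using vcut.hyps(3) vcut.prems(2,3) BV by (intro nest_beside[OF vcut.hyps(2) _ _ 1]) auto
    then show ?thesis unfolding sums e BV by (simp add: algebra_simps Un_commute)
  qed
next
  case (hcut W H1 A H2 B)
  note nn = packable_nonneg[OF hcut.hyps(1)] packable_nonneg[OF hcut.hyps(2)]
  note fin = packable_finite[OF hcut.hyps(1)] packable_finite[OF hcut.hyps(2)]
  have "nest w h (W - sum w (A \<inter> V)) (H1 - sum h (A - V)) W H1 A"
    using hcut.IH(1) hcut.prems nn by auto
  then have 1: "nest h w (H1 - sum h (A - V)) (W - sum w (A \<inter> V)) H1 W A" by (rule nest_swap)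
  have "nest w h (W - sum w (B \<inter> V)) (H2 - sum h (B - V)) W H2 B"
    using hcut.IH(2) hcut.prems nn by auto
  then have 2: "nest h w (H2 - sum h (B - V)) (W - sum w (B \<inter> V)) H2 W B" by (rule nest_swap)
  have "(A \<union> B) \<inter> V = A \<inter> V \<union> B \<inter> V" "(A \<union> B) - V = (A - V) \<union> (B - V)" by auto
  then have sums: "sum w ((A \<union> B) \<inter> V) = sum w (A \<inter> V) + sum w (B \<inter> V)"
    "sum h ((A \<union> B) - V) = sum h (A - V) + sum h (B - V)"
    using fin hcut.hyps(3) by (auto intro!: sum.union_disjoint)
  have "A \<inter> V = {} \<or> B \<inter> V = {}"
  proof (rule ccontr)
    assume "\<not> ?thesis"
    then obtain a b where ab: "a \<in> A \<inter> V" "b \<in> B \<inter> V" by blast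
    then have "1 / 2 < h a" "1 / 2 < h b" using hcut.prems(3) by auto
    then show False using packable_dims[OF hcut.hyps(1), of a] packable_dims[OF hcut.hyps(2), of b] ab hcut.prems(2) by auto
  qed
  then show ?case
  proof
    assume e: "A \<inter> V = {}"
    then have AV: "A - V = A" by auto
    have "nest h w ((H2 - sum h (B - V)) + H1 - sum h A) (W - sum w (B \<inter> V)) (H1 + H2) W (A \<union> B)"
      using hcut.hyps(3) hcut.prems(1,4) AV by (intro nest_beside[OF packable_swap[OF hcut.hyps(1)] _ _ 2]) auto
    then show ?thesis unfolding sums e AV by - (rule nest_swap, simp add: algebra_simps)
  next
    assume e: "B \<inter> V = {}"
    then have BV: "B - V = B" by auto
    have "nest h w ((H1 - sum h (A - V)) + H2 - sum h B) (W - sum w (A \<inter> V)) (H2 + H1) W (B \<union> A)"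
      using hcut.hyps(3) hcut.prems(1,4) BV by (intro nest_beside[OF packable_swap[OF hcut.hyps(2)] _ _ 1]) auto
    then show ?thesis unfolding sums e BV by - (rule nest_swap, simp add: algebra_simps Un_commute)
  qed
qed

text \<open>The upper right corner \<open>(X, Y)\<close> is kept fixed and the inner box sits in
  this corner. A new item enlarges the outer box downwards or to the left, so the positions chosen
  before remain valid. The last conjunct is what puts the items of \<open>L\<close> into the two
  arms.\<close>

lemma nest_placed:
  assumes "nest (\<lambda>i. real (w i)) (\<lambda>i. real (h i)) Wi Hi W H L"
    "contained \<epsilon> w h k p Cs c A (rbox (X - Wi) (Y - Hi) Wi Hi)" "A \<inter> L = {}"
  shows "\<exists>pos. (\<forall>i\<in>A. pos i = p i) \<and> placed w h pos (A \<union> L) (rbox (X - W) (Y - H) W H) \<and>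
    guillotine_separable (rbox (X - W) (Y - H) W H) (item_rect w h pos ` L \<union> snd ` Cs) \<and>
    (\<forall>i\<in>L. snd (pos i) + real (h i) \<le> Y - Hi \<or> fst (pos i) + real (w i) \<le> X - Wi)"
  using assms
proof (induction rule: nest.induct)
  case (inner W H)
  then show ?case by (intro exI[of _ p]) (auto simp: contained_def)
next
  case (bottom Wi Hi W H L i)
  note f = nest_facts[OF bottom.hyps(1)]
  obtain q where q: "\<forall>i\<in>A. q i = p i" "placed w h q (A \<union> L) (rbox (X - W) (Y - H) W H)"
    "guillotine_separable (rbox (X - W) (Y - H) W H) (item_rect w h q ` L \<union> snd ` Cs)"
    "\<forall>i\<in>L. snd (q i) + real (h i) \<le> Y - Hi \<or> fst (q i) + real (w i) \<le> X - Wi"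
    using bottom.IH bottom.prems by auto
  define y where "y = Y - (h i + H)"
  have yH: "Y - H = y + h i" by (simp add: y_def)
  have s: "placed w h (\<lambda>_. (X - W, y)) {i} (rbox (X - W) y W (h i))"
    using bottom.hyps by (intro placed_item) (auto simp: fits_def item_rect_def rbox_def)
  have d: "{i} \<inter> (A \<union> L) = {}" using bottom.hyps bottom.prems by auto
  define r where "r = merge {i} (\<lambda>_. (X - W, y)) q"
  note m = placed_merge[OF s q(2)[unfolded yH] d, folded r_def]
  have r: "r i = (X - W, y)" "\<And>j. j \<in> A \<union> L \<Longrightarrow> r j = q j" using d by (auto simp: r_def merge_def)
  have "placed w h r ({i} \<union> (A \<union> L)) (rbox (X - W) y W (h i + H))"
    using f by (intro placed_hcut[OF m]) auto
  moreover have "guillotine_separable (rbox (X - W) y W (h i + H)) ({item_rect w h r i} \<union> (item_rect w h r ` L \<union> snd ` Cs))"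
  proof -
    have im: "item_rect w h r ` L = item_rect w h q ` L" using r(2) by (intro image_cong item_rect_cong) auto
    have "guillotine_separable ((X - W, y), (X - W + W, y + h i + H)) ({item_rect w h r i} \<union> (item_rect w h r ` L \<union> snd ` Cs))"
    proof (rule guillotine_hcut)
      fix R assume "R \<in> item_rect w h r ` L \<union> snd ` Cs"
      then show "proper R \<and> fits R ((X - W, y + h i), (X - W + W, y + h i + H))"
      proof
        assume "R \<in> item_rect w h r ` L"
        then show ?thesis using m(2) by (auto simp: placed_def rbox_def)
      next
        assume "R \<in> snd ` Cs"
        then have "proper R" "fits R (rbox (X - Wi) (Y - Hi) Wi Hi)" using bottom.prems by (auto simp: contained_def)
        then show ?thesis using f yH by (auto simp: fits_def rbox_def)
      qed
    next
      show "guillotine_separable ((X - W, y + h i), (X - W + W, y + h i + H)) (item_rect w h r ` L \<union> snd ` Cs)"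
        using q(3) im yH by (simp add: rbox_def)
    next
      show "guillotine_separable ((X - W, y), (X - W + W, y + h i)) {item_rect w h r i}"
        by (intro guillotine_separable.at_most_one) auto
    qed (use f m(1) in \<open>auto simp: placed_def rbox_def\<close>)
    then show ?thesis by (simp add: rbox_def add.assoc)
  qed
  moreover have "\<forall>j\<in>insert i L. snd (r j) + h j \<le> Y - Hi \<or> fst (r j) + w j \<le> X - Wi"
    using q(4) r f by (auto simp: y_def)
  ultimately show ?case using q(1) r(2) unfolding y_def by (intro exI[of _ r]) (auto simp: insert_commute)
next
  case (left Wi Hi W H L i)
  note f = nest_facts[OF left.hyps(1)]
  obtain q where q: "\<forall>i\<in>A. q i = p i" "placed w h q (A \<union> L) (rbox (X - W) (Y - H) W H)"
    "guillotine_separable (rbox (X - W) (Y - H) W H) (item_rect w h q ` L \<union> snd ` Cs)"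
    "\<forall>i\<in>L. snd (q i) + real (h i) \<le> Y - Hi \<or> fst (q i) + real (w i) \<le> X - Wi"
    using left.IH left.prems by auto
  define x where "x = X - (w i + W)"
  have xW: "X - W = x + w i" by (simp add: x_def)
  have s: "placed w h (\<lambda>_. (x, Y - H)) {i} (rbox x (Y - H) (w i) H)"
    using left.hyps by (intro placed_item) (auto simp: fits_def item_rect_def rbox_def)
  have d: "{i} \<inter> (A \<union> L) = {}" using left.hyps left.prems by auto
  define r where "r = merge {i} (\<lambda>_. (x, Y - H)) q"
  note m = placed_merge[OF s q(2)[unfolded xW] d, folded r_def]
  have r: "r i = (x, Y - H)" "\<And>j. j \<in> A \<union> L \<Longrightarrow> r j = q j" using d by (auto simp: r_def merge_def)
  have "placed w h r ({i} \<union> (A \<union> L)) (rbox x (Y - H) (w i + W) H)"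
    using f by (intro placed_vcut[OF m]) auto
  moreover have "guillotine_separable (rbox x (Y - H) (w i + W) H) ({item_rect w h r i} \<union> (item_rect w h r ` L \<union> snd ` Cs))"
  proof -
    have im: "item_rect w h r ` L = item_rect w h q ` L" using r(2) by (intro image_cong item_rect_cong) auto
    have "guillotine_separable ((x, Y - H), (x + w i + W, Y - H + H)) ({item_rect w h r i} \<union> (item_rect w h r ` L \<union> snd ` Cs))"
    proof (rule guillotine_vcut)
      fix R assume "R \<in> item_rect w h r ` L \<union> snd ` Cs"
      then show "proper R \<and> fits R ((x + w i, Y - H), (x + w i + W, Y - H + H))"
      proof
        assume "R \<in> item_rect w h r ` L"
        then show ?thesis using m(2) by (auto simp: placed_def rbox_def)
      next
        assume "R \<in> snd ` Cs"
        then have "proper R" "fits R (rbox (X - Wi) (Y - Hi) Wi Hi)" using left.prems by (auto simp: contained_def)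
        then show ?thesis using f xW by (auto simp: fits_def rbox_def)
      qed
    next
      show "guillotine_separable ((x + w i, Y - H), (x + w i + W, Y - H + H)) (item_rect w h r ` L \<union> snd ` Cs)"
        using q(3) im xW by (simp add: rbox_def)
    next
      show "guillotine_separable ((x, Y - H), (x + w i, Y - H + H)) {item_rect w h r i}"
        by (intro guillotine_separable.at_most_one) auto
    qed (use f m(1) in \<open>auto simp: placed_def rbox_def\<close>)
    then show ?thesis by (simp add: rbox_def add.assoc)
  qed
  moreover have "\<forall>j\<in>insert i L. snd (r j) + h j \<le> Y - Hi \<or> fst (r j) + w j \<le> X - Wi"
    using q(4) r f by (auto simp: x_def)
  ultimately show ?case using q(1) r(2) unfolding x_def by (intro exI[of _ r]) (auto simp: insert_commute)
qed

text \<open>The arms have thickness \<open>N - Hi\<close> and \<open>N - Wi\<close>. The interior of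
  the inner box does not meet the L, and distinct containers have disjoint interiors, so the
  geometric membership \<open>items_in\<close> agrees with the assignment of items to
  \<open>L\<close> and to containers.\<close>

lemma LC_packing_of_nest:
  assumes "nest (\<lambda>i. real (w i)) (\<lambda>i. real (h i)) Wi Hi N N L"
    "container_packable \<epsilon> (\<lambda>i. real (w i)) (\<lambda>i. real (h i)) k Wi Hi A"
    "A \<inter> L = {}" "A \<union> L \<subseteq> I" "\<And>i. i \<in> L \<Longrightarrow> long_item N w h i"
  shows "\<exists>pos. LC_packing \<epsilon> k N I w h (A \<union> L) pos"
proof -
  note f = nest_facts[OF assms(1)]
  obtain p Cs c where C0: "contained \<epsilon> w h k p Cs c A (rbox (N - Wi) (N - Hi) Wi Hi)"
    using container_packable_contained[OF assms(2)] by blast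
  obtain pos where pos: "\<forall>i\<in>A. pos i = p i" "placed w h pos (A \<union> L) (rbox (real N - N) (real N - N) N N)"
    "guillotine_separable (rbox (real N - N) (real N - N) N N) (item_rect w h pos ` L \<union> snd ` Cs)"
    "\<forall>i\<in>L. snd (pos i) + real (h i) \<le> N - Hi \<or> fst (pos i) + real (w i) \<le> N - Wi"
    using nest_placed[OF assms(1) C0 assms(3)] by blast
  have K: "rbox (real N - N) (real N - N) N N = knapsack N" by (simp add: rbox_def knapsack_def)
  have C: "contained \<epsilon> w h k pos Cs c A (rbox (N - Wi) (N - Hi) Wi Hi)"
    using contained_cong[OF C0] pos(1) by auto
  define N1 where "N1 = N - Hi"
  define N2 where "N2 = N - Wi"
  have R: "rbox (N - Wi) (N - Hi) Wi Hi = ((N2, N1), (real N, real N))"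
    by (simp add: rbox_def N1_def N2_def)
  note C = C[unfolded R]
  have plA: "placed w h pos A ((N2, N1), (real N, real N))" using C by (simp add: contained_def)
  have pl: "proper (item_rect w h pos i)" "fits (item_rect w h pos i) (knapsack N)" if "i \<in> A \<union> L" for i
    using pos(2) that unfolding K placed_def by auto
  have outside: "rect_open r \<inter> boundary_L N N1 N2 = {}" if "fits r ((N2, N1), (real N, real N))" for r
    using that by (auto simp: fits_def rect_open_eq boundary_L_def)
  have inL: "rect_open (item_rect w h pos i) \<subseteq> boundary_L N N1 N2" if "i \<in> L" for i
    using pl[of i] pos(4) that
    by (force simp: rect_open_eq boundary_L_def fits_def knapsack_def item_rect_def N1_def N2_def)
  have notL: "\<not> rect_open (item_rect w h pos i) \<subseteq> boundary_L N N1 N2" if "i \<in> A" for i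
    using outside[of "item_rect w h pos i"] proper_open_nonempty[OF pl(1), of i] plA that by (auto simp: placed_def)
  have iL: "items_in w h (A \<union> L) pos (boundary_L N N1 N2) = L"
    using inL notL by (auto simp: items_in_def)
  have cin: "proper (snd D)" "fits (snd D) ((N2, N1), (real N, real N))" if "D \<in> Cs" for D
    using C that by (auto simp: contained_def)
  have ci: "c i \<in> Cs" "fits (item_rect w h pos i) (snd (c i))" if "i \<in> A" for i
    using C that by (auto simp: contained_def placed_def)
  have iC: "items_in w h (A \<union> L) pos (rect_closed (snd D)) = {i \<in> A. c i = D}" if D: "D \<in> Cs" for D
  proof (intro equalityI subsetI)
    fix i assume "i \<in> items_in w h (A \<union> L) pos (rect_closed (snd D))"
    then have i: "i \<in> A \<union> L" "fits (item_rect w h pos i) (snd D)"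
      using pl(1) by (auto simp: items_in_def open_subset_closed_iff)
    have o: "rect_open (item_rect w h pos i) \<subseteq> rect_open (snd D)" "rect_open (item_rect w h pos i) \<noteq> {}"
      using fits_open[OF i(2)] proper_open_nonempty[OF pl(1)[OF i(1)]] by simp_all
    have "i \<notin> L"
      using outside[OF cin(2)[OF D]] o inL[of i] by blast
    then have iA: "i \<in> A" using i by auto
    have "c i = D"
    proof (rule ccontr)
      assume "c i \<noteq> D"
      then have "rect_open (snd (c i)) \<inter> rect_open (snd D) = {}"
        using C ci(1)[OF iA] D by (auto simp: contained_def disjoint_family_on_def)
      then show False using o fits_open[OF ci(2)[OF iA]] by blast
    qed
    then show "i \<in> {i \<in> A. c i = D}" using iA by simp
  next
    fix i assume "i \<in> {i \<in> A. c i = D}"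
    then show "i \<in> items_in w h (A \<union> L) pos (rect_closed (snd D))"
      using ci(2)[of i] pl(1)[of i] by (auto simp: items_in_def open_subset_closed_iff)
  qed
  have "feasible_packing N I w h (A \<union> L) pos"
    using assms(4) pos(2) pl unfolding K feasible_packing_def by (auto simp: placed_def open_subset_closed_iff[symmetric])
  moreover have "0 \<le> N1" "N1 \<le> N" "0 \<le> N2" "N2 \<le> N" using f by (auto simp: N1_def N2_def)
  moreover have "rect_open (snd D) \<subseteq> rect_closed (knapsack N) - boundary_L N N1 N2" if "D \<in> Cs" for D
  proof -
    have "fits (snd D) (knapsack N)"
      using cin(2)[OF that] f by (auto simp: fits_def knapsack_def N1_def N2_def)
    then show ?thesis using outside[OF cin(2)[OF that]] open_subset_closed_iff[OF cin(1)[OF that]] by blast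
  qed
  moreover have "A \<union> L = items_in w h (A \<union> L) pos (boundary_L N N1 N2) \<union>
      (\<Union>D\<in>Cs. items_in w h (A \<union> L) pos (rect_closed (snd D)))"
    using iL iC ci(1) by auto
  moreover have "finite Cs" "card Cs \<le> k" "disjoint_family_on (\<lambda>D. rect_open (snd D)) Cs"
    using C by (auto simp: contained_def)
  moreover have "0 < rect_width (snd D)" "0 < rect_height (snd D)" if "D \<in> Cs" for D
    using cin(1)[OF that] by (auto simp: proper_def)
  moreover have "respects_label \<epsilon> w h pos D (items_in w h (A \<union> L) pos (rect_closed (snd D)))"
    "guillotine_separable (snd D) (item_rect w h pos ` items_in w h (A \<union> L) pos (rect_closed (snd D)))" if "D \<in> Cs" for D
    using C that iC[OF that] by (auto simp: contained_def placed_def)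
  ultimately have "LC_packing \<epsilon> k N I w h (A \<union> L) pos"
    unfolding LC_packing_def using pos(3) iL assms(5) unfolding K
    by (intro conjI exI[of _ N1] exI[of _ N2] exI[of _ Cs]) auto
  then show ?thesis by blast
qed

text \<open>\<open>guillotine_separable\<close> only sees the set of rectangles, in which two items
  at the same position would be one element. Disjointness of the nonempty interiors excludes this,
  so a set with at most one rectangle has at most one item.\<close>

lemma packable_of_guillotine:
  assumes "guillotine_separable R F" "fst (fst R) \<le> fst (snd R)" "snd (fst R) \<le> snd (snd R)"
    "F = item_rect w h pos ` S" "finite S" "\<And>i. i \<in> S \<Longrightarrow> 0 < w i \<and> 0 < h i \<and> fits (item_rect w h pos i) R"
    "disjoint_family_on (\<lambda>i. rect_open (item_rect w h pos i)) S"
  shows "packable (\<lambda>i. real (w i)) (\<lambda>i. real (h i)) (rect_width R) (rect_height R) S"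
  using assms
proof (induction arbitrary: S rule: guillotine_separable.induct)
  case (at_most_one F r R)
  have "i = j" if "i \<in> S" "j \<in> S" for i j
  proof (rule ccontr)
    assume "i \<noteq> j"
    then have "rect_open (item_rect w h pos i) \<inter> rect_open (item_rect w h pos j) = {}"
      using at_most_one.prems(6) that by (auto simp: disjoint_family_on_def)
    moreover have "item_rect w h pos i = r" "item_rect w h pos j = r" using that at_most_one by auto
    ultimately show False
      using proper_open_nonempty[of "item_rect w h pos i"] that at_most_one.prems(5) by (auto simp: proper_item)
  qed
  then consider "S = {}" | i where "S = {i}" by blast
  then show ?case
  proof cases
    case 1
    then show ?thesis using at_most_one.prems by (auto simp: rect_width_def rect_height_def intro: packable.empty)
  next
    case (2 i)
    then show ?thesis using at_most_one.prems(5)[of i]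
      by (auto simp: rect_width_def rect_height_def fits_def item_rect_def intro!: packable.item)
  qed
next
  case (vertical_cut x1 c x2 F y1 y2)
  define S1 where "S1 = {i \<in> S. fits (item_rect w h pos i) ((x1, y1), (c, y2))}"
  define S2 where "S2 = {i \<in> S. fits (item_rect w h pos i) ((c, y1), (x2, y2))}"
  have pr: "proper (item_rect w h pos i)" if "i \<in> S" for i using vertical_cut.prems(5)[OF that] by (simp add: proper_item)
  have cover: "i \<in> S1 \<union> S2" if i: "i \<in> S" for i
  proof (rule ccontr)
    assume n: "i \<notin> S1 \<union> S2"
    define r where "r = item_rect w h pos i"
    have r: "proper r" "fits r ((x1, y1), (x2, y2))" "rect_open r \<inter> ({c} \<times> {y1..y2}) = {}"
      using pr[OF i] vertical_cut.prems(3,5) vertical_cut.hyps(3) i by (auto simp: r_def)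
    then have "fst (fst r) < c" "c < fst (snd r)" using n i by (auto simp: S1_def S2_def r_def[symmetric] fits_def)
    \<comment> \<open>An item on neither side has the cut position strictly between its ends; the
      point of the cut at half of its height then lies in its interior.\<close>
    moreover have "(c, (snd (fst r) + snd (snd r)) / 2) \<in> {c} \<times> {y1..y2}"
      using r(1,2) by (auto simp: fits_def proper_def rect_height_def)
    ultimately have "(c, (snd (fst r) + snd (snd r)) / 2) \<in> rect_open r \<inter> ({c} \<times> {y1..y2})"
      using r(1) by (auto simp: rect_open_eq proper_def rect_height_def)
    then show False using r(3) by blast
  qed
  have un: "S = S1 \<union> S2" using cover by (auto simp: S1_def S2_def)
  have dis: "S1 \<inter> S2 = {}"
    using pr by (force simp: S1_def S2_def fits_def proper_def rect_width_def)
  have F: "{r \<in> F. rect_closed r \<subseteq> rect_closed ((x1, y1), (c, y2))} = item_rect w h pos ` S1"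
    "{r \<in> F. rect_closed r \<subseteq> rect_closed ((c, y1), (x2, y2))} = item_rect w h pos ` S2"
  proof -
    have im: "{r \<in> item_rect w h pos ` S. rect_closed r \<subseteq> X} =
      item_rect w h pos ` {i \<in> S. rect_closed (item_rect w h pos i) \<subseteq> X}" for X by blast
    show "{r \<in> F. rect_closed r \<subseteq> rect_closed ((x1, y1), (c, y2))} = item_rect w h pos ` S1"
      "{r \<in> F. rect_closed r \<subseteq> rect_closed ((c, y1), (x2, y2))} = item_rect w h pos ` S2"
      unfolding vertical_cut.prems(3) im S1_def S2_def
      by (rule image_cong, rule Collect_cong, rule conj_cong, rule refl, erule closed_subset_iff[OF pr], rule refl)+
  qed
  have d: "disjoint_family_on (\<lambda>i. rect_open (item_rect w h pos i)) S1"
    "disjoint_family_on (\<lambda>i. rect_open (item_rect w h pos i)) S2"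
    using vertical_cut.prems(6) by (auto simp: S1_def S2_def disjoint_family_on_def)
  have "packable (\<lambda>i. real (w i)) (\<lambda>i. real (h i)) (c - x1) (y2 - y1) S1"
  proof -
    have "packable (\<lambda>i. real (w i)) (\<lambda>i. real (h i)) (rect_width ((x1, y1), (c, y2))) (rect_height ((x1, y1), (c, y2))) S1"
    proof (rule vertical_cut.IH(1)[OF _ _ F(1) _ _ d(1)])
      show "0 < w i \<and> 0 < h i \<and> fits (item_rect w h pos i) ((x1, y1), (c, y2))" if "i \<in> S1" for i
        using that vertical_cut.prems(5)[of i] by (simp add: S1_def)
    qed (use vertical_cut.prems(1,2,4) vertical_cut.hyps(1,2) in \<open>simp_all add: S1_def\<close>)
    then show ?thesis by (simp add: rect_width_def rect_height_def)
  qed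
  moreover have "packable (\<lambda>i. real (w i)) (\<lambda>i. real (h i)) (x2 - c) (y2 - y1) S2"
  proof -
    have "packable (\<lambda>i. real (w i)) (\<lambda>i. real (h i)) (rect_width ((c, y1), (x2, y2))) (rect_height ((c, y1), (x2, y2))) S2"
    proof (rule vertical_cut.IH(2)[OF _ _ F(2) _ _ d(2)])
      show "0 < w i \<and> 0 < h i \<and> fits (item_rect w h pos i) ((c, y1), (x2, y2))" if "i \<in> S2" for i
        using that vertical_cut.prems(5)[of i] by (simp add: S2_def)
    qed (use vertical_cut.prems(1,2,4) vertical_cut.hyps(1,2) in \<open>simp_all add: S2_def\<close>)
    then show ?thesis by (simp add: rect_width_def rect_height_def)
  qed
  ultimately have "packable (\<lambda>i. real (w i)) (\<lambda>i. real (h i)) ((c - x1) + (x2 - c)) (y2 - y1) (S1 \<union> S2)"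
    using dis by (intro packable.vcut)
  then show ?case unfolding un by (simp add: rect_width_def rect_height_def)
next
  case (horizontal_cut y1 c y2 F x1 x2)
  define S1 where "S1 = {i \<in> S. fits (item_rect w h pos i) ((x1, y1), (x2, c))}"
  define S2 where "S2 = {i \<in> S. fits (item_rect w h pos i) ((x1, c), (x2, y2))}"
  have pr: "proper (item_rect w h pos i)" if "i \<in> S" for i using horizontal_cut.prems(5)[OF that] by (simp add: proper_item)
  have cover: "i \<in> S1 \<union> S2" if i: "i \<in> S" for i
  proof (rule ccontr)
    assume n: "i \<notin> S1 \<union> S2"
    define r where "r = item_rect w h pos i"
    have r: "proper r" "fits r ((x1, y1), (x2, y2))" "rect_open r \<inter> ({x1..x2} \<times> {c}) = {}"
      using pr[OF i] horizontal_cut.prems(3,5) horizontal_cut.hyps(3) i by (auto simp: r_def)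
    then have "snd (fst r) < c" "c < snd (snd r)" using n i by (auto simp: S1_def S2_def r_def[symmetric] fits_def)
    moreover have "((fst (fst r) + fst (snd r)) / 2, c) \<in> {x1..x2} \<times> {c}"
      using r(1,2) by (auto simp: fits_def proper_def rect_width_def)
    ultimately have "((fst (fst r) + fst (snd r)) / 2, c) \<in> rect_open r \<inter> ({x1..x2} \<times> {c})"
      using r(1) by (auto simp: rect_open_eq proper_def rect_width_def)
    then show False using r(3) by blast
  qed
  have un: "S = S1 \<union> S2" using cover by (auto simp: S1_def S2_def)
  have dis: "S1 \<inter> S2 = {}"
    using pr by (force simp: S1_def S2_def fits_def proper_def rect_height_def)
  have F: "{r \<in> F. rect_closed r \<subseteq> rect_closed ((x1, y1), (x2, c))} = item_rect w h pos ` S1"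
    "{r \<in> F. rect_closed r \<subseteq> rect_closed ((x1, c), (x2, y2))} = item_rect w h pos ` S2"
  proof -
    have im: "{r \<in> item_rect w h pos ` S. rect_closed r \<subseteq> X} =
      item_rect w h pos ` {i \<in> S. rect_closed (item_rect w h pos i) \<subseteq> X}" for X by blast
    show "{r \<in> F. rect_closed r \<subseteq> rect_closed ((x1, y1), (x2, c))} = item_rect w h pos ` S1"
      "{r \<in> F. rect_closed r \<subseteq> rect_closed ((x1, c), (x2, y2))} = item_rect w h pos ` S2"
      unfolding horizontal_cut.prems(3) im S1_def S2_def
      by (rule image_cong, rule Collect_cong, rule conj_cong, rule refl, erule closed_subset_iff[OF pr], rule refl)+
  qed
  have d: "disjoint_family_on (\<lambda>i. rect_open (item_rect w h pos i)) S1"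
    "disjoint_family_on (\<lambda>i. rect_open (item_rect w h pos i)) S2"
    using horizontal_cut.prems(6) by (auto simp: S1_def S2_def disjoint_family_on_def)
  have "packable (\<lambda>i. real (w i)) (\<lambda>i. real (h i)) (x2 - x1) (c - y1) S1"
  proof -
    have "packable (\<lambda>i. real (w i)) (\<lambda>i. real (h i)) (rect_width ((x1, y1), (x2, c))) (rect_height ((x1, y1), (x2, c))) S1"
    proof (rule horizontal_cut.IH(1)[OF _ _ F(1) _ _ d(1)])
      show "0 < w i \<and> 0 < h i \<and> fits (item_rect w h pos i) ((x1, y1), (x2, c))" if "i \<in> S1" for i
        using that horizontal_cut.prems(5)[of i] by (simp add: S1_def)
    qed (use horizontal_cut.prems(1,2,4) horizontal_cut.hyps(1,2) in \<open>simp_all add: S1_def\<close>)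
    then show ?thesis by (simp add: rect_width_def rect_height_def)
  qed
  moreover have "packable (\<lambda>i. real (w i)) (\<lambda>i. real (h i)) (x2 - x1) (y2 - c) S2"
  proof -
    have "packable (\<lambda>i. real (w i)) (\<lambda>i. real (h i)) (rect_width ((x1, c), (x2, y2))) (rect_height ((x1, c), (x2, y2))) S2"
    proof (rule horizontal_cut.IH(2)[OF _ _ F(2) _ _ d(2)])
      show "0 < w i \<and> 0 < h i \<and> fits (item_rect w h pos i) ((x1, c), (x2, y2))" if "i \<in> S2" for i
        using that horizontal_cut.prems(5)[of i] by (simp add: S2_def)
    qed (use horizontal_cut.prems(1,2,4) horizontal_cut.hyps(1,2) in \<open>simp_all add: S2_def\<close>)
    then show ?thesis by (simp add: rect_width_def rect_height_def)
  qed
  ultimately have "packable (\<lambda>i. real (w i)) (\<lambda>i. real (h i)) (x2 - x1) ((c - y1) + (y2 - c)) (S1 \<union> S2)"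
    using dis by (intro packable.hcut)
  then show ?case unfolding un by (simp add: rect_width_def rect_height_def)
qed

lemma packable_of_feasible:
  assumes "ggk_instance N I w h" "feasible_packing N I w h S pos"
  shows "packable (\<lambda>i. real (w i)) (\<lambda>i. real (h i)) N N S"
proof -
  have S: "S \<subseteq> I" "finite S" "\<And>i. i \<in> S \<Longrightarrow> 0 < w i \<and> 0 < h i"
    using assms finite_subset by (auto simp: ggk_instance_def feasible_packing_def)
  have "packable (\<lambda>i. real (w i)) (\<lambda>i. real (h i)) (rect_width (knapsack N)) (rect_height (knapsack N)) S"
  proof (rule packable_of_guillotine)
    show "guillotine_separable (knapsack N) (item_rect w h pos ` S)" using assms by (simp add: feasible_packing_def)
    show "0 < w i \<and> 0 < h i \<and> fits (item_rect w h pos i) (knapsack N)" if "i \<in> S" for i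
      using S(3)[OF that] assms(2) that open_subset_closed_iff[of "item_rect w h pos i" "knapsack N"]
      by (simp add: feasible_packing_def proper_item)
  qed (use assms(2) S(2) in \<open>auto simp: knapsack_def feasible_packing_def\<close>)
  then show ?thesis by (simp add: rect_width_def rect_height_def knapsack_def)
qed

section \<open>The structural theorem\<close>

text \<open>The \<open>m\<close> largest elements are on average at least as large as the others, so
  a share \<open>m / card X \<ge> p\<close> of the elements carries at least the share
  \<open>p\<close> of the sum. They are found by \<open>greedy_shelf\<close> with unit widths and
  limit \<open>m\<close>, ordered by \<open>u\<close>; the \<open>+ 1\<close> is the rounding of
  \<open>p * card X\<close>.\<close>

lemma drop_largest:
  fixes u :: "nat \<Rightarrow> real" and p :: real
  assumes "finite X" "\<And>i. i \<in> X \<Longrightarrow> 0 \<le> u i" "0 \<le> p" "p \<le> 1"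
  shows "\<exists>Y\<subseteq>X. real (card Y) \<le> p * card X + 1 \<and> sum u (X - Y) \<le> (1 - p) * sum u X"
proof -
  define m where "m = nat \<lceil>p * card X\<rceil>"
  have m: "p * card X \<le> m" "m \<le> p * card X + 1"
    using assms(3) mult_nonneg_nonneg[of p "real (card X)"] unfolding m_def by linarith+
  obtain Y where Y: "Y \<subseteq> X" "(\<Sum>i\<in>Y. 1::real) \<le> real m" "\<forall>i\<in>Y. \<forall>j\<in>X - Y. u j \<le> u i"
    "Y = X \<or> real m - 1 < (\<Sum>i\<in>Y. 1::real)"
    using greedy_shelf[of X "\<lambda>_. 1" 1 "real m" u] assms(1) by auto
  have tot: "0 \<le> sum u X" using assms(2) by (intro sum_nonneg)
  have "sum u (X - Y) \<le> (1 - p) * sum u X"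
  proof (cases "Y = X")
    case True
    then show ?thesis using tot assms(4) by simp
  next
    case False
    have fin: "finite Y" "finite (X - Y)" "X - Y \<noteq> {}" using Y(1) assms(1) False finite_subset by auto
    have cY: "card Y = m" using Y(2,4) False by simp
    define v where "v = Max (u ` (X - Y))"
    have v: "v \<in> u ` (X - Y)" "\<And>i. i \<in> X - Y \<Longrightarrow> u i \<le> v"
      unfolding v_def using fin by (auto intro: Max_in)
    have 1: "sum u (X - Y) \<le> card (X - Y) * v" using v(2) sum_bounded_above[of "X - Y" u v] by simp
    have 2: "card Y * v \<le> sum u Y" using v(1) Y(3) sum_bounded_below[of Y v u] by auto
    have n: "card X = card Y + card (X - Y)" using Y(1) fin assms(1)
      by (metis card_Diff_subset card_mono le_add_diff_inverse)
    have s: "sum u X = sum u Y + sum u (X - Y)" using Y(1) assms(1) by (simp add: sum.subset_diff add.commute)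
    have "card Y * sum u (X - Y) \<le> card Y * (card (X - Y) * v)" using 1 by (intro mult_left_mono) auto
    also have "\<dots> = card (X - Y) * (card Y * v)" by simp
    also have "\<dots> \<le> card (X - Y) * sum u Y" using 2 by (intro mult_left_mono) auto
    finally have "card X * sum u (X - Y) \<le> card (X - Y) * sum u X"
      unfolding n s by (simp add: algebra_simps)
    also have "\<dots> = (card X - real m) * sum u X" unfolding n cY by simp
    also have "\<dots> \<le> (card X - p * card X) * sum u X" using m tot by (intro mult_right_mono) auto
    also have "\<dots> = card X * ((1 - p) * sum u X)" by (simp add: algebra_simps)
    finally have "card X * sum u (X - Y) \<le> card X * ((1 - p) * sum u X)" .
    moreover have "0 < card X" using fin(3) assms(1) by (auto simp: card_gt_0_iff)
    ultimately show ?thesis by simp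
  qed
  moreover have "real (card Y) \<le> p * card X + 1" using Y(2) m by simp
  ultimately show ?thesis using Y(1) by blast
qed

lemma disjoint_family_on_less:
  fixes Z :: "nat \<Rightarrow> 'a set"
  assumes "\<And>i j. i < j \<Longrightarrow> Z i \<inter> Z j = {}"
  shows "disjoint_family_on Z K"
  unfolding disjoint_family_on_def using assms by (metis Int_commute linorder_neqE_nat)

lemma pigeonhole_disjoint:
  fixes X :: "nat set"
  assumes "finite X" "\<And>j. j < K \<Longrightarrow> Z j \<subseteq> X" "disjoint_family_on Z {..<K}" "0 < K"
  shows "\<exists>j<K. K * card (Z j) \<le> card X"
proof (rule ccontr)
  assume "\<not> ?thesis"
  then have less: "card X < K * card (Z j)" if "j < K" for j using that by (auto simp: not_le)
  have "(\<Sum>j<K. card (Z j)) = card (\<Union>j<K. Z j)"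
    using assms finite_subset[OF assms(2)]
    by (intro card_UN_disjoint[symmetric]) (auto simp: disjoint_family_on_def)
  also have "\<dots> \<le> card X" using assms by (intro card_mono) auto
  finally have le: "(\<Sum>j<K. card (Z j)) \<le> card X" .
  have "K * card X = (\<Sum>j<K. card X)" by simp
  also have "\<dots> < (\<Sum>j<K. K * card (Z j))" using less assms(4) by (intro sum_strict_mono) auto
  also have "\<dots> = K * (\<Sum>j<K. card (Z j))" by (simp add: sum_distrib_left)
  also have "\<dots> \<le> K * card X" using le by simp
  finally show False by simp
qed

text \<open>The goal in the unit square and without coordinates: the items of \<open>L\<close>
  surround an inner box on two sides, and this box is divided into containers. The threshold
  \<open>1 / 2\<close> is that of long items after scaling by \<open>1 / N\<close>.\<close>

definition LC_packable :: "real \<Rightarrow> nat \<Rightarrow> (nat \<Rightarrow> real) \<Rightarrow> (nat \<Rightarrow> real) \<Rightarrow> nat set \<Rightarrow> bool" where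
  "LC_packable \<epsilon> k w h T \<longleftrightarrow> (\<exists>L C Wi Hi. T = C \<union> L \<and> C \<inter> L = {} \<and> nest w h Wi Hi 1 1 L \<and> container_packable \<epsilon> w h k Wi Hi C \<and>
     (\<forall>i\<in>L. 1 / 2 < w i \<or> 1 / 2 < h i))"

lemma LC_packable_swap: "LC_packable \<epsilon> k w h T \<Longrightarrow> LC_packable \<epsilon> k h w T"
proof -
  assume "LC_packable \<epsilon> k w h T"
  then obtain L C Wi Hi where "T = C \<union> L" "C \<inter> L = {}" "nest w h Wi Hi 1 1 L" "container_packable \<epsilon> w h k Wi Hi C"
    "\<forall>i\<in>L. 1 / 2 < w i \<or> 1 / 2 < h i" unfolding LC_packable_def by blast
  then show "LC_packable \<epsilon> k h w T" unfolding LC_packable_def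
    by - (rule exI[of _ L], rule exI[of _ C], rule exI[of _ Hi], rule exI[of _ Wi], auto intro: nest_swap container_packable_swap)
qed

lemma LC_packable_mono: "LC_packable \<epsilon> k w h T \<Longrightarrow> k \<le> k' \<Longrightarrow> LC_packable \<epsilon> k' w h T"
proof -
  assume "LC_packable \<epsilon> k w h T" and k: "k \<le> k'"
  then obtain L C Wi Hi where "T = C \<union> L" "C \<inter> L = {}" "nest w h Wi Hi 1 1 L" "container_packable \<epsilon> w h k Wi Hi C"
    "\<forall>i\<in>L. 1 / 2 < w i \<or> 1 / 2 < h i" unfolding LC_packable_def by blast
  then show "LC_packable \<epsilon> k' w h T" unfolding LC_packable_def using container_packable_mono_k[OF _ k]
    by - (rule exI[of _ L], rule exI[of _ C], rule exI[of _ Wi], rule exI[of _ Hi], auto)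
qed

text \<open>The small items fit into the free area: if they cover much of the square, dropping the largest
  ones gains enough area; otherwise the free strip suffices.\<close>

lemma area_budget:
  fixes \<alpha> \<alpha>' b \<beta> a S S' e t \<kappa>' c :: real
  assumes "0 < e" "e \<le> 1 / 2" "0 < t" "t \<le> e" "0 \<le> \<alpha>'" "\<alpha>' \<le> 1 / 2" "\<alpha>' \<le> (1 - t) * \<alpha>" "\<alpha> \<le> 1"
    "0 \<le> b" "b \<le> \<beta>" "\<beta> = e * t / 128" "0 \<le> \<kappa>'" "\<kappa>' \<le> e * t / 64" "c \<le> e * t / 64" "0 \<le> a"
    "a \<le> (1 - \<alpha>) * (1 - t)" "S' \<le> (1 - e) * S" "0 \<le> S" "S + a + (1 - t) * \<alpha> \<le> 1"
  shows "S' \<le> (1 - \<alpha>') * (1 - b - \<beta>) - a * (1 + \<kappa>') - c"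
proof -
  have et: "e * t \<le> t / 2" "0 < e * t" using assms(1-3) mult_right_mono[of e "1 / 2" t] by auto
  have \<alpha>0: "0 \<le> \<alpha>"
  proof (rule ccontr)
    assume "\<not> 0 \<le> \<alpha>"
    then have "(1 - t) * \<alpha> < 0" using assms(2,4) by (intro mult_pos_neg) auto
    then show False using assms(5,7) by linarith
  qed
  have \<alpha>\<alpha>: "\<alpha>' \<le> \<alpha>" using assms(7) \<alpha>0 assms(3) mult_right_mono[of "1 - t" 1 \<alpha>] by auto
  have "a \<le> 1 * 1" using assms(16) mult_mono[of "1 - \<alpha>" 1 "1 - t" 1] \<alpha>0 assms(2-4) by auto
  then have "a * \<kappa>' \<le> 1 * \<kappa>'" using assms(12) by (intro mult_right_mono) auto
  then have ak: "a * (1 + \<kappa>') \<le> a + \<kappa>'" by (simp add: algebra_simps)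
  show ?thesis
  proof (cases "S \<le> t / 16")
    case True
    have "S' \<le> S" using assms(1,17,18) mult_right_mono[of "1 - e" 1 S] by auto
    then have S': "S' \<le> t / 16" using True by simp
    have "(1 - \<alpha>) * (1 - t) \<le> (1 - \<alpha>') * (1 - t)" using \<alpha>\<alpha> assms(2,4) by (intro mult_right_mono) auto
    then have a: "a \<le> (1 - \<alpha>') * (1 - t)" using assms(16) by simp
    \<comment> \<open>The strip has width at least \<open>1 / 2\<close> because
      \<open>\<alpha>' \<le> 1 / 2\<close>; its area of about \<open>t / 2\<close> is to be compared
      with \<open>t / 16\<close> for the small items.\<close>
    have "1 / 2 * (t - b - \<beta>) \<le> (1 - \<alpha>') * (t - b - \<beta>)"
      using assms(6,10,11) et by (intro mult_right_mono) auto
    moreover have "(1 - \<alpha>') * (1 - b - \<beta>) - (1 - \<alpha>') * (1 - t) = (1 - \<alpha>') * (t - b - \<beta>)" by (simp add: algebra_simps)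
    ultimately have "1 / 2 * (t - b - \<beta>) + a \<le> (1 - \<alpha>') * (1 - b - \<beta>)" using a by linarith
    moreover have "t / 16 + \<kappa>' + c \<le> 1 / 2 * (t - b - \<beta>)" using assms(3,10,11,13,14) et by simp
    ultimately show ?thesis using S' ak by linarith
  next
    case False
    have "e * (t / 16) \<le> e * S" using False assms(1) by (intro mult_left_mono) auto
    \<comment> \<open>The gain \<open>e * t / 16\<close> covers all errors:
      \<open>b + \<beta>\<close>, \<open>\<kappa>'\<close> and \<open>c\<close> are at most
      \<open>e * t / 64\<close> each.\<close>
    then have S': "S' \<le> S - e * t / 16" using assms(17) by (simp add: algebra_simps)
    have "\<alpha>' * (b + \<beta>) \<ge> 0" using assms(5,9,10) by (intro mult_nonneg_nonneg) auto
    then have "(1 - \<alpha>') * (1 - b - \<beta>) \<ge> 1 - \<alpha>' - b - \<beta>" by (simp add: algebra_simps)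
    then show ?thesis using S' ak assms(7,10,11,13,14,19) et by linarith
  qed
qed

text \<open>\<open>\<mu>\<close> can only be chosen once the number of pieces for items larger than
  \<open>\<delta>\<close> is known. Hence the gap from \<open>\<mu>\<close> to
  \<open>\<delta>\<close> is a result of the lemma, and that few items lie in it becomes an
  assumption on the packing.\<close>

lemma LC_packable_few_tall:
  fixes e \<delta> :: real
  assumes "0 < e" "e \<le> 1 / 2" "0 < \<delta>" "\<delta> < 1"
  shows "\<exists>\<mu> K n0. 0 < \<mu> \<and> \<mu> < \<delta> \<and> (\<forall>w h A. packable w h 1 1 A \<longrightarrow> n0 \<le> card A \<longrightarrow>
    card {i \<in> A. \<mu> < max (w i) (h i) \<and> max (w i) (h i) \<le> \<delta>} \<le> e * card A \<longrightarrow>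
    2 * card {i \<in> A. \<delta> < h i \<and> w i \<le> \<mu>} \<le> card A \<longrightarrow>
    (\<exists>T\<subseteq>A. LC_packable e K w h T \<and> (3 / 4 - 4 * e) * card A \<le> card T))"
proof -
  define M where "M = nat \<lceil>1 / e\<rceil>"
  have "1 / e \<le> M" unfolding M_def by linarith
  then have M: "1 \<le> M * e" using assms(1) by (simp add: field_simps)
  have M0: "0 < M" using M by (cases M) auto
  \<comment> \<open>The ratio of consecutive levels \<open>s\<close> and \<open>t\<close>, chosen
    such that \<open>s / \<delta> = e * t / 128\<close>; this is the bound \<open>\<beta>\<close> on
    the total height of the wide items above \<open>s\<close>.\<close>
  define \<rho> where "\<rho> = e * \<delta> / 128"
  have "e * \<delta> < 1 * 1" using assms by (intro mult_strict_mono) auto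
  then have \<rho>: "0 < \<rho>" "\<rho> < 1" using assms by (auto simp: \<rho>_def)
  \<comment> \<open>The levels increase from \<open>\<sigma> 0\<close> to
    \<open>\<sigma> M = e * \<delta>\<close>, so all of them are at most \<open>\<delta>\<close>, as
    \<open>combed\<close> demands, and at most \<open>e\<close>.\<close>
  define \<sigma> where "\<sigma> j = e * \<delta> * \<rho> ^ (M - j)" for j
  have \<sigma>0: "0 < \<sigma> j" for j using assms \<rho> by (simp add: \<sigma>_def)
  have \<sigma>S: "\<sigma> j = \<rho> * \<sigma> (Suc j)" if "j < M" for j
    using that by (simp add: \<sigma>_def Suc_diff_Suc[symmetric])
  have \<sigma>le: "\<sigma> j \<le> e * \<delta>" for j
    using mult_left_mono[OF power_le_one[of \<rho> "M - j"], of "e * \<delta>"] \<rho> assms by (simp add: \<sigma>_def)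
  have \<sigma>mono: "\<sigma> i \<le> \<sigma> j" if "i \<le> j" for i j
    unfolding \<sigma>_def using that assms \<rho> by (intro mult_left_mono power_decreasing) auto
  define \<kappa>' where "\<kappa>' = e * \<sigma> 0 / 64"
  define \<kappa> where "\<kappa> = 1 / (1 + \<kappa>')"
  have \<kappa>': "0 < \<kappa>'" using assms \<sigma>0 by (simp add: \<kappa>'_def)
  then have \<kappa>: "0 < \<kappa>" "\<kappa> < 1" by (auto simp: \<kappa>_def)
  \<comment> \<open>Rearranging into containers may use up to half of the strip.\<close>
  define \<tau> where "\<tau> = \<sigma> 0 / 2"
  have "e * \<delta> \<le> 1" using assms mult_mono[of e 1 \<delta> 1] by auto
  then have \<tau>: "0 < \<tau>" "\<tau> \<le> 1" using \<sigma>0[of 0] \<sigma>le[of 0] by (auto simp: \<tau>_def)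
  obtain k l where "\<forall>w h W q A. packable w h W q A \<longrightarrow> (\<forall>i\<in>A. \<delta> < h i \<or> \<delta> < w i) \<longrightarrow> W \<le> 1 \<longrightarrow> q \<le> 1 \<longrightarrow>
    (\<exists>A'\<subseteq>A. card (A - A') \<le> l \<and> tight_packable w h \<kappa> k W (q + \<tau>) A')"
    using tight_packable_with_slack[OF assms(3) \<kappa> \<tau>] by (elim exE)
  note slack = this[rule_format]
  \<comment> \<open>As \<open>192 = 3 * 64\<close>, the \<open>k + 2\<close> leaves, which lose an
    area of \<open>3 * \<mu> / e\<close> each, lose at most \<open>e * \<sigma> 0 / 64\<close>
    together. The \<open>2\<close> is due to padding.\<close>
  define \<mu> where "\<mu> = min (\<delta> / 2) (e * e * \<sigma> 0 / (192 * (real k + 2)))"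
  have \<mu>: "0 < \<mu>" "\<mu> < \<delta>" using assms \<sigma>0[of 0] by (auto simp: \<mu>_def)
  have \<mu>k: "real (k + 2) * (3 * \<mu> / e) \<le> e * \<sigma> 0 / 64"
  proof -
    have "\<mu> \<le> e * e * \<sigma> 0 / (192 * (real k + 2))" by (simp add: \<mu>_def)
    then have "\<mu> * (192 * (real k + 2)) \<le> e * e * \<sigma> 0" by (subst (asm) pos_le_divide_eq) auto
    then show ?thesis using assms(1) by (simp add: field_simps)
  qed
  \<comment> \<open>The losses that do not grow with the number of items: items large in both
    directions, the roundings for \<open>Y\<close> and \<open>Z\<close>, the wide items that cross
    the level \<open>s\<close>, and the \<open>l\<close> items lost when rearranging. From
    \<open>n0\<close> on they are at most \<open>e * n\<close>.\<close>
  define c0 where "c0 = 1 / (\<mu> * \<mu>) + 2 + 1 / \<delta> + real l"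
  define n0 where "n0 = nat \<lceil>c0 / e\<rceil>"
  have main: "\<exists>T\<subseteq>A. LC_packable e (k + 3) w h T \<and> (3 / 4 - 4 * e) * card A \<le> card T"
    if gpA: "packable w h 1 1 A" and nA: "n0 \<le> card A"
      and mid: "card {i \<in> A. \<mu> < max (w i) (h i) \<and> max (w i) (h i) \<le> \<delta>} \<le> e * card A"
      and tall: "2 * card {i \<in> A. \<delta> < h i \<and> w i \<le> \<mu>} \<le> card A" for w h A
  proof -
    note finA = packable_finite[OF gpA] and dA = packable_dims[OF gpA]
    define n where "n = real (card A)"
    have "c0 / e \<le> n" using nA unfolding n_def n0_def by linarith
    then have c0: "c0 \<le> e * n" using assms(1) by (simp add: field_simps)
    define Mid where "Mid = {i \<in> A. \<mu> < max (w i) (h i) \<and> max (w i) (h i) \<le> \<delta>}"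
    define Lg where "Lg = {i \<in> A. \<mu> < w i \<and> \<mu> < h i}"
    define S where "S = {i \<in> A. w i \<le> \<mu> \<and> h i \<le> \<mu>}"
    define V where "V = {i \<in> A. \<delta> < h i \<and> w i \<le> \<mu>}"
    define Hs where "Hs = {i \<in> A. \<delta> < w i \<and> h i \<le> \<mu>}"
    have sub: "S \<subseteq> A" "V \<subseteq> A" "Hs \<subseteq> A" by (auto simp: S_def V_def Hs_def)
    have VH: "V \<inter> Hs = {}" "S \<inter> V = {}" "S \<inter> Hs = {}" using \<mu> by (auto simp: S_def V_def Hs_def)
    have cover: "A \<subseteq> Mid \<union> Lg \<union> S \<union> V \<union> Hs"
      by (auto simp: Mid_def Lg_def S_def V_def Hs_def max_def not_le)
    have fin: "finite S" "finite V" "finite Hs" "finite Lg" "finite Mid"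
      using finA by (auto simp: S_def V_def Hs_def Lg_def Mid_def)
    have cLg: "real (card Lg) \<le> 1 / (\<mu> * \<mu>)"
    proof -
      have "\<mu> * \<mu> \<le> w i * h i" if "i \<in> Lg" for i
        using that \<mu> by (intro mult_mono) (auto simp: Lg_def)
      then have "card Lg * (\<mu> * \<mu>) \<le> area w h Lg"
        unfolding area_def by (intro sum_bounded_below)
      also have "\<dots> \<le> 1 * 1" using packable_area[OF packable_subset[OF gpA]] by (auto simp: Lg_def)
      finally show ?thesis using \<mu> by (simp add: field_simps)
    qed
    have gpB: "packable w h 1 1 (V \<union> Hs)" using gpA by (rule packable_subset) (use sub in auto)
    obtain D y where Dy: "combed w h \<delta> V 1 1 (V \<union> Hs) D y"
      using packable_combed[OF gpB, of V \<delta>] assms(3) by (auto simp: V_def)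
    have BV: "(V \<union> Hs) \<inter> V = V" "V \<union> Hs - V = Hs" using VH by auto
    have D: "D \<subseteq> V" "2 * card D \<le> card {i \<in> V. h i < 1 - \<delta>}" "\<forall>i\<in>D. h i < 1 - \<delta>" "\<forall>i\<in>Hs. 0 \<le> y i"
      and lev: "\<And>t. 0 \<le> t \<Longrightarrow> t \<le> \<delta> \<Longrightarrow>
       packable w h (1 - sum w {i \<in> V - D. 1 - t \<le> h i}) (1 - t)
         ({i \<in> V - D. h i < 1 - t} \<union> {i \<in> Hs. t \<le> y i}) \<and>
       area w h {i \<in> Hs. y i + h i \<le> t} \<le> 1 * t \<and>
       sum w {i \<in> Hs. y i < t \<and> t < y i + h i} \<le> 1"
      using Dy assms(4) unfolding combed_def BV by auto
    have "\<exists>j<M. M * card {i \<in> Hs. \<sigma> j \<le> y i \<and> y i < \<sigma> (Suc j)} \<le> card Hs"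
    proof (rule pigeonhole_disjoint)
      show "disjoint_family_on (\<lambda>j. {i \<in> Hs. \<sigma> j \<le> y i \<and> y i < \<sigma> (Suc j)}) {..<M}"
      proof (rule disjoint_family_on_less)
        fix i j :: nat assume "i < j"
        then have "\<sigma> (Suc i) \<le> \<sigma> j" by (intro \<sigma>mono) simp
        then show "{k \<in> Hs. \<sigma> i \<le> y k \<and> y k < \<sigma> (Suc i)} \<inter> {k \<in> Hs. \<sigma> j \<le> y k \<and> y k < \<sigma> (Suc j)} = {}" by auto
      qed
    qed (use fin M0 in auto)
    then obtain j where j: "j < M" "M * card {i \<in> Hs. \<sigma> j \<le> y i \<and> y i < \<sigma> (Suc j)} \<le> card Hs" by blast
    define s where "s = \<sigma> j"
    define t where "t = \<sigma> (Suc j)"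
    have st: "s = \<rho> * t" "0 < s" "0 < t" "t \<le> e * \<delta>" "\<sigma> 0 \<le> t"
      unfolding s_def t_def using \<sigma>S[OF j(1)] \<sigma>0[of j] \<sigma>0[of "Suc j"] \<sigma>le[of "Suc j"] \<sigma>mono[of 0 "Suc j"]
      by blast+
    have "e * \<delta> \<le> e * 1" using assms by (intro mult_left_mono) auto
    moreover have "e * \<delta> \<le> 1 / 2 * \<delta>" using assms by (intro mult_right_mono) auto
    ultimately have t: "t \<le> e" "t \<le> \<delta>" "t < 1 / 2" using st(4) assms by linarith+
    have "\<rho> * t < 1 * t" using \<rho> st by (intro mult_strict_right_mono) auto
    then have slt: "s < t" "s \<le> \<delta>" using st(1) t(2) by linarith+
    \<comment> \<open>Wide items by depth: \<open>Wn\<close> in the range from \<open>s\<close> to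
      \<open>t\<close> and \<open>X\<close> across the level \<open>s\<close> are lost,
      \<open>Ht\<close> lies above \<open>s\<close>, and those from \<open>t\<close> on stay in
      \<open>R\<close>.\<close>
    define Wn where "Wn = {i \<in> Hs. s \<le> y i \<and> y i < t}"
    define X where "X = {i \<in> Hs. y i < s \<and> s < y i + h i}"
    define Ht where "Ht = {i \<in> Hs. y i + h i \<le> s}"
    define VT where "VT = {i \<in> V - D. 1 - t \<le> h i}"
    define R where "R = {i \<in> V - D. h i < 1 - t} \<union> {i \<in> Hs. t \<le> y i}"
    define \<alpha> where "\<alpha> = sum w VT"
    have gpR: "packable w h (1 - \<alpha>) (1 - t) R" using lev[of t] st t unfolding \<alpha>_def VT_def R_def by auto
    have \<alpha>1: "\<alpha> \<le> 1" using packable_nonneg[OF gpR] by simp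
    have fin2: "finite Wn" "finite X" "finite Ht" "finite VT" "finite R"
      using fin by (auto simp: Wn_def X_def Ht_def VT_def R_def)
    have cWn: "real (card Wn) \<le> e * n"
    proof -
      have "M * card Wn \<le> card A" using j(2) card_mono[OF finA sub(3)] by (simp add: Wn_def s_def t_def)
      then have "real (M * card Wn) \<le> n" unfolding n_def by (rule of_nat_mono)
      then have "real M * card Wn \<le> n" by simp
      then have "e * (M * card Wn) \<le> e * n" using assms(1) by (intro mult_left_mono) auto
      moreover have "1 * real (card Wn) \<le> M * e * card Wn" using M by (intro mult_right_mono) auto
      ultimately show ?thesis by (simp add: algebra_simps)
    qed
    have cX: "real (card X) \<le> 1 / \<delta>"
    proof -
      have "card X * \<delta> \<le> sum w X" using sum_bounded_below[of X \<delta> w] by (auto simp: X_def Hs_def)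
      also have "\<dots> \<le> 1" using lev[of s] st slt by (auto simp: X_def)
      finally show ?thesis using assms(3) by (simp add: field_simps)
    qed
    define \<beta> where "\<beta> = e * t / 128"
    have hHt: "sum h Ht \<le> \<beta>"
    proof -
      have "\<delta> * sum h Ht \<le> area w h Ht" unfolding area_def sum_distrib_left
      proof (rule sum_mono)
        fix i assume "i \<in> Ht"
        then have "\<delta> < w i" "0 < h i" using dA sub by (auto simp: Ht_def Hs_def)
        then show "\<delta> * h i \<le> w i * h i" by (intro mult_right_mono) auto
      qed
      also have "\<dots> \<le> s" using lev[of s] st slt by (auto simp: Ht_def)
      also have "\<dots> = \<delta> * \<beta>" by (simp add: st \<rho>_def \<beta>_def)
      finally show ?thesis using assms(3) by simp
    qed
    \<comment> \<open>If \<open>VT\<close> is wider than \<open>1 / 2\<close>, half of it is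
      dropped, so that \<open>\<alpha>' \<le> 1 / 2\<close> and items of width at most
      \<open>1 / 2\<close> fit beside the arm. Otherwise the share \<open>e \<ge> t\<close> is
      dropped: the items of \<open>VT\<close> have height at least \<open>1 - t\<close> but occupy
      columns of height \<open>1\<close>, and \<open>\<alpha>' \<le> (1 - t) * \<alpha>\<close>
      compensates for the area wasted there.\<close>
    define p where "p = (if 1 / 2 < \<alpha> then 1 / 2 else e)"
    have p: "e \<le> p" "p \<le> 1 / 2" using assms by (auto simp: p_def)
    have wpos: "0 < w i" "0 < h i" if "i \<in> A" for i using dA[OF that] by auto
    have wnn: "0 \<le> w i" "0 \<le> w i * h i" if "i \<in> A" for i using wpos[OF that] by auto
    have VTA: "VT \<subseteq> V" "V \<subseteq> A" by (auto simp: VT_def V_def)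
    have "\<exists>Y\<subseteq>VT. real (card Y) \<le> p * card VT + 1 \<and> sum w (VT - Y) \<le> (1 - p) * sum w VT"
    proof (rule drop_largest[OF fin2(4)])
      show "0 \<le> w i" if "i \<in> VT" for i using wpos[of i] that VTA by auto
    qed (use p assms(1) in auto)
    then obtain Y where Y: "Y \<subseteq> VT" "real (card Y) \<le> p * card VT + 1" "sum w (VT - Y) \<le> (1 - p) * \<alpha>"
      unfolding \<alpha>_def by blast
    define \<alpha>' where "\<alpha>' = sum w (VT - Y)"
    have \<alpha>0: "0 \<le> \<alpha>" "0 \<le> \<alpha>'" unfolding \<alpha>_def \<alpha>'_def using VTA by (auto intro!: sum_nonneg wnn)
    have \<alpha>'t: "\<alpha>' \<le> (1 - t) * \<alpha>"
      using Y(3) mult_right_mono[of "1 - p" "1 - t" \<alpha>] p t \<alpha>0 unfolding \<alpha>'_def by auto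
    have \<alpha>'h: "\<alpha>' \<le> 1 / 2"
    proof (cases "1 / 2 < \<alpha>")
      case True
      then show ?thesis using Y(3) \<alpha>1 by (simp add: p_def \<alpha>'_def)
    next
      case False
      then show ?thesis using \<alpha>'t mult_right_mono[of "1 - t" 1 \<alpha>] \<alpha>0 st by auto
    qed
    have \<alpha>\<alpha>: "\<alpha>' \<le> \<alpha>" using \<alpha>'t mult_right_mono[of "1 - t" 1 \<alpha>] \<alpha>0 st by auto
    have "\<exists>Z\<subseteq>S. real (card Z) \<le> e * card S + 1 \<and> area w h (S - Z) \<le> (1 - e) * area w h S"
      unfolding area_def
    proof (rule drop_largest[OF fin(1)])
      show "0 \<le> w i * h i" if "i \<in> S" for i using wpos[of i] that sub by auto
    qed (use assms(1,2) in auto)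
    then obtain Z where Z: "Z \<subseteq> S" "real (card Z) \<le> e * card S + 1"
      "area w h (S - Z) \<le> (1 - e) * area w h S" by blast
    define HL where "HL = {i \<in> Ht. 1 / 2 < w i}"
    define b where "b = sum h HL"
    have hsplit: "sum h Ht = b + sum h (Ht - HL)"
      unfolding b_def using fin2 by (subst sum.subset_diff[of HL]) (auto simp: HL_def)
    have hp: "0 < h i" if "i \<in> Ht" for i using that wpos sub by (auto simp: Ht_def)
    have b0: "0 \<le> b" unfolding b_def by (intro sum_nonneg less_imp_le hp) (auto simp: HL_def)
    have "0 \<le> sum h (Ht - HL)" by (intro sum_nonneg less_imp_le hp) auto
    then have b\<beta>: "b \<le> \<beta>" "sum h (Ht - HL) \<le> \<beta>" using hsplit hHt b0 by auto
    have \<beta>0: "0 \<le> \<beta>" using assms(1) st by (simp add: \<beta>_def)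
    have "e * t \<le> 1 * t" using assms(2) st by (intro mult_right_mono) auto
    then have \<beta>t: "\<beta> \<le> t / 128" by (simp add: \<beta>_def)
    define L where "L = (VT - Y) \<union> HL"
    have LV: "L \<inter> V = VT - Y" "L - V = HL"
      using VH VTA by (auto simp: L_def HL_def Ht_def)
    have "nest w h (1 - sum w (L \<inter> V)) (1 - sum h (L - V)) 1 1 L"
    proof (rule packable_nest)
      show "packable w h 1 1 L" using gpA by (rule packable_subset) (use VTA sub in \<open>auto simp: L_def HL_def Ht_def\<close>)
      show "1 / 2 < h i" if "i \<in> L \<inter> V" for i using that t unfolding LV by (auto simp: VT_def)
      show "1 / 2 < w i" if "i \<in> L - V" for i using that unfolding LV by (auto simp: HL_def)
    qed auto
    then have nest: "nest w h (1 - \<alpha>') (1 - b) 1 1 L" unfolding LV b_def \<alpha>'_def .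
    have long: "\<forall>i\<in>L. 1 / 2 < w i \<or> 1 / 2 < h i" using t by (auto simp: L_def HL_def VT_def)
    obtain R' where R': "R' \<subseteq> R" "card (R - R') \<le> l" "tight_packable w h \<kappa> k (1 - \<alpha>) (1 - t + \<tau>) R'"
      using slack[OF gpR] \<alpha>0 st by (auto simp: R_def V_def Hs_def)
    \<comment> \<open>The strip of height \<open>t\<close> has to hold three things: the slack
      \<open>\<tau>\<close>, the bottom arm of height \<open>b\<close>, and a container of height
      \<open>\<beta>\<close>.\<close>
    have "\<tau> \<le> t / 2" using st by (simp add: \<tau>_def)
    then have pkR: "tight_packable w h \<kappa> (k + 2) (1 - \<alpha>') (1 - b - \<beta>) R'"
      using \<alpha>\<alpha> b\<beta> \<beta>t st(3) by (intro tight_packable_pad[OF R'(3)]) linarith+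
    have RA: "R \<subseteq> V \<union> Hs" by (auto simp: R_def)
    have RS: "R' \<inter> (S - Z) = {}" using R'(1) RA VH by auto
    have "\<exists>S'\<subseteq>S - Z. container_packable e w h (k + 2) (1 - \<alpha>') (1 - b - \<beta>) (R' \<union> S') \<and>
      (S' = S - Z \<or> (1 - \<alpha>') * (1 - b - \<beta>) - area w h R' / \<kappa> - real (k + 2) * (3 * \<mu> / e) \<le> area w h S')"
    proof (rule tight_packable_fill[OF pkR \<kappa>(1) \<mu>(1) assms(1)])
      show "0 < w i \<and> w i \<le> \<mu> \<and> 0 < h i \<and> h i \<le> \<mu>" if "i \<in> S - Z" for i
        using wpos[of i] that by (simp add: S_def)
    qed (use assms(2) \<alpha>0 b0 \<beta>0 fin(1) RS in simp_all)
    then obtain S' where S': "S' \<subseteq> S - Z" "container_packable e w h (k + 2) (1 - \<alpha>') (1 - b - \<beta>) (R' \<union> S')"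
      "S' = S - Z \<or> (1 - \<alpha>') * (1 - b - \<beta>) - area w h R' / \<kappa> - real (k + 2) * (3 * \<mu> / e) \<le> area w h S'"
      by blast
    \<comment> \<open>By the area budget the alternative would make the area of \<open>S'\<close> at
      least that of \<open>S - Z\<close>, which is impossible for a proper subset since all items
      have positive area.\<close>
    have "S' = S - Z"
    proof -
      have aR: "area w h R' \<le> (1 - \<alpha>) * (1 - t)" using packable_area[OF packable_subset[OF gpR R'(1)]] .
      have "(1 - t) * \<alpha> \<le> area w h VT" unfolding \<alpha>_def area_def sum_distrib_left
      proof (rule sum_mono)
        fix i assume "i \<in> VT"
        then have "1 - t \<le> h i" "0 < w i" using wpos VTA by (auto simp: VT_def)
        then show "(1 - t) * w i \<le> w i * h i" by (simp add: mult.commute)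
      qed
      moreover have "area w h (S \<union> (R' \<union> VT)) = area w h S + (area w h R' + area w h VT)"
      proof -
        have "R' \<inter> VT = {}" using R'(1) VH by (auto simp: R_def VT_def)
        moreover have "S \<inter> (R' \<union> VT) = {}" using R'(1) RA VH VTA by auto
        ultimately show ?thesis using fin fin2 finite_subset[OF R'(1)] by (simp add: area_Un)
      qed
      moreover have "area w h (S \<union> (R' \<union> VT)) \<le> 1 * 1"
      proof (rule packable_area[OF packable_subset[OF gpA]])
        show "S \<union> (R' \<union> VT) \<subseteq> A" using sub VTA RA R'(1) by auto
      qed
      ultimately have total: "area w h S + area w h R' + (1 - t) * \<alpha> \<le> 1" by simp
      have nn: "0 \<le> area w h R'" "0 \<le> area w h S" unfolding area_def
        using sub RA R'(1) by (auto intro!: sum_nonneg wnn)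
      have es: "e * \<sigma> 0 \<le> e * t" using st assms(1) by (intro mult_left_mono) auto
      have "area w h (S - Z) \<le> (1 - \<alpha>') * (1 - b - \<beta>) - area w h R' * (1 + \<kappa>') - real (k + 2) * (3 * \<mu> / e)"
        by (rule area_budget[OF assms(1,2) st(3) t(1) \<alpha>0(2) \<alpha>'h \<alpha>'t \<alpha>1 b0 b\<beta>(1) \<beta>_def _ _ _ nn(1) aR _ nn(2) total])
          (use \<kappa>' \<mu>k es Z(3) in \<open>auto simp: \<kappa>'_def\<close>)
      then have le: "area w h (S - Z) \<le> (1 - \<alpha>') * (1 - b - \<beta>) - area w h R' / \<kappa> - real (k + 2) * (3 * \<mu> / e)"
        by (simp add: \<kappa>_def)
      show ?thesis
      proof (rule ccontr)
        assume ne: "S' \<noteq> S - Z"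
        then have "area w h (S - Z) \<le> area w h S'" using S'(3) le by linarith
        moreover have "area w h S' < area w h (S - Z)"
        proof -
          obtain i where i: "i \<in> (S - Z) - S'" using ne S'(1) by blast
          have "0 < w i * h i" using i wpos sub(1) by auto
          moreover have "w i * h i \<le> area w h ((S - Z) - S')"
            unfolding area_def using i fin sub(1) by (intro member_le_sum) (auto intro!: wnn)
          moreover have "area w h (S - Z) = area w h ((S - Z) - S') + area w h S'"
            unfolding area_def using S'(1) fin by (intro sum.subset_diff) auto
          ultimately show ?thesis by linarith
        qed
        ultimately show False by linarith
      qed
    qed
    define C where "C = (R' \<union> S') \<union> (Ht - HL)"
    \<comment> \<open>The wide items above \<open>s\<close> that are not long have width at most
      \<open>1 / 2 \<le> 1 - \<alpha>'\<close> and total height at most \<open>\<beta>\<close>, so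
      one more container holds them as a stack.\<close>
    have "container_packable e w h ((k + 2) + 1) (1 - \<alpha>') ((1 - b - \<beta>) + \<beta>) C"
      unfolding C_def
    proof (rule container_packable.hcut[OF S'(2)])
      show "container_packable e w h 1 (1 - \<alpha>') \<beta> (Ht - HL)"
        using fin2 b\<beta> \<alpha>'h wpos sub by (intro container_packable.hcont) (auto simp: HL_def Ht_def)
      show "(R' \<union> S') \<inter> (Ht - HL) = {}"
        using R'(1) S'(1) VH slt(1) hp by (fastforce simp: R_def Ht_def)
    qed
    then have cpC: "container_packable e w h (k + 3) (1 - \<alpha>') (1 - b) C" by (simp add: numeral_3_eq_3)
    have CL: "C \<inter> L = {}"
    proof -
      have "R \<inter> VT = {}" using VH by (auto simp: R_def VT_def)
      moreover have "R \<inter> Ht = {}" using VH slt(1) hp by (fastforce simp: R_def Ht_def)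
      moreover have "S \<inter> (VT \<union> Ht) = {}" using VH VTA by (auto simp: Ht_def)
      moreover have "Ht \<inter> VT = {}" using VH VTA by (auto simp: Ht_def)
      ultimately show ?thesis using R'(1) S'(1) unfolding C_def L_def HL_def by blast
    qed
    have LC: "LC_packable e (k + 3) w h (C \<union> L)" unfolding LC_packable_def using nest cpC CL long by blast
    have TA: "C \<union> L \<subseteq> A"
      using R'(1) RA S'(1) sub VTA by (auto simp: C_def L_def HL_def Ht_def)
    have lost: "A - (C \<union> L) \<subseteq> Mid \<union> (Lg \<union> (Z \<union> (D \<union> (Y \<union> (Wn \<union> (X \<union> (R - R')))))))"
    proof
      fix i assume i: "i \<in> A - (C \<union> L)"
      then have n: "i \<notin> R'" "i \<notin> S - Z" "i \<notin> Ht" "i \<notin> VT - Y"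
        using \<open>S' = S - Z\<close> by (auto simp: C_def L_def)
      consider "i \<in> Mid \<union> Lg" | "i \<in> S" | "i \<in> V" | "i \<in> Hs" using cover i by auto
      then show "i \<in> Mid \<union> (Lg \<union> (Z \<union> (D \<union> (Y \<union> (Wn \<union> (X \<union> (R - R')))))))"
      proof cases
        case 3
        then show ?thesis using n by (auto simp: VT_def R_def)
      next
        case 4
        then show ?thesis using n by (auto simp: Wn_def X_def Ht_def R_def not_le not_less)
      qed (use n in auto)
    qed
    have finD: "finite D" "finite Y" "finite Z" 
      using finite_subset[OF D(1) fin(2)] finite_subset[OF Y(1) fin2(4)] finite_subset[OF Z(1) fin(1)] by auto
    have "card (A - (C \<union> L)) \<le> card (Mid \<union> (Lg \<union> (Z \<union> (D \<union> (Y \<union> (Wn \<union> (X \<union> (R - R'))))))))"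
      using lost fin fin2 finD by (intro card_mono) auto
    also have "\<dots> \<le> card Mid + (card Lg + (card Z + (card D + (card Y + (card Wn + (card X + card (R - R')))))))"
      by (intro order_trans[OF card_Un_le] add_left_mono order_refl)
    finally have cl: "real (card (A - (C \<union> L))) \<le>
      card Mid + (card Lg + (card Z + (card D + (card Y + (card Wn + (card X + real (card (R - R')))))))) "
      by (simp flip: of_nat_add)
    \<comment> \<open>\<open>D\<close> is charged to items lower than \<open>1 - \<delta>\<close>,
      whereas those of \<open>VT\<close> have height at least
      \<open>1 - t \<ge> 1 - \<delta>\<close>; so half of \<open>VT\<close> may be dropped in
      addition to \<open>D\<close>.\<close>
    have "2 * card D + card VT \<le> card V"
    proof -
      have "card {i \<in> V. h i < 1 - \<delta>} + card VT = card ({i \<in> V. h i < 1 - \<delta>} \<union> VT)"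
        using fin fin2 t by (intro card_Un_disjoint[symmetric]) (auto simp: VT_def)
      also have "\<dots> \<le> card V" using fin VTA by (intro card_mono) auto
      finally show ?thesis using D(2) by simp
    qed
    then have "real (2 * card D + card VT) \<le> card V" using of_nat_le_iff by blast
    moreover have "real (2 * card V) \<le> n" using tall unfolding V_def n_def using of_nat_le_iff by blast
    ultimately have DV: "card D + 1 / 2 * card VT \<le> n / 4" by simp
    have "p * card VT \<le> 1 / 2 * card VT" using p by (intro mult_right_mono) auto
    then have cY: "card Y \<le> 1 / 2 * card VT + 1" using Y(2) by simp
    have "e * card S \<le> e * n" unfolding n_def using assms(1) card_mono[OF finA sub(1)] by (intro mult_left_mono) auto
    then have cZ: "card Z \<le> e * n + 1" using Z(2) by simp
    have cM: "card Mid \<le> e * n" using mid unfolding Mid_def n_def .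
    have "real (card (A - (C \<union> L))) \<le> n / 4 + 4 * (e * n)"
      using cl cM cLg cZ DV cY cWn cX R'(2) c0 unfolding c0_def by linarith
    moreover have "real (card (A - (C \<union> L))) = n - card (C \<union> L)"
      using TA finA finite_subset[OF TA] card_mono[OF finA TA]
      by (simp add: n_def card_Diff_subset of_nat_diff)
    ultimately have "(3 / 4 - 4 * e) * n \<le> card (C \<union> L)" by (simp add: algebra_simps)
    then show ?thesis using LC TA unfolding n_def by blast
  qed
  show ?thesis
    by (rule exI[of _ \<mu>], rule exI[of _ "k + 3"], rule exI[of _ n0], intro conjI allI impI)
      (rule \<mu> | rule main; assumption)+
qed

text \<open>Iterating the choice of \<open>\<mu>\<close> from \<open>1 / 2\<close> on gives disjoint
  ranges of medium sizes, and one of the first \<open>J\<close> ranges contains at most the fraction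
  \<open>e\<close> of the items. For this range, items that are tall and thin differ from those that
  are wide and flat, so one kind makes up at most half of all items; if it is the wide kind, the
  packing is transposed. The range depends on the packing, so the constants are summed over all
  ranges.\<close>

lemma LC_packable_large:
  fixes e :: real
  assumes "0 < e" "e \<le> 1 / 2"
  shows "\<exists>K n0. \<forall>w h A. packable w h 1 1 A \<longrightarrow> n0 \<le> card A \<longrightarrow>
    (\<exists>T\<subseteq>A. LC_packable e K w h T \<and> (3 / 4 - 4 * e) * card A \<le> card T)"
proof -
  define Q where "Q \<delta> \<mu> K n0 \<longleftrightarrow> 0 < \<mu> \<and> \<mu> < \<delta> \<and> (\<forall>w h A. packable w h 1 1 A \<longrightarrow> n0 \<le> card A \<longrightarrow>
    card {i \<in> A. \<mu> < max (w i) (h i) \<and> max (w i) (h i) \<le> \<delta>} \<le> e * card A \<longrightarrow>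
    2 * card {i \<in> A. \<delta> < h i \<and> w i \<le> \<mu>} \<le> card A \<longrightarrow>
    (\<exists>T\<subseteq>A. LC_packable e K w h T \<and> (3 / 4 - 4 * e) * card A \<le> card T))" for \<delta> \<mu> K n0
  have "\<exists>\<mu> K n0. Q \<delta> \<mu> K n0" if "0 < \<delta>" "\<delta> < 1" for \<delta>
    unfolding Q_def by (rule LC_packable_few_tall[OF assms that])
  then obtain \<mu> K n0 where P: "\<And>\<delta>. 0 < \<delta> \<Longrightarrow> \<delta> < 1 \<Longrightarrow> Q \<delta> (\<mu> \<delta>) (K \<delta>) (n0 \<delta>)" by metis
  define \<delta> where "\<delta> j = (\<mu> ^^ j) (1 / 2)" for j
  have \<delta>S: "\<delta> (Suc j) = \<mu> (\<delta> j)" for j by (simp add: \<delta>_def)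
  have \<delta>: "0 < \<delta> j \<and> \<delta> j < 1" for j
  proof (induction j)
    case (Suc j)
    then show ?case using P[of "\<delta> j"] unfolding \<delta>S Q_def by auto
  qed (simp add: \<delta>_def)
  have dec: "\<delta> (Suc j) < \<delta> j" for j using P[of "\<delta> j"] \<delta>[of j] unfolding \<delta>S Q_def by blast
  have anti: "\<delta> j \<le> \<delta> i" if "i \<le> j" for i j
    using that dec by (induction rule: dec_induct) (auto intro: less_imp_le order_trans)
  define J where "J = nat \<lceil>1 / e\<rceil>"
  have "1 / e \<le> J" unfolding J_def by linarith
  then have J: "1 \<le> J * e" using assms(1) by (simp add: field_simps)
  have J0: "0 < J" using J by (cases J) auto
  define K' where "K' = (\<Sum>j<J. K (\<delta> j))"
  define n0' where "n0' = (\<Sum>j<J. n0 (\<delta> j))"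
  show ?thesis
  proof (rule exI[of _ K'], rule exI[of _ n0'], intro allI impI)
    fix w h A assume A: "packable w h 1 1 A" "n0' \<le> card A"
    note fin = packable_finite[OF A(1)]
    let ?Z = "\<lambda>j. {i \<in> A. \<delta> (Suc j) < max (w i) (h i) \<and> max (w i) (h i) \<le> \<delta> j}"
    have "\<exists>j<J. J * card (?Z j) \<le> card A"
    proof (rule pigeonhole_disjoint[OF fin _ _ J0])
      show "disjoint_family_on ?Z {..<J}"
      proof (rule disjoint_family_on_less)
        fix i j :: nat assume "i < j"
        then have "\<delta> j \<le> \<delta> (Suc i)" by (intro anti) simp
        then show "?Z i \<inter> ?Z j = {}" by auto
      qed
    qed auto
    then obtain j where j: "j < J" "J * card (?Z j) \<le> card A" by blast
    have "real J * card (?Z j) \<le> card A" using of_nat_mono[OF j(2), where ?'a = real] by simp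
    then have "e * (J * card (?Z j)) \<le> e * card A" using assms(1) by (intro mult_left_mono) auto
    moreover have "1 * real (card (?Z j)) \<le> J * e * card (?Z j)" using J by (intro mult_right_mono) auto
    ultimately have mid: "card (?Z j) \<le> e * card A" by (simp add: algebra_simps)
    have K: "K (\<delta> j) \<le> K'" unfolding K'_def using j(1) by (intro member_le_sum) auto
    have n0: "n0 (\<delta> j) \<le> card A"
      using A(2) member_le_sum[of j "{..<J}" "\<lambda>j. n0 (\<delta> j)"] j(1) unfolding n0'_def by auto
    let ?V = "{i \<in> A. \<delta> j < h i \<and> w i \<le> \<delta> (Suc j)}" and ?H = "{i \<in> A. \<delta> j < w i \<and> h i \<le> \<delta> (Suc j)}"
    have "card ?V + card ?H = card (?V \<union> ?H)"
      using fin dec[of j] by (intro card_Un_disjoint[symmetric]) auto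
    also have "\<dots> \<le> card A" using fin by (intro card_mono) auto
    finally have VH: "2 * card ?V \<le> card A \<or> 2 * card ?H \<le> card A" by linarith
    have Qj: "\<exists>T\<subseteq>A. LC_packable e (K (\<delta> j)) w h T \<and> (3 / 4 - 4 * e) * card A \<le> card T"
      if "packable w h 1 1 A" "card {i \<in> A. \<delta> (Suc j) < max (w i) (h i) \<and> max (w i) (h i) \<le> \<delta> j} \<le> e * card A"
        "2 * card {i \<in> A. \<delta> j < h i \<and> w i \<le> \<delta> (Suc j)} \<le> card A" for w h
      using P[of "\<delta> j"] \<delta>[of j] n0 that unfolding \<delta>S Q_def by blast
    from VH show "\<exists>T\<subseteq>A. LC_packable e K' w h T \<and> (3 / 4 - 4 * e) * card A \<le> card T"
    proof
      assume V: "2 * card ?V \<le> card A"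
      obtain T where "T \<subseteq> A" "LC_packable e (K (\<delta> j)) w h T" "(3 / 4 - 4 * e) * card A \<le> card T"
        using Qj[OF A(1) mid V] by blast
      then show ?thesis using LC_packable_mono[OF _ K] by blast
    next
      assume H: "2 * card ?H \<le> card A"
      have mid': "card {i \<in> A. \<delta> (Suc j) < max (h i) (w i) \<and> max (h i) (w i) \<le> \<delta> j} \<le> e * card A"
        using mid by (simp add: max.commute)
      obtain T where "T \<subseteq> A" "LC_packable e (K (\<delta> j)) h w T" "(3 / 4 - 4 * e) * card A \<le> card T"
        using Qj[OF packable_swap[OF A(1)] mid' H] by blast
      then show ?thesis using LC_packable_mono[OF LC_packable_swap K] by blast
    qed
  qed
qed

theorem mainTheorem8:
  shows "\<exists>c>0. \<exists>K :: real \<Rightarrow> nat. \<forall>\<epsilon>>0.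
    \<forall>(N :: nat) (I :: nat set) (w :: nat \<Rightarrow> nat) (h :: nat \<Rightarrow> nat) OPT pos OPT_LC pos_LC.
      ggk_instance N I w h \<longrightarrow>
      optimal_packing N I w h OPT pos \<longrightarrow>
      optimal_LC_packing \<epsilon> (K \<epsilon>) N I w h OPT_LC pos_LC \<longrightarrow>
      real (card OPT_LC) \<ge> (3 / 4 - c * \<epsilon>) * real (card OPT)"
proof -
  define Q where "Q e K n0 \<longleftrightarrow> (\<forall>w h A. packable w h 1 1 A \<longrightarrow> n0 \<le> card A \<longrightarrow>
    (\<exists>T\<subseteq>A. LC_packable e K w h T \<and> (3 / 4 - 4 * e) * card A \<le> card T))" for e K n0
  have "\<exists>K n0. Q e K n0" if "0 < e" "e \<le> 1 / 2" for e
    unfolding Q_def by (rule LC_packable_large[OF that])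
  then obtain K n0 where Q: "\<And>e. 0 < e \<Longrightarrow> e \<le> 1 / 2 \<Longrightarrow> Q e (K e) (n0 e)" by metis
  note K = Q[unfolded Q_def, rule_format]
  show ?thesis
  \<comment> \<open>The summand \<open>n0 e\<close> is for optimal packings with fewer than
    \<open>n0 e\<close> items, in which each item becomes a container of its own.\<close>
  proof (rule exI[of _ 4], rule conjI, simp, rule exI[of _ "\<lambda>e. K e + n0 e"], intro allI impI)
    fix \<epsilon> :: real and N :: nat and I :: "nat set" and w h :: "nat \<Rightarrow> nat" and OPT pos OPT_LC pos_LC
    assume \<epsilon>: "0 < \<epsilon>" and inst: "ggk_instance N I w h" and opt: "optimal_packing N I w h OPT pos"
      and lc: "optimal_LC_packing \<epsilon> (K \<epsilon> + n0 \<epsilon>) N I w h OPT_LC pos_LC"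
    have feas: "feasible_packing N I w h OPT pos" using opt by (simp add: optimal_packing_def)
    have OI: "OPT \<subseteq> I" using feas by (simp add: feasible_packing_def)
    have N: "0 < real N" using inst by (simp add: ggk_instance_def)
    have best: "card T \<le> card OPT_LC" if "LC_packing \<epsilon> (K \<epsilon> + n0 \<epsilon>) N I w h T p" for T p
      using lc that unfolding optimal_LC_packing_def by blast
    let ?w = "\<lambda>i. real (w i)" and ?h = "\<lambda>i. real (h i)"
    have g: "packable ?w ?h N N OPT" using packable_of_feasible[OF inst feas] .
    show "(3 / 4 - 4 * \<epsilon>) * real (card OPT) \<le> real (card OPT_LC)"
    proof (cases "\<epsilon> \<le> 1 / 2")
      case False
      then have "(3 / 4 - 4 * \<epsilon>) * real (card OPT) \<le> 0" by (intro mult_nonpos_nonneg) auto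
      then show ?thesis by linarith
    next
      case True
      show ?thesis
      proof (cases "n0 \<epsilon> \<le> card OPT")
        case False
        have "container_packable \<epsilon> ?w ?h (K \<epsilon> + n0 \<epsilon>) N N OPT"
          using container_packable_singletons[OF g] by (rule container_packable_mono_k) (use False in simp)
        moreover have "nest ?w ?h N N N N {}" by (intro nest.inner) auto
        ultimately obtain p where "LC_packing \<epsilon> (K \<epsilon> + n0 \<epsilon>) N I w h (OPT \<union> {}) p"
          using LC_packing_of_nest[of w h N N N "{}" \<epsilon> "K \<epsilon> + n0 \<epsilon>" OPT I] OI by auto
        then have "card OPT \<le> card OPT_LC" using best by simp
        moreover have "(3 / 4 - 4 * \<epsilon>) * real (card OPT) \<le> 1 * real (card OPT)"
          using \<epsilon> by (intro mult_right_mono) auto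
        ultimately show ?thesis by simp
      next
        case large: True
        have "packable (\<lambda>i. 1 / real N * ?w i) (\<lambda>i. 1 / real N * ?h i) (1 / real N * N) (1 / real N * N) OPT"
          using N by (intro packable_scale[OF g]) auto
        then have "packable (\<lambda>i. 1 / real N * ?w i) (\<lambda>i. 1 / real N * ?h i) 1 1 OPT" using N by simp
        from K[OF \<epsilon> True this large] obtain T where T: "T \<subseteq> OPT"
          "LC_packable \<epsilon> (K \<epsilon>) (\<lambda>i. 1 / real N * ?w i) (\<lambda>i. 1 / real N * ?h i) T"
          "(3 / 4 - 4 * \<epsilon>) * card OPT \<le> card T" by blast
        obtain L C Wi Hi where L: "T = C \<union> L" "C \<inter> L = {}"
          "nest (\<lambda>i. 1 / real N * ?w i) (\<lambda>i. 1 / real N * ?h i) Wi Hi 1 1 L"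
          "container_packable \<epsilon> (\<lambda>i. 1 / real N * ?w i) (\<lambda>i. 1 / real N * ?h i) (K \<epsilon>) Wi Hi C"
          "\<forall>i\<in>L. 1 / 2 < 1 / real N * ?w i \<or> 1 / 2 < 1 / real N * ?h i"
          using T(2) unfolding LC_packable_def by blast
        have "nest ?w ?h (N * Wi) (N * Hi) N N L" using nest_scale[OF L(3) N] N by simp
        moreover have "container_packable \<epsilon> ?w ?h (K \<epsilon>) (N * Wi) (N * Hi) C" using container_packable_scale[OF L(4) N] N by simp
        then have "container_packable \<epsilon> ?w ?h (K \<epsilon> + n0 \<epsilon>) (N * Wi) (N * Hi) C" by (rule container_packable_mono_k) simp
        moreover have "long_item N w h i" if "i \<in> L" for i
          using L(5) that N by (auto simp: long_item_def field_simps)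
        ultimately obtain p where "LC_packing \<epsilon> (K \<epsilon> + n0 \<epsilon>) N I w h (C \<union> L) p"
          using LC_packing_of_nest[of w h "N * Wi" "N * Hi" N L \<epsilon> "K \<epsilon> + n0 \<epsilon>" C I] L(1,2) T(1) OI by blast
        then have "card T \<le> card OPT_LC" using best L(1) by simp
        then show ?thesis using T(3) by linarith
      qed
    qed
  qed
qed

end
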